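(* Let $\{\Phi_a\}_{a\in I}$ be a variable-radius family in $\mathbb{M}^{n+1}_\kappa$ with radius function $r$ and parametric field $\varphi_a$, and let $a\in I$ be such that $A_a(\eta,\eta)\not\equiv0$ on $\partial\Sigma$. Then $$\varphi_a\in\mathcal{K}(\Sigma_a,r(a))\quad\Longleftrightarrow\quad r'(a)=0 .$$
   Context: For $\kappa\in\{-1,0,1\}$, $\mathbb{M}^{n+1}_\kappa$ is the complete simply connected space form of constant sectional curvature $\kappa$, with Levi-Civita connection $\overline\nabla$. Fix $p_0$, let $\rho=\operatorname{dist}(p_0,\cdot)$, $B(r)$ the closed geodesic ball of radius $r>0$ centred at $p_0$ ($r<\pi$ if $\kappa=1$), $S(r)=\partial B(r)$, and $\operatorname{ct}_\kappa(t)=\coth t,\ 1/t,\ \cot t$ for $\kappa=-1,0,1$. A free boundary minimal immersion in $B(r)$ is a two-sided minimal immersion $\Phi:\Sigma^n\to B(r)$ of a compact manifold with nonempty boundary, with $\Phi(\partial\Sigma)\subset S(r)$ and outward unit conormal $\eta$ of $\partial\Sigma$ in $\Sigma$ equal to $\partial_\rho$ along $\partial\Sigma$. With $\nu$ a smooth unit normal, $A(X,Y)=\langle\overline\nabla_X\nu,Y\rangle$. A variable-radius family is a smooth map $\Phi:I\times\Sigma\to\mathbb{M}^{n+1}_\kappa$, $I\subset\mathbb{R}$ an interval, $\Sigma$ a compact $n$-manifold with boundary each of whose connected components has nonempty boundary, such that every $\Phi_a=\Phi(a,\cdot)$ is a free boundary minimal immersion in $B(r(a))$ (all balls centred at $p_0$),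 with $r:I\to(0,\infty)$ smooth and $r<\pi$ if $\kappa=1$. Unit normals $\nu_a$ are chosen smoothly in $a$; $\varphi_a=\langle\partial_a\Phi_a,\nu_a\rangle$ is the parametric field; $\Sigma_a$ denotes $\Sigma$ with the immersion $\Phi_a$. The Jacobi--Robin kernel of a free boundary minimal hypersurface $\Sigma\subset B(r)$ is $\mathcal{K}(\Sigma,r)=\{u\in C^\infty(\Sigma):\ \Delta u+(|A|^2+n\kappa)u=0,\ \partial_\eta u-\operatorname{ct}_\kappa(r)u=0\text{ on }\partial\Sigma\}$. *)

theory Defs
  imports "HOL-Analysis.Analysis"
begin

section \<open>Smooth maps on subsets of Euclidean spaces\<close>

fun Ck_on_open :: "nat \<Rightarrow> ('v::euclidean_space \<Rightarrow> 'b::real_normed_vector) \<Rightarrow> 'v set \<Rightarrow> bool" where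
  "Ck_on_open 0 f S \<longleftrightarrow> continuous_on S f"
| "Ck_on_open (Suc k) f S \<longleftrightarrow> (\<forall>x\<in>S. f differentiable (at x)) \<and>
     (\<forall>v. Ck_on_open k (\<lambda>x. frechet_derivative f (at x) v) S)"

text \<open>Smoothness on an arbitrary set means the existence of local smooth extensions to open sets.
  This covers half-spaces, intervals with end points, and products of the two.\<close>

definition smooth_on :: "'v::euclidean_space set \<Rightarrow> ('v \<Rightarrow> 'b::real_normed_vector) \<Rightarrow> bool" where
  "smooth_on S f \<longleftrightarrow> (\<forall>x\<in>S. \<exists>U g. open U \<and> x \<in> U \<and> (\<forall>k. Ck_on_open k g U) \<and> (\<forall>y\<in>S \<inter> U. g y = f y))"


section \<open>Smooth manifolds with boundary\<close>

text \<open>The boundary coordinate of the half-space is an arbitrary but fixed index.\<close>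

definition nidx :: "'n::finite" where
  "nidx = (SOME i. True)"

definition halfspace :: "(real^'n) set" where
  "halfspace = {x. 0 \<le> x $ nidx}"

type_synonym ('a, 'n) chart = "'a set \<times> ('a \<Rightarrow> real^'n)"

definition chart_image :: "('a, 'n::finite) chart \<Rightarrow> (real^'n) set" where
  "chart_image C = snd C ` fst C"

definition local_rep :: "('a, 'n::finite) chart \<Rightarrow> ('a \<Rightarrow> 'b) \<Rightarrow> real^'n \<Rightarrow> 'b" where
  "local_rep C u = (\<lambda>x. u (inv_into (fst C) (snd C) x))"

definition smooth_manifold_with_boundary :: "'a topology \<Rightarrow> ('a, 'n::finite) chart set \<Rightarrow> bool" where
  "smooth_manifold_with_boundary X atl \<longleftrightarrow>
     Hausdorff_space X \<and> second_countable X \<and> (\<Union>C\<in>atl. fst C) = topspace X \<and>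
     (\<forall>C\<in>atl. openin X (fst C) \<and> openin (top_of_set halfspace) (chart_image C) \<and>
        homeomorphic_map (subtopology X (fst C)) (top_of_set (chart_image C)) (snd C)) \<and>
     (\<forall>C\<in>atl. \<forall>D\<in>atl. smooth_on (snd C ` (fst C \<inter> fst D)) (local_rep C (snd D)))"

definition mfd_boundary :: "'a topology \<Rightarrow> ('a, 'n::finite) chart set \<Rightarrow> 'a set" where
  "mfd_boundary X atl = {p \<in> topspace X. \<exists>C\<in>atl. p \<in> fst C \<and> snd C p $ nidx = 0}"

definition smooth_on_mfd :: "('a, 'n::finite) chart set \<Rightarrow> ('a \<Rightarrow> 'b::real_normed_vector) \<Rightarrow> bool" where
  "smooth_on_mfd atl u \<longleftrightarrow> (\<forall>C\<in>atl. smooth_on (chart_image C) (local_rep C u))"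

definition smooth_family :: "real set \<Rightarrow> ('a, 'n::finite) chart set \<Rightarrow>
    (real \<Rightarrow> 'a \<Rightarrow> 'b::real_normed_vector) \<Rightarrow> bool" where
  "smooth_family I atl F \<longleftrightarrow>
     (\<forall>C\<in>atl. smooth_on (I \<times> chart_image C) (\<lambda>(s, x). local_rep C (F s) x))"


section \<open>The space forms\<close>

text \<open>All three space forms are realised at once in \<open>\<real> \<times> \<real>\<^sup>n\<^sup>+\<^sup>1\<close> with the bilinear form
  \<open>\<kappa> t s + x \<bullet> y\<close>: for \<open>\<kappa> = 1\<close> the unit sphere, for \<open>\<kappa> = -1\<close> the upper sheet of the hyperboloid
  in Minkowski space, for \<open>\<kappa> = 0\<close> the affine hyperplane \<open>t = 1\<close> with the Euclidean metric.
  The Riemannian metric is the restriction of the form to tangent spaces.\<close>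

definition space_form :: "real \<Rightarrow> (real \<times> 'e::euclidean_space) set" where
  "space_form \<kappa> = {p. (fst p)\<^sup>2 + \<kappa> * (snd p \<bullet> snd p) = 1 \<and> (\<kappa> \<le> 0 \<longrightarrow> fst p > 0)}"

definition mform :: "real \<Rightarrow> real \<times> 'e::euclidean_space \<Rightarrow> real \<times> 'e \<Rightarrow> real" where
  "mform \<kappa> v w = \<kappa> * fst v * fst w + snd v \<bullet> snd w"

definition tangent_space :: "real \<Rightarrow> real \<times> 'e::euclidean_space \<Rightarrow> (real \<times> 'e) set" where
  "tangent_space \<kappa> p = {w. fst p * fst w + \<kappa> * (snd p \<bullet> snd w) = 0}"

text \<open>The Levi-Civita connection of the space form is the tangential part of the flat derivative \<open>w\<close>
  of a tangent field at \<open>p\<close>. On the quadrics \<open>mform \<kappa> p p = \<kappa>\<close>, so this is the orthogonal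
  projection; for \<open>\<kappa> = 0\<close> nothing has to be removed.\<close>

definition covariant :: "real \<Rightarrow> real \<times> 'e::euclidean_space \<Rightarrow> real \<times> 'e \<Rightarrow> real \<times> 'e" where
  "covariant \<kappa> p w = w - (\<kappa> * mform \<kappa> w p) *\<^sub>R p"

definition curve_lengths :: "real \<Rightarrow> real \<times> 'e::euclidean_space \<Rightarrow> real \<times> 'e \<Rightarrow> real set" where
  "curve_lengths \<kappa> p q = {L. \<exists>\<gamma> \<gamma>'.
     (\<forall>t\<in>{0..1}. \<gamma> t \<in> space_form \<kappa> \<and> (\<gamma> has_vector_derivative \<gamma>' t) (at t within {0..1})) \<and>
     continuous_on {0..1} \<gamma>' \<and> \<gamma> 0 = p \<and> \<gamma> 1 = q \<and>
     L = integral {0..1} (\<lambda>t. sqrt (mform \<kappa> (\<gamma>' t) (\<gamma>' t)))}"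

definition geo_dist :: "real \<Rightarrow> real \<times> 'e::euclidean_space \<Rightarrow> real \<times> 'e \<Rightarrow> real" where
  "geo_dist \<kappa> p q = Inf (curve_lengths \<kappa> p q)"

definition geo_ball :: "real \<Rightarrow> real \<times> 'e::euclidean_space \<Rightarrow> real \<Rightarrow> (real \<times> 'e) set" where
  "geo_ball \<kappa> p0 r = {p \<in> space_form \<kappa>. geo_dist \<kappa> p0 p \<le> r}"

definition geo_sphere :: "real \<Rightarrow> real \<times> 'e::euclidean_space \<Rightarrow> real \<Rightarrow> (real \<times> 'e) set" where
  "geo_sphere \<kappa> p0 r = (top_of_set (space_form \<kappa>)) frontier_of (geo_ball \<kappa> p0 r)"

text \<open>The derivative within the space form is determined only on the tangent space, so the gradient,
  being tangent, is unique.\<close>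

definition is_gradient :: "real \<Rightarrow> (real \<times> 'e::euclidean_space \<Rightarrow> real) \<Rightarrow> real \<times> 'e \<Rightarrow> real \<times> 'e \<Rightarrow> bool" where
  "is_gradient \<kappa> h p V \<longleftrightarrow> V \<in> tangent_space \<kappa> p \<and>
     (h has_derivative (\<lambda>w. mform \<kappa> V w)) (at p within space_form \<kappa>)"

definition ct :: "real \<Rightarrow> real \<Rightarrow> real" where
  "ct \<kappa> t = (if \<kappa> = -1 then cosh t / sinh t else if \<kappa> = 0 then 1 / t else cot t)"


section \<open>Local geometry of an immersed hypersurface\<close>

text \<open>Here \<open>f\<close> is the representation of the immersion in a chart. Since chart images are relatively open
  in the half-space, derivatives within the half-space are ordinary derivatives at interior points
  and one-sided at boundary points.\<close>

definition pd :: "'n::finite \<Rightarrow> (real^'n \<Rightarrow> 'b::real_normed_vector) \<Rightarrow> real^'n \<Rightarrow> 'b" where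
  "pd i f x = frechet_derivative f (at x within halfspace) (axis i 1)"

definition push :: "(real^'n::finite \<Rightarrow> 'b::real_normed_vector) \<Rightarrow> real^'n \<Rightarrow> real^'n \<Rightarrow> 'b" where
  "push f x v = (\<Sum>i\<in>UNIV. (v $ i) *\<^sub>R pd i f x)"

definition gmat :: "real \<Rightarrow> (real^'n::finite \<Rightarrow> real \<times> 'e::euclidean_space) \<Rightarrow> real^'n \<Rightarrow> real^'n^'n" where
  "gmat \<kappa> f x = (\<chi> i j. mform \<kappa> (pd i f x) (pd j f x))"

definition ginv :: "real \<Rightarrow> (real^'n::finite \<Rightarrow> real \<times> 'e::euclidean_space) \<Rightarrow> real^'n \<Rightarrow> real^'n^'n" where
  "ginv \<kappa> f x = matrix_inv (gmat \<kappa> f x)"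

text \<open>The Christoffel symbol with upper index \<open>k\<close> and lower indices \<open>i j\<close>.\<close>

definition christoffel :: "real \<Rightarrow> (real^'n::finite \<Rightarrow> real \<times> 'e::euclidean_space) \<Rightarrow>
    'n \<Rightarrow> 'n \<Rightarrow> 'n \<Rightarrow> real^'n \<Rightarrow> real" where
  "christoffel \<kappa> f k i j x = 1/2 * (\<Sum>l\<in>UNIV. ginv \<kappa> f x $ k $ l *
     (pd i (\<lambda>y. gmat \<kappa> f y $ j $ l) x + pd j (\<lambda>y. gmat \<kappa> f y $ i $ l) x
      - pd l (\<lambda>y. gmat \<kappa> f y $ i $ j) x))"

text \<open>Laplace--Beltrami operator of the induced metric: the metric trace of the Hessian.\<close>

definition laplacian :: "real \<Rightarrow> (real^'n::finite \<Rightarrow> real \<times> 'e::euclidean_space) \<Rightarrow>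
    (real^'n \<Rightarrow> real) \<Rightarrow> real^'n \<Rightarrow> real" where
  "laplacian \<kappa> f u x = (\<Sum>i\<in>UNIV. \<Sum>j\<in>UNIV. ginv \<kappa> f x $ i $ j *
     (pd i (pd j u) x - (\<Sum>k\<in>UNIV. christoffel \<kappa> f k i j x * pd k u x)))"

definition sff :: "real \<Rightarrow> (real^'n::finite \<Rightarrow> real \<times> 'e::euclidean_space) \<Rightarrow>
    (real^'n \<Rightarrow> real \<times> 'e) \<Rightarrow> real^'n \<Rightarrow> real^'n^'n" where
  "sff \<kappa> f \<nu> x = (\<chi> i j. mform \<kappa> (covariant \<kappa> (f x) (pd i \<nu> x)) (pd j f x))"

definition mean_curvature :: "real \<Rightarrow> (real^'n::finite \<Rightarrow> real \<times> 'e::euclidean_space) \<Rightarrow>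
    (real^'n \<Rightarrow> real \<times> 'e) \<Rightarrow> real^'n \<Rightarrow> real" where
  "mean_curvature \<kappa> f \<nu> x = (\<Sum>i\<in>UNIV. \<Sum>j\<in>UNIV. ginv \<kappa> f x $ i $ j * sff \<kappa> f \<nu> x $ i $ j)"

definition sff_norm2 :: "real \<Rightarrow> (real^'n::finite \<Rightarrow> real \<times> 'e::euclidean_space) \<Rightarrow>
    (real^'n \<Rightarrow> real \<times> 'e) \<Rightarrow> real^'n \<Rightarrow> real" where
  "sff_norm2 \<kappa> f \<nu> x = (\<Sum>i\<in>UNIV. \<Sum>j\<in>UNIV. \<Sum>k\<in>UNIV. \<Sum>l\<in>UNIV.
     ginv \<kappa> f x $ i $ k * ginv \<kappa> f x $ j $ l * sff \<kappa> f \<nu> x $ i $ j * sff \<kappa> f \<nu> x $ k $ l)"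

text \<open>Coordinates of the outward unit conormal at a boundary point \<open>x\<close>; the vector itself is
  \<open>push f x (conormal \<kappa> f x)\<close>.\<close>

definition conormal :: "real \<Rightarrow> (real^'n::finite \<Rightarrow> real \<times> 'e::euclidean_space) \<Rightarrow> real^'n \<Rightarrow> real^'n" where
  "conormal \<kappa> f x = (THE N. N $ nidx < 0 \<and> N \<bullet> (gmat \<kappa> f x *v N) = 1 \<and>
     (\<forall>v. v $ nidx = 0 \<longrightarrow> N \<bullet> (gmat \<kappa> f x *v v) = 0))"

definition sff_conormal :: "real \<Rightarrow> (real^'n::finite \<Rightarrow> real \<times> 'e::euclidean_space) \<Rightarrow>
    (real^'n \<Rightarrow> real \<times> 'e) \<Rightarrow> real^'n \<Rightarrow> real" where
  "sff_conormal \<kappa> f \<nu> x = conormal \<kappa> f x \<bullet> (sff \<kappa> f \<nu> x *v conormal \<kappa> f x)"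


section \<open>Free boundary minimal immersions and variable-radius families\<close>

text \<open>Pointwise conditions below are imposed in every chart of the atlas; being invariant under change
  of chart, they do not depend on the choice of chart at a point.\<close>

definition immersion :: "real \<Rightarrow> ('a, 'n::finite) chart set \<Rightarrow> ('a \<Rightarrow> real \<times> 'e::euclidean_space) \<Rightarrow> bool" where
  "immersion \<kappa> atl F \<longleftrightarrow> smooth_on_mfd atl F \<and>
     (\<forall>C\<in>atl. \<forall>x\<in>chart_image C. local_rep C F x \<in> space_form \<kappa> \<and> inj (push (local_rep C F) x))"

definition unit_normal :: "real \<Rightarrow> ('a, 'n::finite) chart set \<Rightarrow> ('a \<Rightarrow> real \<times> 'e::euclidean_space) \<Rightarrow>
    ('a \<Rightarrow> real \<times> 'e) \<Rightarrow> bool" where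
  "unit_normal \<kappa> atl F \<nu> \<longleftrightarrow> smooth_on_mfd atl \<nu> \<and>
     (\<forall>C\<in>atl. \<forall>x\<in>chart_image C.
        local_rep C \<nu> x \<in> tangent_space \<kappa> (local_rep C F x) \<and>
        mform \<kappa> (local_rep C \<nu> x) (local_rep C \<nu> x) = 1 \<and>
        (\<forall>v. mform \<kappa> (local_rep C \<nu> x) (push (local_rep C F) x v) = 0))"

definition two_sided_minimal_immersion :: "real \<Rightarrow> ('a, 'n::finite) chart set \<Rightarrow>
    ('a \<Rightarrow> real \<times> 'e::euclidean_space) \<Rightarrow> bool" where
  "two_sided_minimal_immersion \<kappa> atl F \<longleftrightarrow> immersion \<kappa> atl F \<and>
     (\<exists>\<nu>. unit_normal \<kappa> atl F \<nu> \<and>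
        (\<forall>C\<in>atl. \<forall>x\<in>chart_image C. mean_curvature \<kappa> (local_rep C F) (local_rep C \<nu>) x = 0))"

definition free_boundary_minimal_immersion :: "real \<Rightarrow> real \<times> 'e::euclidean_space \<Rightarrow> real \<Rightarrow>
    'a topology \<Rightarrow> ('a, 'n::finite) chart set \<Rightarrow> ('a \<Rightarrow> real \<times> 'e) \<Rightarrow> bool" where
  "free_boundary_minimal_immersion \<kappa> p0 r X atl F \<longleftrightarrow>
     smooth_manifold_with_boundary X atl \<and> compact_space X \<and> mfd_boundary X atl \<noteq> {} \<and>
     two_sided_minimal_immersion \<kappa> atl F \<and>
     F ` topspace X \<subseteq> geo_ball \<kappa> p0 r \<and>
     F ` mfd_boundary X atl \<subseteq> geo_sphere \<kappa> p0 r \<and>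
     (\<forall>C\<in>atl. \<forall>x\<in>chart_image C. x $ nidx = 0 \<longrightarrow>
        is_gradient \<kappa> (geo_dist \<kappa> p0) (local_rep C F x)
          (push (local_rep C F) x (conormal \<kappa> (local_rep C F) x)))"

text \<open>The interval is required to be nondegenerate, so that derivatives within it make sense; it may
  contain end points, where derivatives are one-sided. The smooth choice \<open>\<nu>\<close> of unit normals is part
  of the data.\<close>

definition variable_radius_family :: "real \<Rightarrow> real \<times> 'e::euclidean_space \<Rightarrow> 'a topology \<Rightarrow>
    ('a, 'n::finite) chart set \<Rightarrow> real set \<Rightarrow> (real \<Rightarrow> real) \<Rightarrow> (real \<Rightarrow> 'a \<Rightarrow> real \<times> 'e) \<Rightarrow>
    (real \<Rightarrow> 'a \<Rightarrow> real \<times> 'e) \<Rightarrow> bool" where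
  "variable_radius_family \<kappa> p0 X atl I r \<Phi> \<nu> \<longleftrightarrow>
     is_interval I \<and> interior I \<noteq> {} \<and>
     smooth_manifold_with_boundary X atl \<and> compact_space X \<and>
     (\<forall>K\<in>connected_components_of X. K \<inter> mfd_boundary X atl \<noteq> {}) \<and>
     smooth_on I r \<and> (\<forall>s\<in>I. 0 < r s \<and> (\<kappa> = 1 \<longrightarrow> r s < pi)) \<and>
     smooth_family I atl \<Phi> \<and>
     (\<forall>s\<in>I. free_boundary_minimal_immersion \<kappa> p0 (r s) X atl (\<Phi> s)) \<and>
     smooth_family I atl \<nu> \<and> (\<forall>s\<in>I. unit_normal \<kappa> atl (\<Phi> s) (\<nu> s))"

definition parametric_field :: "real \<Rightarrow> real set \<Rightarrow> (real \<Rightarrow> 'a \<Rightarrow> real \<times> 'e::euclidean_space) \<Rightarrow>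
    (real \<Rightarrow> 'a \<Rightarrow> real \<times> 'e) \<Rightarrow> real \<Rightarrow> 'a \<Rightarrow> real" where
  "parametric_field \<kappa> I \<Phi> \<nu> a p =
     mform \<kappa> (vector_derivative (\<lambda>s. \<Phi> s p) (at a within I)) (\<nu> a p)"

definition jacobi_robin_kernel :: "real \<Rightarrow> ('a, 'n::finite) chart set \<Rightarrow>
    ('a \<Rightarrow> real \<times> 'e::euclidean_space) \<Rightarrow> ('a \<Rightarrow> real \<times> 'e) \<Rightarrow> real \<Rightarrow> ('a \<Rightarrow> real) set" where
  "jacobi_robin_kernel \<kappa> atl F \<nu> r = {u. smooth_on_mfd atl u \<and>
     (\<forall>C\<in>atl. \<forall>x\<in>chart_image C.
        laplacian \<kappa> (local_rep C F) (local_rep C u) x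
        + (sff_norm2 \<kappa> (local_rep C F) (local_rep C \<nu>) x + real CARD('n) * \<kappa>) * local_rep C u x = 0) \<and>
     (\<forall>C\<in>atl. \<forall>x\<in>chart_image C. x $ nidx = 0 \<longrightarrow>
        push (local_rep C u) x (conormal \<kappa> (local_rep C F) x) - ct \<kappa> r * local_rep C u x = 0)}"

definition sff_conormal_not_identically_zero :: "real \<Rightarrow> ('a, 'n::finite) chart set \<Rightarrow>
    ('a \<Rightarrow> real \<times> 'e::euclidean_space) \<Rightarrow> ('a \<Rightarrow> real \<times> 'e) \<Rightarrow> bool" where
  "sff_conormal_not_identically_zero \<kappa> atl F \<nu> \<longleftrightarrow>
     (\<exists>C\<in>atl. \<exists>x\<in>chart_image C. x $ nidx = 0 \<and> sff_conormal \<kappa> (local_rep C F) (local_rep C \<nu>) x \<noteq> 0)"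

end

theory Submission
  imports Defs
begin

text \<open>On the boundary sphere the gradient of the distance is
  \<open>\<nabla>\<rho> = (cs r F - p\<^sub>0) / sn r\<close> in the ambient linear model, so the free boundary condition says
  \<open>\<langle>\<nu>, F - p\<^sub>0\<rangle> = 0\<close> for every parameter. Differentiating this along the boundary shows that
  \<open>\<eta>\<close> is a principal direction; differentiating it in the parameter, and using that the \<open>\<eta>\<close>-component of
  the velocity is \<open>r'\<close>, gives \<open>\<partial>\<^sub>\<eta> \<phi> - ct r \<phi> = r' A(\<eta>, \<eta>)\<close>. The Jacobi equation for
  \<open>\<phi>\<close> always holds: it is the derivative of \<open>H = 0\<close> in the parameter. The tangential part of the velocity
  drops out because the same computation, applied to the coordinate directions in place of the parameter,
  shows that \<open>\<Delta>\<nu>\<close> has no tangential component.\<close>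

section \<open>Derivatives of smooth maps\<close>

text \<open>The linear model removes curvature tensors from the computation: derivatives are flat,
  second derivatives commute, and the space form is felt only through the component of second
  derivatives along the position vector. Traced against the metric, this component is what produces
  the term n \<kappa> of the Jacobi operator. Two obstacles shape the rest. The distance is an
  infimum of curve lengths, so a formula for its gradient presupposes a proof that geodesics
  minimise. And the geometric relations hold only on a product of an interval, possibly with end
  points, and a relatively open piece of a half-space, while derivatives are taken of arbitrary
  smooth extensions that satisfy no relation elsewhere. Relations are therefore differentiated only
  along coordinate directions, along which the product accumulates at each of its points.\<close>

abbreviation dd :: "'v::euclidean_space \<Rightarrow> ('v \<Rightarrow> 'b::real_normed_vector) \<Rightarrow> 'v \<Rightarrow> 'b" where
  "dd v f \<equiv> \<lambda>z. frechet_derivative f (at z) v"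

abbreviation smooth_open :: "('v::euclidean_space \<Rightarrow> 'b::real_normed_vector) \<Rightarrow> 'v set \<Rightarrow> bool" where
  "smooth_open f U \<equiv> (\<forall>k. Ck_on_open k f U)"

text \<open>\<open>frechet_derivative\<close> is a choice from the derivative relation, and at z
  this relation is the same for both maps; the two choices coincide even where no derivative
  exists.\<close>

lemma dd_cong_open:
  assumes "open U" "z \<in> U" "\<And>y. y \<in> U \<Longrightarrow> f y = g y"
  shows "frechet_derivative f (at z) = frechet_derivative g (at z)"
proof -
  have "(f has_derivative D) (at z) \<longleftrightarrow> (g has_derivative D) (at z)" for D
    using has_derivative_transform_within_open[OF _ assms(1,2)] assms(3) by metis
  then show ?thesis
    unfolding frechet_derivative_def by simp
qed

lemma Ck_on_open_cong:
  assumes "open U" "\<And>y. y \<in> U \<Longrightarrow> f y = g y" "Ck_on_open k f U"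
  shows "Ck_on_open k g U"
  using assms(2,3)
proof (induction k arbitrary: f g)
  case 0
  then show ?case using continuous_on_cong by fastforce
next
  case (Suc k)
  have D: "frechet_derivative f (at z) = frechet_derivative g (at z)" if "z \<in> U" for z
    using dd_cong_open[OF assms(1) that] Suc.prems(1) by blast
  have "g differentiable (at x)" if "x \<in> U" for x
    using Suc.prems that unfolding differentiable_def
    by (metis Ck_on_open.simps(2) assms(1) differentiable_def has_derivative_transform_within_open)
  moreover have "Ck_on_open k (dd v g) U" for v
    using Suc.IH[of "dd v f" "dd v g"] Suc.prems(2) D by simp
  ultimately show ?case by simp
qed

lemma Ck_on_open_Suc_imp: "Ck_on_open (Suc k) f U \<Longrightarrow> Ck_on_open k f U"
proof (induction k arbitrary: f)
  case 0
  then show ?case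
    by (auto intro!: differentiable_imp_continuous_on simp: differentiable_on_def
        intro: differentiable_at_imp_differentiable_on differentiable_at_withinI)
next
  case (Suc k)
  then show ?case by (metis Ck_on_open.simps(2))
qed

lemma Ck_on_open_const: "Ck_on_open k (\<lambda>z. c) U"
  by (induction k arbitrary: c) auto

lemma Ck_on_open_subset: "Ck_on_open k f U \<Longrightarrow> V \<subseteq> U \<Longrightarrow> Ck_on_open k f V"
  by (induction k arbitrary: f) (auto intro: continuous_on_subset)

lemma smooth_open_dd: "smooth_open f U \<Longrightarrow> smooth_open (dd v f) U"
  by (metis Ck_on_open.simps(2))

lemma smooth_open_differentiable: "smooth_open f U \<Longrightarrow> z \<in> U \<Longrightarrow> f differentiable (at z)"
  by (metis Ck_on_open.simps(2))

lemma dd_add: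
  assumes "f differentiable (at z)" "g differentiable (at z)"
  shows "dd v (\<lambda>x. f x + g x) z = dd v f z + dd v g z"
  using has_derivative_add[OF assms[unfolded frechet_derivative_works]] frechet_derivative_at
  by (metis (mono_tags))

lemma dd_bilinear:
  assumes "bounded_bilinear h" "f differentiable (at z)" "g differentiable (at z)"
  shows "dd v (\<lambda>x. h (f x) (g x)) z = h (f z) (dd v g z) + h (dd v f z) (g z)"
proof -
  have "((\<lambda>x. h (f x) (g x)) has_derivative (\<lambda>v. h (f z) (dd v g z) + h (dd v f z) (g z))) (at z)"
    by (rule bounded_bilinear.FDERIV[OF assms(1) assms(2,3)[unfolded frechet_derivative_works]])
  from frechet_derivative_at[OF this] show ?thesis by metis
qed

lemma differentiable_bilinear:
  assumes "bounded_bilinear h" "f differentiable (at z)" "g differentiable (at z)"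
  shows "(\<lambda>x. h (f x) (g x)) differentiable (at z)"
  using bounded_bilinear.FDERIV[OF assms(1)] assms(2,3) unfolding differentiable_def by blast

lemma Ck_on_open_add:
  assumes "open U" "Ck_on_open k f U" "Ck_on_open k g U"
  shows "Ck_on_open k (\<lambda>x. f x + g x) U"
  using assms(2,3)
proof (induction k arbitrary: f g)
  case 0
  then show ?case by (auto intro: continuous_on_add)
next
  case (Suc k)
  have "Ck_on_open k (dd v (\<lambda>x. f x + g x)) U" for v
    by (rule Ck_on_open_cong[OF assms(1) _ Suc.IH[of "dd v f" "dd v g"]])
      (use Suc.prems in \<open>auto simp: dd_add\<close>)
  then show ?case using Suc.prems by auto
qed

text \<open>The Leibniz rule pairs one differentiated with one undifferentiated factor. The latter
  enters the induction hypothesis at one order less than is known of it, hence the use of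
  \<open>Ck_on_open_Suc_imp\<close>.\<close>

lemma Ck_on_open_bilinear:
  assumes "bounded_bilinear h" "open U" "Ck_on_open k f U" "Ck_on_open k g U"
  shows "Ck_on_open k (\<lambda>x. h (f x) (g x)) U"
  using assms(3,4)
proof (induction k arbitrary: f g)
  case 0
  then show ?case using bounded_bilinear.continuous_on[OF assms(1)] by auto
next
  case (Suc k)
  have "Ck_on_open k (dd v (\<lambda>x. h (f x) (g x))) U" for v
  proof (rule Ck_on_open_cong[OF assms(2)])
    show "Ck_on_open k (\<lambda>z. h (f z) (dd v g z) + h (dd v f z) (g z)) U"
      using Suc.prems Suc.prems[THEN Ck_on_open_Suc_imp]
      by (intro Ck_on_open_add assms(2) Suc.IH) simp_all
  qed (use Suc.prems in \<open>simp add: dd_bilinear[OF assms(1)]\<close>)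
  then show ?case using Suc.prems by (simp add: differentiable_bilinear[OF assms(1)])
qed

lemma has_derivative_slice:
  assumes "f differentiable (at (a, x))"
  shows "((\<lambda>x. f (a, x)) has_derivative (\<lambda>v. dd (0, v) f (a, x))) (at x)"
proof -
  have "((\<lambda>x. (a, x)) has_derivative (\<lambda>v. (0, v))) (at x)"
    by (auto intro!: derivative_eq_intros)
  from diff_chain_at[OF this assms[unfolded frechet_derivative_works]]
  show ?thesis by (simp add: o_def)
qed

text \<open>Freezing the first variable turns a jointly smooth extension of a family into a smooth
  extension of its member at one parameter.\<close>

lemma Ck_on_open_slice:
  fixes f :: "'u::euclidean_space \<times> 'v::euclidean_space \<Rightarrow> 'b::real_normed_vector"
  assumes "open U" "Ck_on_open k f U"
  shows "Ck_on_open k (\<lambda>x. f (a, x)) (Pair a -` U)"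
  using assms(2)
proof (induction k arbitrary: f)
  case 0
  then show ?case
    by (auto intro!: continuous_on_compose2[of U f] continuous_intros)
next
  case (Suc k)
  have op: "open (Pair a -` U)"
    by (intro open_vimage assms(1) continuous_intros)
  have D: "dd v (\<lambda>x. f (a, x)) x = dd (0, v) f (a, x)" if "x \<in> Pair a -` U" for x v
    using frechet_derivative_at[OF has_derivative_slice[of f a x]] Suc.prems that
    by (metis Ck_on_open.simps(2) vimageD)
  have "Ck_on_open k (dd v (\<lambda>x. f (a, x))) (Pair a -` U)" for v
    by (rule Ck_on_open_cong[OF op _ Suc.IH[of "dd (0, v) f"]]) (use Suc.prems D in auto)
  moreover have "(\<lambda>x. f (a, x)) differentiable (at x)" if "x \<in> Pair a -` U" for x
    using has_derivative_slice[of f a x] Suc.prems that by (auto intro: differentiableI)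
  ultimately show ?case by simp
qed

lemma has_vector_derivative_line:
  assumes "f differentiable (at (p + s *\<^sub>R u))"
  shows "((\<lambda>s. f (p + s *\<^sub>R u)) has_vector_derivative dd u f (p + s *\<^sub>R u)) (at s)"
proof -
  have "((\<lambda>s. p + s *\<^sub>R u) has_derivative (\<lambda>h. h *\<^sub>R u)) (at s)"
    by (auto intro!: derivative_eq_intros)
  from diff_chain_at[OF this assms[unfolded frechet_derivative_works]]
  have "((\<lambda>s. f (p + s *\<^sub>R u)) has_derivative (\<lambda>h. dd (h *\<^sub>R u) f (p + s *\<^sub>R u))) (at s)"
    by (simp add: o_def)
  moreover have "dd (h *\<^sub>R u) f (p + s *\<^sub>R u) = h *\<^sub>R dd u f (p + s *\<^sub>R u)" for h
    using linear_frechet_derivative[OF assms] by (simp add: linear_cmul)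
  ultimately show ?thesis
    by (simp add: has_vector_derivative_def)
qed

text \<open>Only the values of \<open>f\<close> on a set accumulating at \<open>z\<close> along \<open>v\<close> matter; this allows relations
  that hold on a half-space or an interval with end points to be differentiated.\<close>

lemma dd_eq_0:
  fixes f :: "'v::euclidean_space \<Rightarrow> 'b::real_normed_vector"
  assumes "f differentiable (at z)" "f z = 0"
    and "\<And>e. 0 < e \<Longrightarrow> \<exists>t. 0 < \<bar>t\<bar> \<and> \<bar>t\<bar> < e \<and> f (z + t *\<^sub>R v) = 0"
  shows "dd v f z = 0"
proof (rule ccontr)
  let ?D = "dd v f z"
  assume "?D \<noteq> 0"
  have "((\<lambda>t. f (z + t *\<^sub>R v)) has_vector_derivative ?D) (at 0)"
    using has_vector_derivative_line[of f z 0 v] assms(1) by simp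
  then have "((\<lambda>t. norm (f (z + t *\<^sub>R v) - t *\<^sub>R ?D) / norm t) \<longlongrightarrow> 0) (at 0)"
    using assms(2) by (simp add: has_vector_derivative_def has_derivative_iff_norm)
  then obtain d where "d > 0" and
    d: "\<And>t. t \<noteq> 0 \<Longrightarrow> \<bar>t\<bar> < d \<Longrightarrow> norm (f (z + t *\<^sub>R v) - t *\<^sub>R ?D) / \<bar>t\<bar> < norm ?D"
    using LIM_D[of "\<lambda>t. norm (f (z + t *\<^sub>R v) - t *\<^sub>R ?D) / norm t" 0 0 "norm ?D"] \<open>?D \<noteq> 0\<close> by auto
  obtain t where "0 < \<bar>t\<bar>" "\<bar>t\<bar> < d" "f (z + t *\<^sub>R v) = 0"
    using assms(3)[OF \<open>d > 0\<close>] by blast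
  with d[of t] show False by simp
qed

section \<open>Symmetry of second derivatives\<close>

lemma mixed_difference_mean_value:
  fixes f :: "'v::euclidean_space \<Rightarrow> real"
  assumes "0 < e" "\<And>s t. s \<in> {0..e} \<Longrightarrow> t \<in> {0..e} \<Longrightarrow> z + s *\<^sub>R u + t *\<^sub>R v \<in> U"
    and "Ck_on_open 2 f U"
  shows "\<exists>s\<in>{0..e}. \<exists>t\<in>{0..e}. f (z + e *\<^sub>R u + e *\<^sub>R v) - f (z + e *\<^sub>R u) - f (z + e *\<^sub>R v) + f z
    = e * (e * dd v (dd u f) (z + s *\<^sub>R u + t *\<^sub>R v))"
proof -
  have f1: "f differentiable (at p)" if "p \<in> U" for p
    using assms(3) that by (simp add: numeral_2_eq_2)
  have f2: "dd u f differentiable (at p)" if "p \<in> U" for p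
    using assms(3) that by (simp add: numeral_2_eq_2)
  let ?h = "\<lambda>s. f (z + e *\<^sub>R v + s *\<^sub>R u) - f (z + s *\<^sub>R u)"
  have "(?h has_real_derivative dd u f (z + e *\<^sub>R v + s *\<^sub>R u) - dd u f (z + s *\<^sub>R u)) (at s)"
    if "0 \<le> s" "s \<le> e" for s
    unfolding has_real_derivative_iff_has_vector_derivative
    using assms(2)[of s e] assms(2)[of s 0] that assms(1)
    by (intro has_vector_derivative_diff has_vector_derivative_line f1) (auto simp: algebra_simps)
  from MVT2[OF assms(1) this] obtain s where s: "0 < s" "s < e"
    "?h e - ?h 0 = (e - 0) * (dd u f (z + e *\<^sub>R v + s *\<^sub>R u) - dd u f (z + s *\<^sub>R u))"
    by metis
  have "((\<lambda>t. dd u f (z + s *\<^sub>R u + t *\<^sub>R v)) has_real_derivative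
      dd v (dd u f) (z + s *\<^sub>R u + t *\<^sub>R v)) (at t)" if "0 \<le> t" "t \<le> e" for t
    unfolding has_real_derivative_iff_has_vector_derivative
    using assms(2)[of s t] s that
    by (intro has_vector_derivative_line f2) auto
  from MVT2[OF assms(1) this] obtain t where t: "0 < t" "t < e"
    "dd u f (z + s *\<^sub>R u + e *\<^sub>R v) - dd u f (z + s *\<^sub>R u + 0 *\<^sub>R v)
      = (e - 0) * dd v (dd u f) (z + s *\<^sub>R u + t *\<^sub>R v)"
    by metis
  have "?h e - ?h 0 = e * (e * dd v (dd u f) (z + s *\<^sub>R u + t *\<^sub>R v))"
    using s(3) t(3) by (simp add: algebra_simps)
  then show ?thesis
    using s(1,2) t(1,2) by (intro bexI[of _ s] bexI[of _ t]) (auto simp: algebra_simps)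
qed

text \<open>The second mixed difference over a small parallelogram is symmetric in u and v.
  Evaluated by the mean value theorem in either order, it equals the same multiple of a value of
  each mixed derivative near z, and continuity at z excludes two different limits.\<close>

lemma dd_commute_real:
  fixes f :: "'v::euclidean_space \<Rightarrow> real"
  assumes "open U" "z \<in> U" "Ck_on_open 2 f U"
  shows "dd u (dd v f) z = dd v (dd u f) z"
proof (rule ccontr)
  let ?P = "dd u (dd v f)" and ?Q = "dd v (dd u f)"
  assume ne: "?P z \<noteq> ?Q z"
  define e where "e = \<bar>?P z - ?Q z\<bar> / 2"
  have "e > 0" using ne by (simp add: e_def)
  have "continuous_on U ?P" "continuous_on U ?Q"
    using assms(3) by (simp_all add: numeral_2_eq_2)
  then have "isCont ?P z" "isCont ?Q z"
    using assms(1,2) continuous_on_eq_continuous_at by blast+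
  then obtain d1 d2 where d: "d1 > 0" "d2 > 0" "\<And>y. dist y z < d1 \<Longrightarrow> dist (?P y) (?P z) < e"
    "\<And>y. dist y z < d2 \<Longrightarrow> dist (?Q y) (?Q z) < e"
    unfolding continuous_at_eps_delta using \<open>e > 0\<close> by metis
  obtain d0 where d0: "d0 > 0" "ball z d0 \<subseteq> U"
    using assms(1,2) open_contains_ball by blast
  define d where "d = min d0 (min d1 d2)"
  have "d > 0" using d d0 by (simp add: d_def)
  \<comment> \<open>The summand 1 keeps the denominator positive for u = v = 0; the factor 2 makes
    the whole parallelogram lie strictly within distance d of z.\<close>
  define \<epsilon> where "\<epsilon> = d / (2 * (norm u + norm v + 1))"
  have ep: "\<epsilon> > 0" "\<epsilon> * (norm u + norm v) < d"
  proof -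
    show "\<epsilon> > 0" using \<open>d > 0\<close> by (simp add: \<epsilon>_def add_nonneg_pos)
    have "\<epsilon> * (2 * (norm u + norm v + 1)) = d"
      by (simp add: \<epsilon>_def) (smt (verit) norm_ge_zero)
    moreover have "\<epsilon> * (norm u + norm v) < \<epsilon> * (2 * (norm u + norm v + 1))"
      using \<open>\<epsilon> > 0\<close> by (intro mult_strict_left_mono) (smt (verit) norm_ge_zero)+
    ultimately show "\<epsilon> * (norm u + norm v) < d" by simp
  qed
  have near: "dist (z + s *\<^sub>R u + t *\<^sub>R v) z < d" if "s \<in> {0..\<epsilon>}" "t \<in> {0..\<epsilon>}" for s t
  proof -
    have "dist (z + s *\<^sub>R u + t *\<^sub>R v) z \<le> s * norm u + t * norm v"
      using norm_triangle_ineq[of "s *\<^sub>R u" "t *\<^sub>R v"] that by (simp add: dist_norm add.assoc)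
    also have "\<dots> \<le> \<epsilon> * norm u + \<epsilon> * norm v"
      using that by (intro add_mono mult_right_mono) auto
    finally show ?thesis using ep by (simp add: algebra_simps)
  qed
  have inU: "z + s *\<^sub>R u + t *\<^sub>R v \<in> U" if "s \<in> {0..\<epsilon>}" "t \<in> {0..\<epsilon>}" for s t
    using near[OF that] d0 by (auto simp: d_def dist_commute subset_iff)
  then have inU': "z + s *\<^sub>R v + t *\<^sub>R u \<in> U" if "s \<in> {0..\<epsilon>}" "t \<in> {0..\<epsilon>}" for s t
    using that by (metis add.assoc add.commute)
  obtain s t where st: "s \<in> {0..\<epsilon>}" "t \<in> {0..\<epsilon>}"
    "f (z + \<epsilon> *\<^sub>R u + \<epsilon> *\<^sub>R v) - f (z + \<epsilon> *\<^sub>R u) - f (z + \<epsilon> *\<^sub>R v) + f z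
      = \<epsilon> * (\<epsilon> * ?Q (z + s *\<^sub>R u + t *\<^sub>R v))"
    using mixed_difference_mean_value[OF ep(1) inU assms(3)] by blast
  obtain s' t' where st': "s' \<in> {0..\<epsilon>}" "t' \<in> {0..\<epsilon>}"
    "f (z + \<epsilon> *\<^sub>R v + \<epsilon> *\<^sub>R u) - f (z + \<epsilon> *\<^sub>R v) - f (z + \<epsilon> *\<^sub>R u) + f z
      = \<epsilon> * (\<epsilon> * ?P (z + s' *\<^sub>R v + t' *\<^sub>R u))"
    using mixed_difference_mean_value[OF ep(1) inU' assms(3)] by blast
  have "\<epsilon> * (\<epsilon> * ?Q (z + s *\<^sub>R u + t *\<^sub>R v)) = \<epsilon> * (\<epsilon> * ?P (z + s' *\<^sub>R v + t' *\<^sub>R u))"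
    using st(3) st'(3) by (simp add: algebra_simps)
  then have "?Q (z + s *\<^sub>R u + t *\<^sub>R v) = ?P (z + t' *\<^sub>R u + s' *\<^sub>R v)"
    using ep(1) by (simp add: algebra_simps)
  moreover have "dist (?Q (z + s *\<^sub>R u + t *\<^sub>R v)) (?Q z) < e"
    using near[OF st(1,2)] by (intro d) (simp add: d_def)
  moreover have "dist (?P (z + t' *\<^sub>R u + s' *\<^sub>R v)) (?P z) < e"
    using near[OF st'(2,1)] by (intro d) (simp add: d_def)
  ultimately show False
    unfolding e_def dist_real_def by (simp add: abs_if field_simps split: if_splits)
qed

lemma dd_commute:
  fixes f :: "'v::euclidean_space \<Rightarrow> 'b::euclidean_space"
  assumes "open U" "z \<in> U" "Ck_on_open 2 f U"
  shows "dd u (dd v f) z = dd v (dd u f) z"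
proof (rule euclidean_eqI)
  fix b :: 'b
  have bb: "bounded_bilinear (\<lambda>(x::'b) (y::'b). x \<bullet> y)" by (rule bounded_bilinear_inner)
  have inner_dd: "dd w (\<lambda>x. g x \<bullet> b) p = dd w g p \<bullet> b" if "g differentiable (at p)" for g :: "'v \<Rightarrow> 'b" and w p
    using dd_bilinear[OF bb that, of "\<lambda>_. b" w] by simp
  have "dd w (dd w' (\<lambda>x. f x \<bullet> b)) z = dd w (dd w' f) z \<bullet> b" for w w'
  proof -
    have "frechet_derivative (dd w' (\<lambda>x. f x \<bullet> b)) (at z) = frechet_derivative (\<lambda>x. dd w' f x \<bullet> b) (at z)"
      using assms(3) by (intro dd_cong_open[OF assms(1,2)] inner_dd) (simp add: numeral_2_eq_2)
    then show ?thesis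
      using assms(2,3) by (simp add: inner_dd numeral_2_eq_2)
  qed
  moreover have "Ck_on_open 2 (\<lambda>x. f x \<bullet> b) U"
    using Ck_on_open_bilinear[OF bb assms(1,3) Ck_on_open_const] .
  ultimately show "dd u (dd v f) z \<bullet> b = dd v (dd u f) z \<bullet> b"
    using dd_commute_real[OF assms(1,2)] by metis
qed

section \<open>Linear algebra of hypersurfaces in the space forms\<close>

text \<open>The defining form of the space form: its points satisfy
  \<open>qform \<kappa> p p = 1\<close>, and tangent vectors at p are those with
  \<open>qform \<kappa> p w = 0\<close>. For curvature 1 and -1 it is \<kappa> times the metric
  form; in the flat case it sees only the first coordinate, so the two forms have to be kept
  apart.\<close>

definition qform :: "real \<Rightarrow> real \<times> 'e::euclidean_space \<Rightarrow> real \<times> 'e \<Rightarrow> real" where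
  "qform \<kappa> v w = fst v * fst w + \<kappa> * (snd v \<bullet> snd w)"

lemma bounded_bilinear_weighted:
  "bounded_bilinear (\<lambda>(v::real \<times> 'e::euclidean_space) w. a * (fst v * fst w) + b * (snd v \<bullet> snd w))"
proof
  show "\<exists>K. \<forall>(v::real \<times> 'e) w. norm (a * (fst v * fst w) + b * (snd v \<bullet> snd w)) \<le> norm v * norm w * K"
  proof (intro exI allI)
    fix v w :: "real \<times> 'e"
    have le: "\<bar>fst x\<bar> \<le> norm x" "norm (snd x) \<le> norm x" for x :: "real \<times> 'e"
      by (metis norm_fst_le prod.collapse real_norm_def) (metis norm_snd_le prod.collapse)
    have 1: "\<bar>fst v * fst w\<bar> \<le> norm v * norm w"
      unfolding abs_mult by (intro mult_mono le) simp_all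
    have 2: "\<bar>snd v \<bullet> snd w\<bar> \<le> norm v * norm w"
      using Cauchy_Schwarz_ineq2[of "snd v" "snd w"]
        mult_mono[OF le(2)[of v] le(2)[of w]] by simp
    have "\<bar>a * (fst v * fst w) + b * (snd v \<bullet> snd w)\<bar> \<le> \<bar>a\<bar> * \<bar>fst v * fst w\<bar> + \<bar>b\<bar> * \<bar>snd v \<bullet> snd w\<bar>"
      by (metis abs_mult abs_triangle_ineq)
    also have "\<dots> \<le> \<bar>a\<bar> * (norm v * norm w) + \<bar>b\<bar> * (norm v * norm w)"
      using 1 2 by (intro add_mono mult_left_mono) auto
    finally show "norm (a * (fst v * fst w) + b * (snd v \<bullet> snd w)) \<le> norm v * norm w * (\<bar>a\<bar> + \<bar>b\<bar>)"
      by (simp add: algebra_simps)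
  qed
qed (auto simp: algebra_simps inner_add_left inner_add_right)

lemma bounded_bilinear_mform: "bounded_bilinear (mform \<kappa>)"
  using bounded_bilinear_weighted[of \<kappa> 1] by (simp add: mform_def[abs_def] mult.assoc)

lemma bounded_bilinear_qform: "bounded_bilinear (qform \<kappa>)"
  using bounded_bilinear_weighted[of 1 \<kappa>] by (simp add: qform_def[abs_def])

lemmas mform_simps =
  bounded_bilinear.add_left[OF bounded_bilinear_mform] bounded_bilinear.add_right[OF bounded_bilinear_mform]
  bounded_bilinear.diff_left[OF bounded_bilinear_mform] bounded_bilinear.diff_right[OF bounded_bilinear_mform]
  bounded_bilinear.minus_left[OF bounded_bilinear_mform] bounded_bilinear.minus_right[OF bounded_bilinear_mform]
  bounded_bilinear.zero_left[OF bounded_bilinear_mform] bounded_bilinear.zero_right[OF bounded_bilinear_mform]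
  bounded_bilinear.scaleR_left[OF bounded_bilinear_mform] bounded_bilinear.scaleR_right[OF bounded_bilinear_mform]
  bounded_bilinear.sum_left[OF bounded_bilinear_mform] bounded_bilinear.sum_right[OF bounded_bilinear_mform]

lemmas qform_simps =
  bounded_bilinear.add_left[OF bounded_bilinear_qform] bounded_bilinear.add_right[OF bounded_bilinear_qform]
  bounded_bilinear.diff_left[OF bounded_bilinear_qform] bounded_bilinear.diff_right[OF bounded_bilinear_qform]
  bounded_bilinear.minus_left[OF bounded_bilinear_qform] bounded_bilinear.minus_right[OF bounded_bilinear_qform]
  bounded_bilinear.zero_left[OF bounded_bilinear_qform] bounded_bilinear.zero_right[OF bounded_bilinear_qform]
  bounded_bilinear.scaleR_left[OF bounded_bilinear_qform] bounded_bilinear.scaleR_right[OF bounded_bilinear_qform]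
  bounded_bilinear.sum_left[OF bounded_bilinear_qform] bounded_bilinear.sum_right[OF bounded_bilinear_qform]

lemma mform_commute: "mform \<kappa> v w = mform \<kappa> w v"
  by (simp add: mform_def inner_commute)

lemma qform_commute: "qform \<kappa> v w = qform \<kappa> w v"
  by (simp add: qform_def inner_commute)

lemma tangent_space_iff: "w \<in> tangent_space \<kappa> p \<longleftrightarrow> qform \<kappa> p w = 0"
  by (simp add: tangent_space_def qform_def)

lemma qform_self: "p \<in> space_form \<kappa> \<Longrightarrow> qform \<kappa> p p = 1"
  by (simp add: space_form_def qform_def power2_eq_square)

lemma qform_eq_mform: "\<kappa> \<in> {-1, 1} \<Longrightarrow> qform \<kappa> v w = \<kappa> * mform \<kappa> v w"
  by (auto simp: qform_def mform_def)

lemma qform_tangent: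
  assumes "\<kappa> \<in> {-1, 0, 1}" "p \<in> space_form \<kappa>" "v \<in> tangent_space \<kappa> p" "w \<in> tangent_space \<kappa> p"
  shows "qform \<kappa> v w = \<kappa> * mform \<kappa> v w"
proof (cases "\<kappa> = 0")
  case True
  then have "fst p \<noteq> 0" using assms(2) by (auto simp: space_form_def)
  then show ?thesis using True assms(3,4) by (simp add: tangent_space_def qform_def)
next
  case False
  then show ?thesis using assms(1) by (intro qform_eq_mform) auto
qed

text \<open>The factor \<kappa> lets one formula cover all cases: on the quadrics the position
  vector is metrically orthogonal to the tangent space, in the flat case it need not be, and the
  factor removes the term.\<close>

lemma mform_tangent_point:
  assumes "\<kappa> \<in> {-1, 0, 1}" "w \<in> tangent_space \<kappa> p"
  shows "\<kappa> * mform \<kappa> p w = 0"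
  using assms qform_eq_mform[of \<kappa> p w] by (cases "\<kappa> = 0") (auto simp: tangent_space_iff)

text \<open>Only the hyperboloid needs an argument. Tangency and Cauchy--Schwarz in the space
  components give (1 + a) (fst w)^2 \<le> a b < (1 + a) b, where a and b are the squares of the
  space components of p and w; so tangent vectors are spacelike.\<close>

lemma mform_tangent_pos:
  assumes "\<kappa> \<in> {-1, 0, 1}" "p \<in> space_form \<kappa>" "w \<in> tangent_space \<kappa> p" "w \<noteq> 0"
  shows "0 < mform \<kappa> w w"
proof -
  have ne: "fst w \<noteq> 0 \<or> snd w \<noteq> 0" using assms(4) by (simp add: prod_eq_iff)
  consider "\<kappa> = 1" | "\<kappa> = 0" | "\<kappa> = -1" using assms(1) by blast
  then show ?thesis
  proof cases
    case 1
    then have "mform \<kappa> w w = (fst w)\<^sup>2 + snd w \<bullet> snd w"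
      by (simp add: mform_def power2_eq_square)
    moreover have "(fst w)\<^sup>2 \<ge> 0" "snd w \<bullet> snd w \<ge> 0" by auto
    moreover have "(fst w)\<^sup>2 > 0 \<or> snd w \<bullet> snd w > 0" using ne by auto
    ultimately show ?thesis by linarith
  next
    case 2
    then have "fst w = 0"
      using assms(2,3) by (simp add: tangent_space_def space_form_def)
    then show ?thesis using 2 ne by (simp add: mform_def)
  next
    case 3
    define a b c where "a = snd p \<bullet> snd p" and "b = snd w \<bullet> snd w" and "c = snd p \<bullet> snd w"
    have "(fst p)\<^sup>2 = 1 + a" "fst p * fst w = c"
      using assms(2,3) 3 by (auto simp: space_form_def tangent_space_def a_def c_def)
    then have "(1 + a) * (fst w)\<^sup>2 = c\<^sup>2" by (metis power_mult_distrib)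
    moreover have "c\<^sup>2 \<le> a * b"
      using Cauchy_Schwarz_ineq[of "snd p" "snd w"] by (simp add: a_def b_def c_def)
    moreover have "a \<ge> 0" by (simp add: a_def)
    ultimately have "(1 + a) * (fst w)\<^sup>2 \<le> a * b" by simp
    moreover have "b > 0"
    proof (rule ccontr)
      assume "\<not> b > 0"
      then have "b = 0" by (simp add: b_def)
      then have "(1 + a) * (fst w)\<^sup>2 \<le> 0" using \<open>(1 + a) * (fst w)\<^sup>2 \<le> a * b\<close> by simp
      then have "fst w = 0" using \<open>a \<ge> 0\<close> by (simp add: mult_le_0_iff)
      then show False using ne \<open>b = 0\<close> by (simp add: b_def)
    qed
    ultimately have "(1 + a) * (fst w)\<^sup>2 < (1 + a) * b" by (simp add: algebra_simps)
    then have "(fst w)\<^sup>2 < b" using \<open>a \<ge> 0\<close> by simp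
    then show ?thesis using 3 by (simp add: mform_def b_def power2_eq_square)
  qed
qed

lemma tangent_eqI:
  assumes "\<kappa> \<in> {-1, 0, 1}" "p \<in> space_form \<kappa>" "u \<in> tangent_space \<kappa> p" "v \<in> tangent_space \<kappa> p"
    and "\<And>w. w \<in> tangent_space \<kappa> p \<Longrightarrow> mform \<kappa> u w = mform \<kappa> v w"
  shows "u = v"
proof (rule ccontr)
  assume "u \<noteq> v"
  have t: "u - v \<in> tangent_space \<kappa> p"
    using assms(3,4) by (simp add: tangent_space_iff qform_simps)
  have "mform \<kappa> (u - v) (u - v) = 0" using assms(5)[OF t] by (simp add: mform_simps)
  moreover have "0 < mform \<kappa> (u - v) (u - v)"
    using mform_tangent_pos[OF assms(1,2) t] \<open>u \<noteq> v\<close> by simp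
  ultimately show False by simp
qed

section \<open>The Gram matrix and the splitting of tangent vectors\<close>

lemma matrix_inv_inverse:
  fixes A :: "real^'n^'n"
  assumes "invertible A"
  shows "A ** matrix_inv A = mat 1" "matrix_inv A ** A = mat 1"
  using someI_ex[OF assms[unfolded invertible_def]] unfolding matrix_inv_def by blast+

lemma matrix_inv_symmetric:
  fixes A :: "real^'n^'n"
  assumes "invertible A" "\<And>i j. A $ i $ j = A $ j $ i"
  shows "matrix_inv A $ i $ j = matrix_inv A $ j $ i"
proof -
  let ?B = "matrix_inv A"
  have At: "transpose A = A" using assms(2) by (simp add: transpose_def vec_eq_iff)
  have "transpose ?B ** A = mat 1"
    using matrix_inv_inverse(1)[OF assms(1)] At by (metis matrix_transpose_mul transpose_mat)
  then have "transpose ?B = ?B"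
    using matrix_inv_inverse(1)[OF assms(1)]
    by (metis matrix_mul_assoc matrix_mul_lid matrix_mul_rid)
  from arg_cong[OF this, of "\<lambda>M. M $ j $ i"] show ?thesis by (simp add: transpose_def)
qed

lemma sum_delta_product:
  fixes A B :: "real^'n^'n"
  assumes "A ** B = mat 1"
  shows "(\<Sum>k\<in>UNIV. A $ i $ k * B $ k $ j) = (if i = j then 1 else 0)"
proof -
  have "(A ** B) $ i $ j = (if i = j then 1 else 0)" using assms by (simp add: mat_def)
  then show ?thesis by (simp add: matrix_matrix_mult_def)
qed

text \<open>A single point of a hypersurface with coordinate frame E and unit normal N. Derivatives
  enter the later identities over this frame as free vectors, so the variational computation becomes
  linear algebra.\<close>

locale hypersurface_frame =
  fixes \<kappa> :: real and F N :: "real \<times> 'e::euclidean_space" and E :: "'n::finite \<Rightarrow> real \<times> 'e"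
  assumes kappa: "\<kappa> \<in> {-1, 0, 1}"
    and dim: "DIM('e) = CARD('n) + 1"
    and F: "F \<in> space_form \<kappa>"
    and E_tangent: "E i \<in> tangent_space \<kappa> F"
    and N_tangent: "N \<in> tangent_space \<kappa> F"
    and N_unit: "mform \<kappa> N N = 1"
    and N_orth: "mform \<kappa> N (E i) = 0"
    and E_inj: "inj (\<lambda>v::real^'n. \<Sum>i\<in>UNIV. (v $ i) *\<^sub>R E i)"
begin

abbreviation tang :: "real^'n \<Rightarrow> real \<times> 'e" where
  "tang v \<equiv> \<Sum>i\<in>UNIV. (v $ i) *\<^sub>R E i"

definition gram :: "real^'n^'n" where
  "gram = (\<chi> i j. mform \<kappa> (E i) (E j))"

abbreviation G :: "real^'n^'n" where
  "G \<equiv> matrix_inv gram"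

lemma tang_tangent: "tang v \<in> tangent_space \<kappa> F"
  using E_tangent by (simp add: tangent_space_iff qform_simps)

lemma N_tang: "mform \<kappa> N (tang v) = 0"
  by (simp add: mform_simps N_orth)

lemma tang_eq_0: "tang v = 0 \<Longrightarrow> v = 0"
  using E_inj[THEN injD, of v 0] by simp

text \<open>A dimension count: F, N and the frame are independent, and their number CARD('n) + 2 is
  the dimension of the ambient space. The coefficient of F is detected by \<open>qform\<close>, that
  of N by \<open>mform\<close>; tangency makes the former vanish.\<close>

lemma tangent_decomp_ex:
  assumes "w \<in> tangent_space \<kappa> F"
  shows "\<exists>v. w = mform \<kappa> N w *\<^sub>R N + tang v"
proof -
  define L :: "real \<times> real \<times> (real^'n) \<Rightarrow> real \<times> 'e"
    where "L = (\<lambda>(a, b, v). a *\<^sub>R F + b *\<^sub>R N + tang v)"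
  have lin: "linear L"
    unfolding L_def
    by (intro linearI)
      (auto simp: algebra_simps sum.distrib scaleR_sum_right)
  have q: "qform \<kappa> F (L (a, b, v)) = a" for a b v
    using tang_tangent[of v] N_tangent qform_self[OF F]
    by (simp add: L_def qform_simps(1-11) tangent_space_iff del: sum_component)
  have m: "mform \<kappa> N (L (0, b, v)) = b" for b v
    using N_tang[of v] N_unit by (simp add: L_def mform_simps(1-11))
  have "L x = 0 \<Longrightarrow> x = 0" for x
  proof -
    assume 0: "L x = 0"
    obtain a b v where x: "x = (a, b, v)" by (cases x) auto
    have "a = 0" using q[of a b v] 0 x by (simp add: qform_simps)
    moreover have "b = 0" using m[of b v] 0 x \<open>a = 0\<close> by (simp add: mform_simps)
    ultimately have "v = 0" using 0 x tang_eq_0[of v] by (simp add: L_def)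
    then show ?thesis using x \<open>a = 0\<close> \<open>b = 0\<close> by (simp add: zero_prod_def)
  qed
  then have "inj L" using lin linear_injective_0 by blast
  then have "dim (range L) = DIM(real \<times> 'e)"
    using dim_image_eq[OF lin, of UNIV] dim by simp
  then have "range L = UNIV"
    using dim_eq_full[of "range L"] linear_subspace_image[OF lin subspace_UNIV] span_eq_iff by metis
  then obtain a b v where w: "w = L (a, b, v)" by (metis prod_cases3 rangeE UNIV_I)
  have "a = 0" using q[of a b v] w assms by (simp add: tangent_space_iff)
  moreover have "b = mform \<kappa> N w" using m[of b v] w \<open>a = 0\<close> by simp
  ultimately show ?thesis using w by (auto simp: L_def)
qed

lemma mform_tang: "mform \<kappa> (tang v) (tang w) = v \<bullet> (gram *v w)"
proof -
  have "mform \<kappa> (tang v) (tang w) = (\<Sum>i\<in>UNIV. v $ i * mform \<kappa> (E i) (tang w))"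
    by (simp only: mform_simps(9,11) real_scaleR_def)
  also have "\<dots> = (\<Sum>i\<in>UNIV. v $ i * (\<Sum>j\<in>UNIV. w $ j * mform \<kappa> (E i) (E j)))"
    by (simp only: mform_simps real_scaleR_def)
  finally show ?thesis
    by (simp add: inner_vec_def matrix_vector_mult_def gram_def mult.commute)
qed

lemma gram_pos: "v \<noteq> 0 \<Longrightarrow> 0 < v \<bullet> (gram *v v)"
  unfolding mform_tang[symmetric] using tang_eq_0[of v]
  by (intro mform_tangent_pos[OF kappa F tang_tangent]) auto

lemma gram_invertible: "invertible gram"
proof -
  have "gram *v v = 0 \<Longrightarrow> v = 0" for v
    using gram_pos[of v] by (cases "v = 0") auto
  then show ?thesis
    unfolding invertible_left_inverse matrix_left_invertible_ker by blast
qed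

lemma gram_symmetric: "gram $ i $ j = gram $ j $ i"
  by (simp add: gram_def mform_commute)

lemma G_symmetric: "G $ i $ j = G $ j $ i"
  using matrix_inv_symmetric[OF gram_invertible gram_symmetric] .

lemma G_gram: "(\<Sum>k\<in>UNIV. G $ i $ k * mform \<kappa> (E k) (E j)) = (if i = j then 1 else 0)"
  using sum_delta_product[OF matrix_inv_inverse(2)[OF gram_invertible]] by (simp add: gram_def)

lemma tangent_decomp:
  assumes "w \<in> tangent_space \<kappa> F"
  shows "w = mform \<kappa> N w *\<^sub>R N + (\<Sum>k\<in>UNIV. (\<Sum>l\<in>UNIV. G $ k $ l * mform \<kappa> w (E l)) *\<^sub>R E k)"
proof -
  obtain v where v: "w = mform \<kappa> N w *\<^sub>R N + tang v"
    using tangent_decomp_ex[OF assms] by blast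
  have wl: "mform \<kappa> w (E l) = (\<Sum>i\<in>UNIV. v $ i * mform \<kappa> (E i) (E l))" for l
    by (subst v) (simp add: mform_simps N_orth)
  have "(\<Sum>l\<in>UNIV. G $ k $ l * mform \<kappa> w (E l)) = v $ k" for k
  proof -
    have "(\<Sum>l\<in>UNIV. G $ k $ l * mform \<kappa> w (E l))
        = (\<Sum>l\<in>UNIV. \<Sum>i\<in>UNIV. v $ i * (G $ k $ l * mform \<kappa> (E l) (E i)))"
      unfolding wl sum_distrib_left
      by (intro sum.cong refl) (simp add: mform_commute[of _ "E _" "E _"])
    also have "\<dots> = (\<Sum>i\<in>UNIV. v $ i * (\<Sum>l\<in>UNIV. G $ k $ l * mform \<kappa> (E l) (E i)))"
      by (subst sum.swap) (simp add: sum_distrib_left)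
    also have "\<dots> = v $ k"
      unfolding G_gram by (simp add: if_distrib cong: if_cong)
    finally show ?thesis .
  qed
  then have "tang v = (\<Sum>k\<in>UNIV. (\<Sum>l\<in>UNIV. G $ k $ l * mform \<kappa> w (E l)) *\<^sub>R E k)"
    by simp
  with v show ?thesis by (rule trans[OF _ arg_cong])
qed

end

section \<open>Distance spheres and the gradient of the distance\<close>

text \<open>For \<kappa> in {-1, 0, 1}, \<open>cs\<close> and \<open>sn\<close> are the solutions of
  y'' = - \<kappa> y with the initial values of cosine and sine.\<close>

definition cs :: "real \<Rightarrow> real \<Rightarrow> real" where
  "cs \<kappa> t = (if \<kappa> = 0 then 1 else if \<kappa> = 1 then cos t else cosh t)"

definition sn :: "real \<Rightarrow> real \<Rightarrow> real" where
  "sn \<kappa> t = (if \<kappa> = 0 then t else if \<kappa> = 1 then sin t else sinh t)"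

text \<open>The square of the chord, with respect to \<open>mform \<kappa>\<close>, of a geodesic segment of length \<open>t\<close>. Working
  with chords treats the three curvatures uniformly and avoids the singularity of the distance.\<close>

definition chord :: "real \<Rightarrow> real \<Rightarrow> real" where
  "chord \<kappa> t = (if \<kappa> = 0 then t\<^sup>2 else 2 * \<kappa> * (1 - cs \<kappa> t))"

lemma cs_sn: "\<kappa> \<in> {-1, 0, 1} \<Longrightarrow> (cs \<kappa> t)\<^sup>2 + \<kappa> * (sn \<kappa> t)\<^sup>2 = 1"
  by (auto simp: cs_def sn_def cosh_square_eq)

lemma sn_pos: "0 < t \<Longrightarrow> (\<kappa> = 1 \<Longrightarrow> t < pi) \<Longrightarrow> 0 < sn \<kappa> t"
  by (auto simp: sn_def sin_gt_zero)

lemma ct_eq: "\<kappa> \<in> {-1, 0, 1} \<Longrightarrow> ct \<kappa> t = cs \<kappa> t / sn \<kappa> t"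
  by (auto simp: ct_def cs_def sn_def cot_def)

lemma cs_derivative:
  "\<kappa> \<in> {-1, 0, 1} \<Longrightarrow> (cs \<kappa> has_real_derivative - \<kappa> * sn \<kappa> t) (at t within S)"
  unfolding cs_def[abs_def] sn_def by (auto intro!: derivative_eq_intros)

lemma sn_derivative:
  "\<kappa> \<in> {-1, 0, 1} \<Longrightarrow> (sn \<kappa> has_real_derivative cs \<kappa> t) (at t within S)"
  unfolding cs_def sn_def[abs_def] by (auto intro!: derivative_eq_intros)

lemma chord_derivative:
  "\<kappa> \<in> {-1, 0, 1} \<Longrightarrow> (chord \<kappa> has_real_derivative 2 * sn \<kappa> t) (at t within S)"
  unfolding chord_def[abs_def] cs_def[abs_def] sn_def by (auto intro!: derivative_eq_intros)

text \<open>Strict monotonicity on the admissible range turns comparisons of distances into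
  comparisons of quadratic expressions in the ambient coordinates.\<close>

lemma chord_less_iff:
  assumes "\<kappa> \<in> {-1, 0, 1}" "0 \<le> s" "0 \<le> t" "\<kappa> = 1 \<Longrightarrow> s \<le> pi" "\<kappa> = 1 \<Longrightarrow> t \<le> pi"
  shows "chord \<kappa> s < chord \<kappa> t \<longleftrightarrow> s < t"
proof -
  have *: "chord \<kappa> s < chord \<kappa> t" if "0 \<le> s" "s < t" "\<kappa> = 1 \<longrightarrow> t \<le> pi" for s t
    using assms(1) that
    by (auto simp: chord_def cs_def cos_monotone_0_pi cosh_real_strict_mono power_strict_mono)
  show ?thesis
    using *[of s t] *[of t s] assms by (metis linorder_neqE_linordered_idom order_less_asym)
qed

section \<open>Lower bounds for the length of curves\<close>

lemma mform_self: "\<kappa> \<in> {-1, 1} \<Longrightarrow> p \<in> space_form \<kappa> \<Longrightarrow> mform \<kappa> p p = \<kappa>"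
  using qform_self[of p \<kappa>] qform_eq_mform[of \<kappa> p p] by auto

lemma mform_tangent_nonneg:
  "\<kappa> \<in> {-1, 0, 1} \<Longrightarrow> p \<in> space_form \<kappa> \<Longrightarrow> w \<in> tangent_space \<kappa> p \<Longrightarrow> 0 \<le> mform \<kappa> w w"
  using mform_tangent_pos[of \<kappa> p w] by (cases "w = 0") (auto simp: mform_simps intro: less_imp_le)

lemma mform_tangent_Cauchy_Schwarz:
  assumes "\<kappa> \<in> {-1, 0, 1}" "p \<in> space_form \<kappa>" "v \<in> tangent_space \<kappa> p" "w \<in> tangent_space \<kappa> p"
  shows "(mform \<kappa> v w)\<^sup>2 \<le> mform \<kappa> v v * mform \<kappa> w w"
proof (cases "w = 0")
  case False
  define b where "b = mform \<kappa> w w"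
  have "b > 0" using mform_tangent_pos[OF assms(1,2,4) False] by (simp add: b_def)
  let ?u = "b *\<^sub>R v - mform \<kappa> v w *\<^sub>R w"
  have "?u \<in> tangent_space \<kappa> p"
    using assms(3,4) by (simp add: tangent_space_iff qform_simps)
  from mform_tangent_nonneg[OF assms(1,2) this]
  have "0 \<le> b * (mform \<kappa> v v * b - (mform \<kappa> v w)\<^sup>2)"
    by (simp add: mform_simps mform_commute[of \<kappa> w v] b_def[symmetric] algebra_simps power2_eq_square)
  then show ?thesis using \<open>b > 0\<close> by (simp add: zero_le_mult_iff b_def)
qed (simp add: mform_simps)

lemma projection_tangent:
  assumes "q \<in> space_form \<kappa>"
  shows "w - qform \<kappa> q w *\<^sub>R q \<in> tangent_space \<kappa> q"
  using qform_self[OF assms] by (simp add: tangent_space_iff qform_simps)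

text \<open>Both follow from the tangential part of p at q, whose square is \<kappa> (1 - (p, q)^2):
  it is nonnegative, and Cauchy--Schwarz holds for it. The second bound controls the derivative of
  (p, \<gamma>) along a curve \<gamma> by the speed of the curve.\<close>

lemma mform_points:
  assumes "\<kappa> \<in> {-1, 1}" "p \<in> space_form \<kappa>" "q \<in> space_form \<kappa>" "w \<in> tangent_space \<kappa> q"
  shows "0 \<le> \<kappa> * (1 - (mform \<kappa> p q)\<^sup>2)"
    and "(mform \<kappa> p w)\<^sup>2 \<le> \<kappa> * (1 - (mform \<kappa> p q)\<^sup>2) * mform \<kappa> w w"
proof -
  have k: "\<kappa> \<in> {-1, 0, 1}" using assms(1) by auto
  let ?P = "p - qform \<kappa> q p *\<^sub>R q"
  have t: "?P \<in> tangent_space \<kappa> q" by (rule projection_tangent[OF assms(3)])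
  have "mform \<kappa> q w = 0"
    using mform_tangent_point[OF k assms(4)] assms(1) by auto
  then have 1: "mform \<kappa> ?P w = mform \<kappa> p w" by (simp add: mform_simps)
  have "\<kappa> * \<kappa> = 1" using assms(1) by auto
  then have 2: "mform \<kappa> ?P ?P = \<kappa> * (1 - (mform \<kappa> p q)\<^sup>2)"
    using assms(1) by (auto simp: mform_simps qform_eq_mform mform_self[OF _ assms(2)] mform_self[OF _ assms(3)]
        mform_commute[of _ q p] power2_eq_square algebra_simps)
  show "0 \<le> \<kappa> * (1 - (mform \<kappa> p q)\<^sup>2)"
    using mform_tangent_nonneg[OF k assms(3) t] 2 by simp
  show "(mform \<kappa> p w)\<^sup>2 \<le> \<kappa> * (1 - (mform \<kappa> p q)\<^sup>2) * mform \<kappa> w w"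
    using mform_tangent_Cauchy_Schwarz[OF k assms(3) t assms(4)] 1 2 by simp
qed

text \<open>The reverse Cauchy--Schwarz inequality. Its square is the first part of
  \<open>mform_points\<close>; the sign comes from both points being on the upper sheet, where the
  time component dominates.\<close>

lemma hyperboloid_mform_neg:
  assumes "p \<in> space_form (-1)" "q \<in> space_form (-1)"
  shows "mform (-1) p q \<le> -1"
proof -
  have *: "norm (snd x) < fst x" if "x \<in> space_form (-1)" for x :: "real \<times> 'a"
  proof (rule power2_less_imp_less)
    show "(norm (snd x))\<^sup>2 < (fst x)\<^sup>2"
      unfolding power2_norm_eq_inner using that by (simp add: space_form_def)
  qed (use that in \<open>simp add: space_form_def\<close>)
  have "snd p \<bullet> snd q \<le> norm (snd p) * norm (snd q)" by (rule norm_cauchy_schwarz)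
  also have "\<dots> < fst p * fst q"
    using *[OF assms(1)] *[OF assms(2)] by (intro mult_strict_mono') auto
  finally have "mform (-1) p q < 0" by (simp add: mform_def)
  moreover have "1 \<le> (mform (-1) p q)\<^sup>2"
    using mform_points(1)[of "-1" p q 0] assms by (simp add: tangent_space_iff qform_simps)
  ultimately show ?thesis
    using power2_le_imp_le[of 1 "- mform (-1) p q"] by simp
qed

lemma sphere_mform_abs:
  assumes "p \<in> space_form 1" "q \<in> space_form 1"
  shows "\<bar>mform 1 p q\<bar> \<le> 1"
  using mform_points(1)[of 1 p q 0] assms abs_square_le_1[of "mform 1 p q"]
  by (simp add: tangent_space_iff qform_simps)

lemma velocity_tangent:
  assumes "\<And>t. t \<in> {0..1} \<Longrightarrow> \<gamma> t \<in> space_form \<kappa>"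
    and "t \<in> {0..1::real}" "(\<gamma> has_vector_derivative v) (at t within {0..1})"
  shows "v \<in> tangent_space \<kappa> (\<gamma> t)"
proof -
  have "((\<lambda>t. qform \<kappa> (\<gamma> t) (\<gamma> t)) has_vector_derivative qform \<kappa> (\<gamma> t) v + qform \<kappa> v (\<gamma> t))
      (at t within {0..1})"
    by (rule bounded_bilinear.has_vector_derivative[OF bounded_bilinear_qform assms(3) assms(3)])
  moreover have "((\<lambda>t. qform \<kappa> (\<gamma> t) (\<gamma> t)) has_vector_derivative 0) (at t within {0..1})"
    by (rule has_vector_derivative_transform[OF assms(2) _ has_vector_derivative_const[of 1]])
      (use assms(1) in \<open>simp add: qform_self del: split_paired_All\<close>)
  ultimately have "qform \<kappa> (\<gamma> t) v + qform \<kappa> v (\<gamma> t) = 0"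
    using vector_derivative_unique_within_closed_interval[of 0 1 t] assms(2) by (metis box_real(2) zero_less_one)
  then show ?thesis by (simp add: tangent_space_iff qform_commute[of _ v])
qed

lemma growth_le_integral:
  fixes \<theta> s :: "real \<Rightarrow> real"
  assumes "\<And>t. t \<in> {0..1} \<Longrightarrow> (\<theta> has_real_derivative \<theta>' t) (at t within {0..1})"
    and "\<And>t. t \<in> {0..1} \<Longrightarrow> \<theta>' t \<le> s t" "continuous_on {0..1} s"
  shows "\<theta> 1 - \<theta> 0 \<le> integral {0..1} s"
proof -
  have "(\<theta>' has_integral (\<theta> 1 - \<theta> 0)) {0..1}"
    using assms(1) by (intro fundamental_theorem_of_calculus)
      (auto simp: has_real_derivative_iff_has_vector_derivative)
  moreover have "(s has_integral integral {0..1} s) {0..1}"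
    using assms(3) by (simp add: integrable_continuous_interval integrable_integral)
  ultimately show ?thesis by (rule has_integral_le) (rule assms(2))
qed

lemma mform_right_derivative:
  "(\<gamma> has_vector_derivative v) F \<Longrightarrow> ((\<lambda>t. mform \<kappa> p (\<gamma> t)) has_vector_derivative mform \<kappa> p v) F"
  by (rule bounded_linear.has_vector_derivative[OF
        bounded_bilinear.bounded_linear_right[OF bounded_bilinear_mform]])

text \<open>Scaling by a factor \<open>l\<close> keeps the argument of \<open>arccos\<close> (or \<open>arcosh\<close>) away from the points where it is
  not differentiable, and the derivative bound survives; then \<open>l\<close> tends to \<open>1\<close>.\<close>

lemma sphere_length_scaled:
  assumes "\<And>t. t \<in> {0..1} \<Longrightarrow> \<gamma> t \<in> space_form 1"
    and "\<And>t. t \<in> {0..1} \<Longrightarrow> (\<gamma> has_vector_derivative \<gamma>' t) (at t within {0..1})"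
    and "continuous_on {0..1} (\<lambda>t. sqrt (mform 1 (\<gamma>' t) (\<gamma>' t)))"
    and "0 < l" "l < 1"
  shows "arccos (l * mform 1 (\<gamma> 0) (\<gamma> 1)) - arccos l \<le> integral {0..1} (\<lambda>t. sqrt (mform 1 (\<gamma>' t) (\<gamma>' t)))"
proof -
  let ?u = "\<lambda>t. mform 1 (\<gamma> 0) (\<gamma> t)" and ?u' = "\<lambda>t. mform 1 (\<gamma> 0) (\<gamma>' t)"
  have u: "\<bar>?u t\<bar> \<le> 1" if "t \<in> {0..1}" for t
    using assms(1)[of 0] assms(1)[OF that] by (intro sphere_mform_abs) auto
  have lu: "\<bar>l * ?u t\<bar> < 1" if "t \<in> {0..1}" for t
    using mult_left_mono[OF u[OF that], of l] assms(4,5) unfolding abs_mult by linarith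
  have bound: "inverse (- sqrt (1 - (l * ?u t)\<^sup>2)) * (l * ?u' t) \<le> sqrt (mform 1 (\<gamma>' t) (\<gamma>' t))"
    if t: "t \<in> {0..1}" for t
  proof -
    have t0: "(0::real) \<in> {0..1}" by simp
    have tan: "\<gamma>' t \<in> tangent_space 1 (\<gamma> t)"
      using velocity_tangent[of \<gamma> 1 t] assms(1,2) t by blast
    let ?s = "mform 1 (\<gamma>' t) (\<gamma>' t)"
    have s: "?s \<ge> 0" using mform_tangent_nonneg[of 1 "\<gamma> t"] assms(1) t tan by auto
    have pos: "1 - (l * ?u t)\<^sup>2 > 0" using lu[OF t] abs_square_less_1[of "l * ?u t"] by simp
    have "(l * ?u' t)\<^sup>2 = l\<^sup>2 * (?u' t)\<^sup>2" by (rule power_mult_distrib)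
    also have "\<dots> \<le> l\<^sup>2 * ((1 - (?u t)\<^sup>2) * ?s)"
      using mform_points(2)[of 1 "\<gamma> 0" "\<gamma> t" "\<gamma>' t"] assms(1)[OF t0] assms(1)[OF t] tan
      by (intro mult_left_mono) auto
    also have "\<dots> = (l\<^sup>2 - (l * ?u t)\<^sup>2) * ?s" by (simp add: algebra_simps power_mult_distrib)
    also have "\<dots> \<le> (1 - (l * ?u t)\<^sup>2) * ?s"
      using s assms(4,5) by (intro mult_right_mono) (auto simp: power_le_one)
    finally have "\<bar>l * ?u' t\<bar> \<le> sqrt (1 - (l * ?u t)\<^sup>2) * sqrt ?s"
      by (metis real_sqrt_abs real_sqrt_le_iff real_sqrt_mult)
    then have "- (l * ?u' t) \<le> sqrt (1 - (l * ?u t)\<^sup>2) * sqrt ?s" by linarith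
    then show ?thesis using pos by (simp add: field_simps)
  qed
  have "((\<lambda>t. arccos (l * ?u t)) has_real_derivative inverse (- sqrt (1 - (l * ?u t)\<^sup>2)) * (l * ?u' t))
      (at t within {0..1})" if "t \<in> {0..1}" for t
  proof (rule DERIV_chain2[OF DERIV_arccos])
    show "((\<lambda>t. l * ?u t) has_real_derivative l * ?u' t) (at t within {0..1})"
      using mform_right_derivative[OF assms(2)[OF that]]
      by (intro DERIV_cmult) (simp add: has_real_derivative_iff_has_vector_derivative)
  qed (use lu[OF that] in auto)
  from growth_le_integral[OF this bound assms(3)] show ?thesis
    using mform_self[of 1 "\<gamma> 0"] assms(1)[of 0] by simp
qed

text \<open>Here the scaling goes upwards: \<open>arcosh\<close> is singular at 1 and its argument
  is at least 1, so a factor above 1 keeps it in the smooth range, and l^2 \<ge> 1 has the right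
  sign in the derivative bound.\<close>

lemma hyperboloid_length_scaled:
  assumes "\<And>t. t \<in> {0..1} \<Longrightarrow> \<gamma> t \<in> space_form (-1)"
    and "\<And>t. t \<in> {0..1} \<Longrightarrow> (\<gamma> has_vector_derivative \<gamma>' t) (at t within {0..1})"
    and "continuous_on {0..1} (\<lambda>t. sqrt (mform (-1) (\<gamma>' t) (\<gamma>' t)))"
    and "1 < l"
  shows "arcosh (l * - mform (-1) (\<gamma> 0) (\<gamma> 1)) - arcosh l
    \<le> integral {0..1} (\<lambda>t. sqrt (mform (-1) (\<gamma>' t) (\<gamma>' t)))"
proof -
  let ?u = "\<lambda>t. - mform (-1) (\<gamma> 0) (\<gamma> t)" and ?u' = "\<lambda>t. - mform (-1) (\<gamma> 0) (\<gamma>' t)"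
  have u: "?u t \<ge> 1" if "t \<in> {0..1}" for t
    using hyperboloid_mform_neg[OF assms(1)[of 0] assms(1)[OF that]] by simp
  have lu: "l * ?u t > 1" if "t \<in> {0..1}" for t
    using mult_left_mono[OF u[OF that], of l] assms(4) by simp
  have bound: "1 / sqrt ((l * ?u t)\<^sup>2 - 1) * (l * ?u' t) \<le> sqrt (mform (-1) (\<gamma>' t) (\<gamma>' t))"
    if t: "t \<in> {0..1}" for t
  proof -
    have t0: "(0::real) \<in> {0..1}" by simp
    have tan: "\<gamma>' t \<in> tangent_space (-1) (\<gamma> t)"
      using velocity_tangent[of \<gamma> "-1" t] assms(1,2) t by blast
    let ?s = "mform (-1) (\<gamma>' t) (\<gamma>' t)"
    have s: "?s \<ge> 0" using mform_tangent_nonneg[of "-1" "\<gamma> t"] assms(1) t tan by auto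
    have pos: "(l * ?u t)\<^sup>2 - 1 > 0" using lu[OF t] by (smt (verit) one_less_power pos2)
    have "(l * ?u' t)\<^sup>2 = l\<^sup>2 * (?u' t)\<^sup>2" by (rule power_mult_distrib)
    also have "\<dots> \<le> l\<^sup>2 * (((?u t)\<^sup>2 - 1) * ?s)"
      using mform_points(2)[of "-1" "\<gamma> 0" "\<gamma> t" "\<gamma>' t"] assms(1)[OF t0] assms(1)[OF t] tan
      by (intro mult_left_mono) auto
    also have "\<dots> = ((l * ?u t)\<^sup>2 - l\<^sup>2) * ?s" by (simp add: algebra_simps power_mult_distrib)
    also have "\<dots> \<le> ((l * ?u t)\<^sup>2 - 1) * ?s"
      using s assms(4) by (intro mult_right_mono) auto
    finally have "\<bar>l * ?u' t\<bar> \<le> sqrt ((l * ?u t)\<^sup>2 - 1) * sqrt ?s"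
      by (metis real_sqrt_abs real_sqrt_le_iff real_sqrt_mult)
    then have "l * ?u' t \<le> sqrt ((l * ?u t)\<^sup>2 - 1) * sqrt ?s" by linarith
    then show ?thesis using pos by (simp add: field_simps)
  qed
  have "((\<lambda>t. arcosh (l * ?u t)) has_real_derivative 1 / sqrt ((l * ?u t)\<^sup>2 - 1) * (l * ?u' t))
      (at t within {0..1})" if "t \<in> {0..1}" for t
  proof (rule DERIV_chain2[OF arcosh_real_has_field_derivative])
    show "((\<lambda>t. l * ?u t) has_real_derivative l * ?u' t) (at t within {0..1})"
      using mform_right_derivative[OF assms(2)[OF that]]
      by (intro DERIV_cmult DERIV_minus) (simp add: has_real_derivative_iff_has_vector_derivative)
  qed (use lu[OF that] in auto)
  from growth_le_integral[OF this bound assms(3)] show ?thesis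
    using mform_self[of "-1" "\<gamma> 0"] assms(1)[of 0] by simp
qed

text \<open>The number \<theta> is known only through its chord, which determines it as an arccos, a
  norm or an arcosh of data of the end points. The curved cases are limits of the scaled estimates,
  from below on the sphere and from above on the hyperboloid; the flat case bounds the norm of an
  integral by the integral of the norm.\<close>

lemma curve_length_ge:
  assumes k: "\<kappa> \<in> {-1, 0, 1}" and L: "L \<in> curve_lengths \<kappa> p q"
    and \<theta>: "0 \<le> \<theta>" "\<kappa> = 1 \<Longrightarrow> \<theta> \<le> pi" "chord \<kappa> \<theta> = mform \<kappa> (q - p) (q - p)"
  shows "\<theta> \<le> L"
proof -
  obtain \<gamma> \<gamma>' where \<gamma>: "\<And>t. t \<in> {0..1} \<Longrightarrow> \<gamma> t \<in> space_form \<kappa>"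
    "\<And>t. t \<in> {0..1} \<Longrightarrow> (\<gamma> has_vector_derivative \<gamma>' t) (at t within {0..1})"
    "continuous_on {0..1} \<gamma>'" "\<gamma> 0 = p" "\<gamma> 1 = q"
    "L = integral {0..1} (\<lambda>t. sqrt (mform \<kappa> (\<gamma>' t) (\<gamma>' t)))"
    using L unfolding curve_lengths_def by blast
  have cont: "continuous_on {0..1} (\<lambda>t. sqrt (mform \<kappa> (\<gamma>' t) (\<gamma>' t)))"
    by (intro continuous_on_real_sqrt bounded_bilinear.continuous_on[OF bounded_bilinear_mform] \<gamma>(3))
  have p: "p \<in> space_form \<kappa>" and q: "q \<in> space_form \<kappa>"
    using \<gamma>(1)[of 0] \<gamma>(1)[of 1] \<gamma>(4,5) by auto
  have cs: "cs \<kappa> \<theta> = \<kappa> * mform \<kappa> p q" if "\<kappa> \<in> {-1, 1}"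
    using that \<theta>(3) by (auto simp: chord_def mform_simps mform_self[OF that p] mform_self[OF that q] mform_commute[of _ q p])
  consider "\<kappa> = 1" | "\<kappa> = 0" | "\<kappa> = -1" using k by blast
  then show ?thesis
  proof cases
    case 1
    let ?u = "mform 1 p q"
    have u: "\<bar>?u\<bar> \<le> 1" using sphere_mform_abs[of p q] p q 1 by simp
    have ev: "\<forall>\<^sub>F l in at_left (1::real). 0 < l \<and> l < 1"
      by (rule eventually_at_leftI[of 0]) auto
    have lim: "((\<lambda>l. l * c) \<longlongrightarrow> c) (at_left 1)" for c :: real
      by (rule tendsto_eq_intros refl tendsto_ident_at)+ simp
    have lim2: "((\<lambda>l. arccos (l * c)) \<longlongrightarrow> arccos c) (at_left 1)" if "\<bar>c\<bar> \<le> 1" for c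
    proof (rule continuous_on_tendsto_compose[OF continuous_on_arccos' lim])
      show "\<forall>\<^sub>F l in at_left 1. l * c \<in> {-1..1}"
        using ev
      proof eventually_elim
        case (elim l)
        then have "\<bar>l * c\<bar> \<le> 1" using that by (simp add: abs_mult mult_le_one)
        then show ?case by auto
      qed
    qed (use that in auto)
    have "arccos ?u - arccos 1 \<le> L"
    proof (rule tendsto_upperbound)
      \<comment> \<open>Writing \<open>l * 1\<close> makes the second term an instance of
        \<open>lim2\<close>, with c = 1.\<close>
      show "((\<lambda>l. arccos (l * ?u) - arccos (l * 1)) \<longlongrightarrow> arccos ?u - arccos 1) (at_left 1)"
        by (intro tendsto_diff lim2 u) simp
      show "\<forall>\<^sub>F l in at_left 1. arccos (l * ?u) - arccos (l * 1) \<le> L"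
        using ev
        by eventually_elim (use sphere_length_scaled[of \<gamma> \<gamma>'] \<gamma> cont 1 in simp)
    qed simp
    moreover have "arccos ?u = \<theta>" using cs \<theta>(1,2) 1 by (metis arccos_cos cs_def insertCI mult_1 zero_neq_one)
    ultimately show ?thesis by simp
  next
    case 2
    have "((\<lambda>t. snd (\<gamma>' t)) has_integral (snd (\<gamma> 1) - snd (\<gamma> 0))) {0..1}"
      by (intro fundamental_theorem_of_calculus bounded_linear.has_vector_derivative[OF bounded_linear_snd] \<gamma>(2)) auto
    then have i: "(\<lambda>t. snd (\<gamma>' t)) integrable_on {0..1}"
      and "norm (snd (\<gamma> 1) - snd (\<gamma> 0)) = norm (integral {0..1} (\<lambda>t. snd (\<gamma>' t)))"
      by (auto simp: integral_unique)
    note this(2)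
    also have "norm (integral {0..1} (\<lambda>t. snd (\<gamma>' t))) \<le> L"
      unfolding \<gamma>(6)
      by (intro integral_norm_bound_integral i integrable_continuous_interval cont)
        (simp add: 2 mform_def norm_eq_sqrt_inner)
    finally have "norm (snd q - snd p) \<le> L" using \<gamma>(4,5) by simp
    moreover have "\<theta>\<^sup>2 = (norm (snd q - snd p))\<^sup>2"
      using \<theta>(3) 2 by (simp add: chord_def mform_def power2_norm_eq_inner)
    ultimately show ?thesis using \<theta>(1) by (simp add: power2_eq_iff_nonneg)
  next
    case 3
    let ?u = "- mform (-1) p q"
    have u: "?u \<ge> 1" using hyperboloid_mform_neg[of p q] p q 3 by simp
    have ev: "\<forall>\<^sub>F l in at_right (1::real). 1 < l"
      by (rule eventually_at_rightI[of _ 2]) auto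
    have lim2: "((\<lambda>l. arcosh (l * c)) \<longlongrightarrow> arcosh c) (at_right 1)" if "1 \<le> c" for c :: real
    proof (rule tendsto_arcosh_strong)
      show "((\<lambda>l. l * c) \<longlongrightarrow> c) (at_right 1)"
        by (rule tendsto_eq_intros refl tendsto_ident_at)+ simp
      show "\<forall>\<^sub>F l in at_right 1. 1 \<le> l * c"
        using ev by eventually_elim (use that mult_mono[of 1 _ 1 c] in auto)
    qed (use that in auto)
    have "arcosh ?u - arcosh 1 \<le> L"
    proof (rule tendsto_upperbound)
      show "((\<lambda>l. arcosh (l * ?u) - arcosh (l * 1)) \<longlongrightarrow> arcosh ?u - arcosh 1) (at_right 1)"
        by (intro tendsto_diff lim2 u) simp
      show "\<forall>\<^sub>F l in at_right 1. arcosh (l * ?u) - arcosh (l * 1) \<le> L"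
        using ev
        by eventually_elim (use hyperboloid_length_scaled[of \<gamma> \<gamma>'] \<gamma> cont 3 in simp)
    qed simp
    moreover have "arcosh ?u = \<theta>" using cs \<theta>(1) 3 arcosh_cosh_real[of \<theta>] by (simp add: cs_def)
    ultimately show ?thesis by simp
  qed
qed

section \<open>Minimising geodesics and polar coordinates\<close>

lemma ex_unit_tangent:
  assumes "\<kappa> \<in> {-1, 0, 1}" "(p :: real \<times> 'e::euclidean_space) \<in> space_form \<kappa>"
  shows "\<exists>e\<in>tangent_space \<kappa> p. mform \<kappa> e e = 1"
proof -
  have "2 \<le> DIM(real \<times> 'e)" using DIM_positive[where 'a='e] by simp
  then obtain y where y: "y \<noteq> 0" "orthogonal (fst p, \<kappa> *\<^sub>R snd p) y"
    by (rule orthogonal_to_vector_exists)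
  then have t: "y \<in> tangent_space \<kappa> p"
    by (simp add: orthogonal_def tangent_space_def inner_prod_def)
  have pos: "0 < mform \<kappa> y y" by (rule mform_tangent_pos[OF assms t y(1)])
  let ?e = "(1 / sqrt (mform \<kappa> y y)) *\<^sub>R y"
  have "?e \<in> tangent_space \<kappa> p" using t by (simp add: tangent_space_iff qform_simps)
  moreover have "mform \<kappa> ?e ?e = 1" using pos by (simp add: mform_simps field_simps)
  ultimately show ?thesis by blast
qed

text \<open>The quadric equation is \<open>cs_sn\<close>. The real point is to stay on the upper
  sheet of the hyperboloid: Cauchy--Schwarz gives |fst e| < fst p, and |sinh| \<le> cosh then keeps
  the first coordinate positive.\<close>

lemma geodesic_in_space_form:
  assumes "\<kappa> \<in> {-1, 0, 1}" "p \<in> space_form \<kappa>" "e \<in> tangent_space \<kappa> p" "mform \<kappa> e e = 1"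
  shows "cs \<kappa> t *\<^sub>R p + sn \<kappa> t *\<^sub>R e \<in> space_form \<kappa>"
proof -
  let ?g = "cs \<kappa> t *\<^sub>R p + sn \<kappa> t *\<^sub>R e"
  have ee: "qform \<kappa> e e = \<kappa>" using qform_tangent[OF assms(1-3,3)] assms(4) by simp
  have pe: "qform \<kappa> p e = 0" using assms(3) by (simp add: tangent_space_iff)
  have "qform \<kappa> ?g ?g = (cs \<kappa> t)\<^sup>2 + \<kappa> * (sn \<kappa> t)\<^sup>2"
    using ee pe qform_self[OF assms(2)] qform_commute[of \<kappa> e p]
    by (simp add: qform_simps power2_eq_square)
  then have 1: "qform \<kappa> ?g ?g = 1" using cs_sn[OF assms(1)] by simp
  have "fst ?g > 0" if "\<kappa> \<le> 0"
  proof (cases "\<kappa> = 0")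
    case True
    then have "fst e = 0" "fst p > 0" using assms(2,3) by (auto simp: tangent_space_def space_form_def)
    then show ?thesis using True by (simp add: cs_def)
  next
    case False
    then have k: "\<kappa> = -1" using assms(1) that by auto
    have p: "(fst p)\<^sup>2 = 1 + snd p \<bullet> snd p" "fst p > 0"
      using assms(2) k by (auto simp: space_form_def)
    have e: "fst p * fst e = snd p \<bullet> snd e" "snd e \<bullet> snd e = 1 + (fst e)\<^sup>2"
      using assms(3,4) k by (auto simp: tangent_space_def mform_def power2_eq_square)
    have "(fst p)\<^sup>2 * (fst e)\<^sup>2 \<le> ((fst p)\<^sup>2 - 1) * (1 + (fst e)\<^sup>2)"
      using Cauchy_Schwarz_ineq[of "snd p" "snd e"] p(1) e
      by (metis add_diff_cancel_left' power_mult_distrib)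
    then have "(fst e)\<^sup>2 < (fst p)\<^sup>2" by (simp add: algebra_simps)
    then have "\<bar>fst e\<bar> < fst p" using p(2) by (metis abs_of_pos power2_abs power2_less_imp_less less_imp_le)
    moreover have "\<bar>sinh t\<bar> \<le> cosh t" using sinh_less_cosh_real[of t] sinh_less_cosh_real[of "-t"] by auto
    ultimately have "\<bar>sinh t\<bar> * \<bar>fst e\<bar> \<le> cosh t * \<bar>fst e\<bar>" "cosh t * \<bar>fst e\<bar> < cosh t * fst p"
      using cosh_real_pos[of t] by (auto intro: mult_right_mono)
    then have "\<bar>sinh t * fst e\<bar> < cosh t * fst p" unfolding abs_mult by linarith
    then show ?thesis using k by (simp add: cs_def sn_def)
  qed
  with 1 show ?thesis by (auto simp: space_form_def qform_def power2_eq_square)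
qed

lemma geodesic_length:
  assumes "\<kappa> \<in> {-1, 0, 1}" "p \<in> space_form \<kappa>" "e \<in> tangent_space \<kappa> p" "mform \<kappa> e e = 1" "0 \<le> \<theta>"
  shows "\<theta> \<in> curve_lengths \<kappa> p (cs \<kappa> \<theta> *\<^sub>R p + sn \<kappa> \<theta> *\<^sub>R e)"
proof -
  define \<gamma> where "\<gamma> = (\<lambda>t. cs \<kappa> (\<theta> * t) *\<^sub>R p + sn \<kappa> (\<theta> * t) *\<^sub>R e)"
  define \<gamma>' where "\<gamma>' = (\<lambda>t. (\<theta> * (- \<kappa> * sn \<kappa> (\<theta> * t))) *\<^sub>R p + (\<theta> * cs \<kappa> (\<theta> * t)) *\<^sub>R e)"
  have d: "((\<lambda>t. cs \<kappa> (\<theta> * t)) has_real_derivative \<theta> * (- \<kappa> * sn \<kappa> (\<theta> * t))) (at t within S)"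
    "((\<lambda>t. sn \<kappa> (\<theta> * t)) has_real_derivative \<theta> * cs \<kappa> (\<theta> * t)) (at t within S)" for t S
  proof -
    have "((*) \<theta> has_real_derivative \<theta>) (at t within S)"
      by (auto intro!: derivative_eq_intros)
    from DERIV_chain2[OF cs_derivative[OF assms(1)] this] DERIV_chain2[OF sn_derivative[OF assms(1)] this]
    show "((\<lambda>t. cs \<kappa> (\<theta> * t)) has_real_derivative \<theta> * (- \<kappa> * sn \<kappa> (\<theta> * t))) (at t within S)"
      "((\<lambda>t. sn \<kappa> (\<theta> * t)) has_real_derivative \<theta> * cs \<kappa> (\<theta> * t)) (at t within S)"
      by (simp_all add: mult.commute)
  qed
  have "(\<gamma> has_vector_derivative \<gamma>' t) (at t within {0..1})" for t
  proof -
    have "((\<lambda>t. cs \<kappa> (\<theta> * t) *\<^sub>R p) has_vector_derivative (\<theta> * (- \<kappa> * sn \<kappa> (\<theta> * t))) *\<^sub>R p) (at t within {0..1})"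
      "((\<lambda>t. sn \<kappa> (\<theta> * t) *\<^sub>R e) has_vector_derivative (\<theta> * cs \<kappa> (\<theta> * t)) *\<^sub>R e) (at t within {0..1})"
      using has_vector_derivative_scaleR[OF d(1) has_vector_derivative_const[of p]]
        has_vector_derivative_scaleR[OF d(2) has_vector_derivative_const[of e]] by auto
    from has_vector_derivative_add[OF this] show ?thesis by (simp add: \<gamma>_def \<gamma>'_def)
  qed
  moreover have "\<gamma> t \<in> space_form \<kappa>" for t
    unfolding \<gamma>_def by (rule geodesic_in_space_form[OF assms(1-4)])
  moreover have "continuous_on {0..1} \<gamma>'"
  proof -
    have "continuous_on {0..1} (\<lambda>t. cs \<kappa> (\<theta> * t))" "continuous_on {0..1} (\<lambda>t. sn \<kappa> (\<theta> * t))"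
      using d by (auto intro!: DERIV_continuous_on)
    then show ?thesis unfolding \<gamma>'_def by (intro continuous_intros)
  qed
  moreover have "\<gamma> 0 = p" "\<gamma> 1 = cs \<kappa> \<theta> *\<^sub>R p + sn \<kappa> \<theta> *\<^sub>R e"
    by (simp_all add: \<gamma>_def cs_def sn_def)
  moreover have "mform \<kappa> (\<gamma>' t) (\<gamma>' t) = \<theta>\<^sup>2" for t
  proof -
    have z: "\<kappa> * mform \<kappa> p e = 0" "\<kappa> * mform \<kappa> e p = 0"
      using mform_tangent_point[OF assms(1,3)] mform_commute[of \<kappa> e p] by auto
    \<comment> \<open>Stated with \<kappa>^2 in front so that it also holds in the flat case, where
      the metric square of p is arbitrary.\<close>
    have pp: "\<kappa>\<^sup>2 * mform \<kappa> p p = \<kappa>"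
      using mform_self[of \<kappa> p] assms(1,2) by auto
    have "mform \<kappa> (\<gamma>' t) (\<gamma>' t) = \<theta>\<^sup>2 * ((sn \<kappa> (\<theta> * t))\<^sup>2 * (\<kappa>\<^sup>2 * mform \<kappa> p p)
        - sn \<kappa> (\<theta> * t) * cs \<kappa> (\<theta> * t) * (\<kappa> * mform \<kappa> p e + \<kappa> * mform \<kappa> e p) + (cs \<kappa> (\<theta> * t))\<^sup>2)"
      by (simp add: \<gamma>'_def mform_simps assms(4) algebra_simps power2_eq_square)
    then have "mform \<kappa> (\<gamma>' t) (\<gamma>' t) = \<theta>\<^sup>2 * ((cs \<kappa> (\<theta> * t))\<^sup>2 + \<kappa> * (sn \<kappa> (\<theta> * t))\<^sup>2)"
      unfolding z pp by (simp add: algebra_simps)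
    then show ?thesis using cs_sn[OF assms(1), of "\<theta> * t"] by simp
  qed
  moreover have "\<theta> = integral {0..1} (\<lambda>t::real. sqrt (\<theta>\<^sup>2))" using assms(5) by simp
  ultimately show ?thesis unfolding curve_lengths_def
    by (intro CollectI exI[of _ \<gamma>] exI[of _ \<gamma>']) auto
qed

text \<open>The radius is forced by the chord. Subtracting
  \<open>cs \<kappa> \<theta> *\<^sub>R p\<close> from q leaves a tangent vector at p whose square
  is the square of \<open>sn \<kappa> \<theta>\<close>, and dividing by the latter gives the
  direction.\<close>

lemma polar_coordinates:
  assumes "\<kappa> \<in> {-1, 0, 1}" "p \<in> space_form \<kappa>" "q \<in> space_form \<kappa>"
  shows "\<exists>\<theta> e. 0 \<le> \<theta> \<and> (\<kappa> = 1 \<longrightarrow> \<theta> \<le> pi) \<and> e \<in> tangent_space \<kappa> p \<and> mform \<kappa> e e = 1 \<and>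
    q = cs \<kappa> \<theta> *\<^sub>R p + sn \<kappa> \<theta> *\<^sub>R e"
proof -
  obtain \<theta> where \<theta>: "0 \<le> \<theta>" "\<kappa> = 1 \<longrightarrow> \<theta> \<le> pi" "chord \<kappa> \<theta> = mform \<kappa> (q - p) (q - p)"
  proof -
    consider "\<kappa> = 1" | "\<kappa> = 0" | "\<kappa> = -1" using assms(1) by blast
    then show ?thesis
    proof cases
      case 1
      then have "\<bar>mform 1 p q\<bar> \<le> 1" using sphere_mform_abs[of p q] assms by simp
      then show ?thesis using 1 assms mform_self[of 1 p] mform_self[of 1 q]
        by (intro that[of "arccos (mform 1 p q)"])
          (auto simp: arccos_lbound arccos_ubound chord_def cs_def cos_arccos mform_simps mform_commute[of _ q p])
    next
      case 2
      then show ?thesis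
        by (intro that[of "norm (snd q - snd p)"]) (auto simp: chord_def mform_def power2_norm_eq_inner)
    next
      case 3
      then have "- mform (-1) p q \<ge> 1" using hyperboloid_mform_neg[of p q] assms by auto
      then show ?thesis using 3 assms mform_self[of "-1" p] mform_self[of "-1" q]
        by (intro that[of "arcosh (- mform (-1) p q)"])
          (auto simp: chord_def cs_def mform_simps mform_commute[of _ q p])
    qed
  qed
  let ?w = "q - cs \<kappa> \<theta> *\<^sub>R p"
  have w: "?w \<in> tangent_space \<kappa> p \<and> mform \<kappa> ?w ?w = (sn \<kappa> \<theta>)\<^sup>2"
  proof (cases "\<kappa> = 0")
    case True
    then have "fst p = 1" "fst q = 1"
      using assms by (auto simp: space_form_def power2_eq_1_iff)
    then show ?thesis using True \<theta>(3)
      by (simp add: tangent_space_def cs_def sn_def chord_def)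
  next
    case False
    then have k: "\<kappa> \<in> {-1, 1}" using assms(1) by auto
    then have kk: "\<kappa> * \<kappa> = 1" by auto
    have c: "mform \<kappa> p q = \<kappa> * cs \<kappa> \<theta>"
      using \<theta>(3) k
      by (auto simp: chord_def mform_simps mform_self[OF k assms(2)] mform_self[OF k assms(3)] mform_commute[of _ q p])
    have "qform \<kappa> p ?w = 0"
      using kk by (simp only: qform_simps qform_self[OF assms(2)] qform_eq_mform[OF k, of p q] c
          flip: mult.assoc) simp
    moreover have "mform \<kappa> ?w ?w = \<kappa> * (1 - (cs \<kappa> \<theta>)\<^sup>2)"
      by (simp add: mform_simps mform_self[OF k assms(2)] mform_self[OF k assms(3)] mform_commute[of _ q p] c
          algebra_simps power2_eq_square)
    moreover have "1 - (cs \<kappa> \<theta>)\<^sup>2 = \<kappa> * (sn \<kappa> \<theta>)\<^sup>2" using cs_sn[OF assms(1), of \<theta>] by simp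
    ultimately show ?thesis using kk
      by (simp add: tangent_space_iff flip: mult.assoc)
  qed
  show ?thesis
  proof (cases "sn \<kappa> \<theta> = 0")
    case True
    \<comment> \<open>At distance 0, and at the antipode on the sphere, the direction is
      undetermined and any unit tangent vector serves.\<close>
    obtain e where e: "e \<in> tangent_space \<kappa> p" "mform \<kappa> e e = 1"
      using ex_unit_tangent[OF assms(1,2)] by blast
    have "?w = 0" using mform_tangent_pos[OF assms(1,2), of ?w] w True by fastforce
    then show ?thesis using e True \<theta> by (intro exI[of _ \<theta>] exI[of _ e]) auto
  next
    case False
    let ?e = "(1 / sn \<kappa> \<theta>) *\<^sub>R ?w"
    have "?e \<in> tangent_space \<kappa> p" using w by (simp add: tangent_space_iff qform_simps del: scaleR_right_diff_distrib)
    moreover have "mform \<kappa> ?e ?e = 1"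
      using w False by (simp only: mform_simps(9,10)) (simp add: power2_eq_square)
    ultimately show ?thesis using \<theta> False by (intro exI[of _ \<theta>] exI[of _ ?e]) auto
  qed
qed

text \<open>The infimum is attained: the geodesic of the polar coordinates has a length equal to the
  lower bound of \<open>curve_length_ge\<close>. What is used of the distance afterwards goes
  through this identity.\<close>

theorem chord_geo_dist:
  assumes "\<kappa> \<in> {-1, 0, 1}" "p \<in> space_form \<kappa>" "q \<in> space_form \<kappa>"
  shows "chord \<kappa> (geo_dist \<kappa> p q) = mform \<kappa> (q - p) (q - p)" "0 \<le> geo_dist \<kappa> p q"
    "\<kappa> = 1 \<Longrightarrow> geo_dist \<kappa> p q \<le> pi"
proof -
  obtain \<theta> e where \<theta>: "0 \<le> \<theta>" "\<kappa> = 1 \<Longrightarrow> \<theta> \<le> pi" and e: "e \<in> tangent_space \<kappa> p" "mform \<kappa> e e = 1"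
    and q: "q = cs \<kappa> \<theta> *\<^sub>R p + sn \<kappa> \<theta> *\<^sub>R e"
    using polar_coordinates[OF assms] by blast
  have chord: "chord \<kappa> \<theta> = mform \<kappa> (q - p) (q - p)"
  proof (cases "\<kappa> = 0")
    case True
    then show ?thesis using e by (simp add: q chord_def cs_def sn_def mform_simps power2_eq_square)
  next
    case False
    then have k: "\<kappa> \<in> {-1, 1}" using assms(1) by auto
    have "mform \<kappa> p e = 0" using mform_tangent_point[OF assms(1) e(1)] False by simp
    then have "mform \<kappa> p q = \<kappa> * cs \<kappa> \<theta>"
      using mform_self[OF k assms(2)] by (simp add: q mform_simps)
    then show ?thesis using False
      by (simp add: chord_def mform_simps mform_self[OF k assms(2)] mform_self[OF k assms(3)] mform_commute[of _ q p]
          algebra_simps)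
  qed
  have "geo_dist \<kappa> p q = \<theta>"
    unfolding geo_dist_def
  proof (rule cInf_eq_minimum)
    show "\<theta> \<in> curve_lengths \<kappa> p q"
      using geodesic_length[OF assms(1,2) e \<theta>(1)] q by simp
    show "\<theta> \<le> L" if "L \<in> curve_lengths \<kappa> p q" for L
      by (rule curve_length_ge[OF assms(1) that \<theta> chord])
  qed
  then show "chord \<kappa> (geo_dist \<kappa> p q) = mform \<kappa> (q - p) (q - p)" "0 \<le> geo_dist \<kappa> p q"
    "\<kappa> = 1 \<Longrightarrow> geo_dist \<kappa> p q \<le> pi"
    using chord \<theta> by auto
qed

section \<open>Distance spheres as chord levels, and the gradient\<close>

lemma geo_sphere_dist:
  assumes k: "\<kappa> \<in> {-1, 0, 1}" and p: "p \<in> space_form \<kappa>" and r: "0 \<le> r" "\<kappa> = 1 \<Longrightarrow> r \<le> pi"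
    and q: "q \<in> geo_sphere \<kappa> p r"
  shows "q \<in> space_form \<kappa>" "geo_dist \<kappa> p q = r"
proof -
  let ?M = "space_form \<kappa>" and ?h = "\<lambda>y. mform \<kappa> (y - p) (y - p)" and ?d = "geo_dist \<kappa> p"
  have less: "?d y < s \<longleftrightarrow> ?h y < chord \<kappa> s" "s < ?d y \<longleftrightarrow> chord \<kappa> s < ?h y"
    if "y \<in> ?M" "0 \<le> s" "\<kappa> = 1 \<Longrightarrow> s \<le> pi" for y s
    using chord_geo_dist[OF k p that(1)] that(2,3) chord_less_iff[OF k, of "?d y" s] chord_less_iff[OF k, of s "?d y"]
    by auto
  have cont: "continuous_on ?M ?h"
    by (intro bounded_bilinear.continuous_on[OF bounded_bilinear_mform] continuous_intros)
  \<comment> \<open>The closed and the open sublevel set of the polynomial \<open>?h\<close> enclose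
    the ball from outside and from inside. A frontier point lies in the first and not in the second,
    so \<open>?h\<close> takes the value \<open>chord \<kappa> r\<close> there.\<close>
  have "closedin (top_of_set ?M) (?M \<inter> ?h -` {..chord \<kappa> r})"
    by (rule continuous_closedin_preimage[OF cont]) simp
  moreover have "geo_ball \<kappa> p r \<subseteq> ?M \<inter> ?h -` {..chord \<kappa> r}"
    using less(2)[of _ r] r by (force simp: geo_ball_def)
  ultimately have cl: "top_of_set ?M closure_of geo_ball \<kappa> p r \<subseteq> ?M \<inter> ?h -` {..chord \<kappa> r}"
    using closure_of_minimal by blast
  have "openin (top_of_set ?M) (?M \<inter> ?h -` {..<chord \<kappa> r})"
    by (rule continuous_openin_preimage_gen[OF cont]) simp
  moreover have "?M \<inter> ?h -` {..<chord \<kappa> r} \<subseteq> geo_ball \<kappa> p r"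
    using less(1)[of _ r] r by (force simp: geo_ball_def)
  ultimately have op: "?M \<inter> ?h -` {..<chord \<kappa> r} \<subseteq> top_of_set ?M interior_of geo_ball \<kappa> p r"
    using interior_of_maximal by blast
  have "q \<in> ?M \<inter> ?h -` {..chord \<kappa> r}" "q \<notin> ?M \<inter> ?h -` {..<chord \<kappa> r}"
    using q cl op unfolding geo_sphere_def frontier_of_def by blast+
  then have "q \<in> ?M" "\<not> chord \<kappa> r < ?h q" "\<not> ?h q < chord \<kappa> r" by auto
  then show "q \<in> ?M" "?d q = r"
    using less[of q r] r by auto
qed

text \<open>The straight line q + t w is rescaled back to the quadric. Its \<open>qform\<close>
  square is 1 + t^2 \<open>qform \<kappa> w w\<close>, even in t, so the scaling factor has
  derivative 0 at t = 0 and the velocity is unchanged. T keeps the square root defined and the curve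
  on the correct sheet.\<close>

lemma curve_with_velocity:
  assumes "\<kappa> \<in> {-1, 0, 1}" "q \<in> space_form \<kappa>" "w \<in> tangent_space \<kappa> q"
  obtains T \<gamma> where "open T" "(0::real) \<in> T" "\<gamma> ` T \<subseteq> space_form \<kappa>" "\<gamma> 0 = q"
    "(\<gamma> has_vector_derivative w) (at 0)"
proof -
  let ?Q = "qform \<kappa> w w"
  define T where "T = {t. 0 < 1 + t\<^sup>2 * ?Q} \<inter> (if \<kappa> \<le> 0 then {t. 0 < fst q + t * fst w} else UNIV)"
  define \<gamma> where "\<gamma> = (\<lambda>t. (1 / sqrt (1 + t\<^sup>2 * ?Q)) *\<^sub>R (q + t *\<^sub>R w))"
  have "open T"
    unfolding T_def by (auto intro!: open_Int open_Collect_less continuous_intros)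
  moreover have "0 \<in> T"
    using assms(2) by (auto simp: T_def space_form_def)
  moreover have "\<gamma> ` T \<subseteq> space_form \<kappa>"
  proof (rule image_subsetI)
    fix t assume t: "t \<in> T"
    have "qform \<kappa> q w = 0" "qform \<kappa> w q = 0"
      using assms(3) by (simp_all add: tangent_space_iff qform_commute)
    then have "qform \<kappa> (q + t *\<^sub>R w) (q + t *\<^sub>R w) = 1 + t\<^sup>2 * ?Q"
      using qform_self[OF assms(2)] by (simp add: qform_simps power2_eq_square)
    moreover have pos: "0 < 1 + t\<^sup>2 * ?Q" using t by (simp add: T_def)
    ultimately have "qform \<kappa> (\<gamma> t) (\<gamma> t) = 1"
      unfolding \<gamma>_def by (simp only: qform_simps(9,10)) (simp add: field_simps)
    moreover have "0 < fst (\<gamma> t)" if "\<kappa> \<le> 0"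
      using t pos that by (simp add: T_def \<gamma>_def)
    ultimately show "\<gamma> t \<in> space_form \<kappa>"
      by (simp add: space_form_def qform_def power2_eq_square)
  qed
  moreover have "\<gamma> 0 = q" by (simp add: \<gamma>_def)
  moreover have "(\<gamma> has_vector_derivative w) (at 0)"
  proof -
    have "((\<lambda>t. 1 / sqrt (1 + t\<^sup>2 * ?Q)) has_real_derivative 0) (at 0)"
      by (auto intro!: derivative_eq_intros)
    moreover have "((\<lambda>t. q + t *\<^sub>R w) has_vector_derivative w) (at 0)"
      by (auto intro!: derivative_eq_intros)
    ultimately show ?thesis
      unfolding \<gamma>_def using has_vector_derivative_scaleR by fastforce
  qed
  ultimately show thesis by (rule that)
qed

lemma covariant_tangent:
  assumes "\<kappa> \<in> {-1, 0, 1}" "q \<in> space_form \<kappa>" "\<kappa> = 0 \<Longrightarrow> fst w = 0"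
  shows "covariant \<kappa> q w \<in> tangent_space \<kappa> q"
proof (cases "\<kappa> = 0")
  case True
  then show ?thesis using assms(3) by (simp add: covariant_def tangent_space_def)
next
  case False
  then have "\<kappa> * mform \<kappa> w q = qform \<kappa> q w"
    using assms(1) qform_eq_mform[of \<kappa> q w] mform_commute[of \<kappa> w q] by auto
  then show ?thesis unfolding covariant_def using projection_tangent[OF assms(2)] by simp
qed

lemma mform_covariant:
  assumes "\<kappa> \<in> {-1, 0, 1}" "v \<in> tangent_space \<kappa> q"
  shows "mform \<kappa> (covariant \<kappa> q w) v = mform \<kappa> w v"
  using mform_tangent_point[OF assms] by (auto simp: covariant_def mform_simps)

text \<open>Along a curve through q with velocity w, \<open>chord\<close> of the distance is
  differentiated twice over: by the chain rule, and as the quadratic polynomial of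
  \<open>chord_geo_dist\<close>. Comparing for all tangent w determines the gradient; keeping
  \<open>sn\<close> as a factor avoids a division.\<close>

lemma gradient_geo_dist:
  assumes k: "\<kappa> \<in> {-1, 0, 1}" and p: "p \<in> space_form \<kappa>" and q: "q \<in> space_form \<kappa>"
    and V: "is_gradient \<kappa> (geo_dist \<kappa> p) q V"
  shows "sn \<kappa> (geo_dist \<kappa> p q) *\<^sub>R V = covariant \<kappa> q (q - p)"
proof (rule tangent_eqI[OF k q])
  let ?d = "geo_dist \<kappa> p"
  have Vt: "V \<in> tangent_space \<kappa> q"
    and Vd: "(?d has_derivative mform \<kappa> V) (at q within space_form \<kappa>)"
    using V by (auto simp: is_gradient_def)
  show "sn \<kappa> (?d q) *\<^sub>R V \<in> tangent_space \<kappa> q"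
    using Vt by (simp add: tangent_space_iff qform_simps)
  show "covariant \<kappa> q (q - p) \<in> tangent_space \<kappa> q"
    using p q by (intro covariant_tangent[OF k q]) (auto simp: space_form_def power2_eq_1_iff)
  fix w assume w: "w \<in> tangent_space \<kappa> q"
  obtain T \<gamma> where T: "open T" "(0::real) \<in> T" "\<gamma> ` T \<subseteq> space_form \<kappa>" "\<gamma> 0 = q"
    and \<gamma>: "(\<gamma> has_vector_derivative w) (at 0)"
    using curve_with_velocity[OF k q w] by blast
  have "(?d has_derivative mform \<kappa> V) (at (\<gamma> 0) within \<gamma> ` T)"
    using has_derivative_subset[OF Vd T(3)] T(4) by simp
  then have "((?d \<circ> \<gamma>) has_derivative mform \<kappa> V \<circ> (\<lambda>h. h *\<^sub>R w)) (at 0 within T)"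
    using diff_chain_within[of \<gamma> "\<lambda>h. h *\<^sub>R w" 0 T ?d "mform \<kappa> V"]
      has_derivative_at_withinI[OF \<gamma>[unfolded has_vector_derivative_def]]
    by simp
  then have "((\<lambda>t. ?d (\<gamma> t)) has_real_derivative mform \<kappa> V w) (at 0)"
    unfolding at_within_open[OF T(2,1)] o_def
    by (rule has_derivative_imp_has_field_derivative) (simp add: mform_simps(10))
  from DERIV_chain2[OF chord_derivative[OF k] this]
  have "((\<lambda>t. chord \<kappa> (?d (\<gamma> t))) has_real_derivative 2 * sn \<kappa> (?d q) * mform \<kappa> V w) (at 0)"
    using T(4) by simp
  moreover have "((\<lambda>t. chord \<kappa> (?d (\<gamma> t))) has_real_derivative 2 * mform \<kappa> (q - p) w) (at 0)"
  proof -
    have "((\<lambda>t. \<gamma> t - p) has_vector_derivative w) (at 0)"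
      using has_vector_derivative_diff[OF \<gamma> has_vector_derivative_const[of p]] by simp
    from bounded_bilinear.has_vector_derivative[OF bounded_bilinear_mform[of \<kappa>] this this]
    have "((\<lambda>t. mform \<kappa> (\<gamma> t - p) (\<gamma> t - p)) has_real_derivative 2 * mform \<kappa> (q - p) w) (at 0)"
      using T(4) by (simp add: has_real_derivative_iff_has_vector_derivative mform_commute[of \<kappa> w "q - p"])
    moreover have "mform \<kappa> (\<gamma> t - p) (\<gamma> t - p) = chord \<kappa> (?d (\<gamma> t))" if "t \<in> T" for t
      using chord_geo_dist(1)[OF k p, of "\<gamma> t"] T(3) that by auto
    ultimately show ?thesis
      by (rule has_field_derivative_transform_within_open[OF _ T(1,2)])
  qed
  ultimately have "2 * sn \<kappa> (?d q) * mform \<kappa> V w = 2 * mform \<kappa> (q - p) w"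
    by (rule DERIV_unique)
  then show "mform \<kappa> (sn \<kappa> (?d q) *\<^sub>R V) w = mform \<kappa> (covariant \<kappa> q (q - p)) w"
    using mform_covariant[OF k w] by (simp add: mform_simps)
qed

section \<open>The first variation of the mean curvature at a point\<close>

context hypersurface_frame
begin

text \<open>Christoffel symbols in extrinsic form: when E2 holds the second derivatives of an
  immersion, these are the tangential coefficients of E2.\<close>

definition \<Gamma> :: "('n \<Rightarrow> 'n \<Rightarrow> real \<times> 'e) \<Rightarrow> 'n \<Rightarrow> 'n \<Rightarrow> 'n \<Rightarrow> real" where
  "\<Gamma> E2 k i j = (\<Sum>l\<in>UNIV. G $ k $ l * mform \<kappa> (E2 i j) (E l))"

lemma Weingarten:
  assumes "w \<in> tangent_space \<kappa> F" "mform \<kappa> N w = 0"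
  shows "mform \<kappa> v w = (\<Sum>k\<in>UNIV. \<Sum>l\<in>UNIV. G $ k $ l * mform \<kappa> w (E l) * mform \<kappa> v (E k))"
proof -
  have "w = (\<Sum>k\<in>UNIV. (\<Sum>l\<in>UNIV. G $ k $ l * mform \<kappa> w (E l)) *\<^sub>R E k)"
    using tangent_decomp[OF assms(1)] unfolding assms(2) by simp
  then have "mform \<kappa> v w = mform \<kappa> v (\<Sum>k\<in>UNIV. (\<Sum>l\<in>UNIV. G $ k $ l * mform \<kappa> w (E l)) *\<^sub>R E k)"
    by (rule arg_cong)
  then show ?thesis by (simp only: mform_simps real_scaleR_def sum_distrib_right)
qed

text \<open>The hypothesis measures the position component of w, and adding
  \<open>(\<kappa> * c) *\<^sub>R F\<close> makes w tangent. For second derivatives of an immersion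
  c is the metric coefficient; this component carries the ambient curvature.\<close>

lemma Gauss:
  assumes "qform \<kappa> F w = - \<kappa> * c"
  shows "mform \<kappa> w v = mform \<kappa> N w * mform \<kappa> N v - c * (\<kappa> * mform \<kappa> F v)
    + (\<Sum>k\<in>UNIV. (\<Sum>l\<in>UNIV. G $ k $ l * mform \<kappa> w (E l)) * mform \<kappa> (E k) v)"
proof -
  let ?w = "w + (\<kappa> * c) *\<^sub>R F"
  have t: "?w \<in> tangent_space \<kappa> F"
    using assms qform_self[OF F] by (simp add: tangent_space_iff qform_simps)
  have FE: "\<kappa> * mform \<kappa> F (E l) = 0" for l
    by (rule mform_tangent_point[OF kappa E_tangent])
  have E: "mform \<kappa> ?w (E l) = mform \<kappa> w (E l)" for l
  proof -
    have "mform \<kappa> ?w (E l) = mform \<kappa> w (E l) + c * (\<kappa> * mform \<kappa> F (E l))"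
      by (simp add: mform_simps)
    then show ?thesis unfolding FE by simp
  qed
  have N: "mform \<kappa> N ?w = mform \<kappa> N w"
  proof -
    have "mform \<kappa> N ?w = mform \<kappa> N w + c * (\<kappa> * mform \<kappa> F N)"
      by (simp add: mform_simps mform_commute[of \<kappa> N F])
    then show ?thesis unfolding mform_tangent_point[OF kappa N_tangent] by simp
  qed
  have "?w = mform \<kappa> N w *\<^sub>R N + (\<Sum>k\<in>UNIV. (\<Sum>l\<in>UNIV. G $ k $ l * mform \<kappa> w (E l)) *\<^sub>R E k)"
    using tangent_decomp[OF t] unfolding E N .
  from arg_cong[OF this, of "\<lambda>u. mform \<kappa> u v"]
  have "mform \<kappa> w v + \<kappa> * c * mform \<kappa> F v = mform \<kappa> N w * mform \<kappa> N v
      + (\<Sum>k\<in>UNIV. (\<Sum>l\<in>UNIV. G $ k $ l * mform \<kappa> w (E l)) * mform \<kappa> (E k) v)"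
    by (simp only: mform_simps(1,9,11) real_scaleR_def)
  then show ?thesis by (simp add: algebra_simps)
qed

lemma trace_gram: "(\<Sum>i\<in>UNIV. \<Sum>j\<in>UNIV. G $ i $ j * mform \<kappa> (E i) (E j)) = real CARD('n)"
proof -
  have "(\<Sum>j\<in>UNIV. G $ i $ j * mform \<kappa> (E i) (E j)) = 1" for i
    using G_gram[of i i] by (simp add: mform_commute[of \<kappa> "E i"])
  then show ?thesis by simp
qed

text \<open>The letters \<open>W\<close>, \<open>W1\<close>, \<open>W2\<close> stand for a variation field and its
  coordinate derivatives, \<open>Nd\<close> and \<open>DG\<close> for the variations of the normal and of the
  inverse metric. The variation field may be tangential: this is how the Codazzi equation enters.\<close>

lemma first_variation:
  fixes E2 W2 N2 :: "'n \<Rightarrow> 'n \<Rightarrow> real \<times> 'e" and W1 N1 :: "'n \<Rightarrow> real \<times> 'e" and W Nd :: "real \<times> 'e"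
    and DG :: "'n \<Rightarrow> 'n \<Rightarrow> real"
  assumes N1: "\<And>i. N1 i \<in> tangent_space \<kappa> F" "\<And>i. mform \<kappa> N (N1 i) = 0"
    and A: "\<And>i j. mform \<kappa> (N1 i) (E j) = - mform \<kappa> N (E2 i j)" "\<And>i j. E2 i j = E2 j i"
    and E2: "\<And>i j. qform \<kappa> F (E2 i j) = - \<kappa> * mform \<kappa> (E i) (E j)"
    and DG: "\<And>i j. DG i j = - (\<Sum>a\<in>UNIV. \<Sum>b\<in>UNIV.
      G $ i $ a * (mform \<kappa> (W1 a) (E b) + mform \<kappa> (E a) (W1 b)) * G $ b $ j)"
    and H: "(\<Sum>i\<in>UNIV. \<Sum>j\<in>UNIV. DG i j * mform \<kappa> (E2 i j) N
      + G $ i $ j * (mform \<kappa> (W2 i j) N + mform \<kappa> (E2 i j) Nd)) = 0"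
    and Nd: "mform \<kappa> N Nd = 0" "\<And>k. mform \<kappa> (E k) Nd = - mform \<kappa> (W1 k) N"
      "\<kappa> * mform \<kappa> F Nd = - \<kappa> * mform \<kappa> W N"
  shows "(\<Sum>i\<in>UNIV. \<Sum>j\<in>UNIV. G $ i $ j *
      ((mform \<kappa> (W2 i j) N + mform \<kappa> (W1 j) (N1 i) + mform \<kappa> (W1 i) (N1 j) + mform \<kappa> W (N2 i j))
        - (\<Sum>k\<in>UNIV. \<Gamma> E2 k i j * (mform \<kappa> (W1 k) N + mform \<kappa> W (N1 k)))))
      + real CARD('n) * \<kappa> * mform \<kappa> W N
    = (\<Sum>i\<in>UNIV. \<Sum>j\<in>UNIV. G $ i $ j * mform \<kappa> W (N2 i j - (\<Sum>k\<in>UNIV. \<Gamma> E2 k i j *\<^sub>R N1 k)))"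
proof -
  define A where "A = (\<lambda>i j. mform \<kappa> (N1 i) (E j))"
  have A_sym: "A i j = A j i" for i j unfolding A_def A(1) by (subst A(2)) (rule refl)
  define S where "S = (\<lambda>h :: 'n \<Rightarrow> 'n \<Rightarrow> real. \<Sum>i\<in>UNIV. \<Sum>j\<in>UNIV. G $ i $ j * h i j)"
  have S_add: "S (\<lambda>i j. h i j + h' i j) = S h + S h'" for h h'
    by (simp add: S_def distrib_left sum.distrib)
  have S_diff: "S (\<lambda>i j. h i j - h' i j) = S h - S h'" for h h'
    by (simp add: S_def right_diff_distrib sum_subtractf)
  have S_cmult: "S (\<lambda>i j. h i j * c) = S h * c" for h c
    by (simp add: S_def sum_distrib_right mult.assoc)
  have S_swap: "S (\<lambda>i j. h j i) = S h" for h
    unfolding S_def by (subst sum.swap) (simp add: G_symmetric)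
  \<comment> \<open>DG is -G dg G, where dg is a sum of two mirror terms. \<open>t\<close> is the
    contribution of one of them when paired with A; by symmetry of G and A the other is
    \<open>t\<close> with both index pairs exchanged.\<close>
  define t where "t = (\<lambda>i j a b. G $ i $ a * mform \<kappa> (W1 a) (E b) * G $ b $ j * A i j)"
  \<comment> \<open>Summing out j and b, the Weingarten expansion of \<open>N1 i\<close> reassembles
    the contraction as a pairing of \<open>W1 a\<close> with \<open>N1 i\<close>.\<close>
  have t1: "(\<Sum>i\<in>UNIV. \<Sum>j\<in>UNIV. \<Sum>a\<in>UNIV. \<Sum>b\<in>UNIV. t i j a b) = S (\<lambda>i a. mform \<kappa> (W1 a) (N1 i))"
    unfolding S_def
  proof (rule sum.cong[OF refl])
    fix i
    have "(\<Sum>j\<in>UNIV. \<Sum>a\<in>UNIV. \<Sum>b\<in>UNIV. t i j a b) = (\<Sum>a\<in>UNIV. \<Sum>j\<in>UNIV. \<Sum>b\<in>UNIV. t i j a b)"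
      by (rule sum.swap)
    also have "\<dots> = (\<Sum>a\<in>UNIV. G $ i $ a * mform \<kappa> (W1 a) (N1 i))"
    proof (rule sum.cong[OF refl])
      fix a
      have "(\<Sum>j\<in>UNIV. \<Sum>b\<in>UNIV. t i j a b) = (\<Sum>b\<in>UNIV. \<Sum>j\<in>UNIV. t i j a b)"
        by (rule sum.swap)
      also have "\<dots> = G $ i $ a * mform \<kappa> (W1 a) (N1 i)"
        unfolding Weingarten[OF N1(1,2), of "W1 a" i] sum_distrib_left
        by (simp add: t_def A_def mult_ac)
      finally show "(\<Sum>j\<in>UNIV. \<Sum>b\<in>UNIV. t i j a b) = G $ i $ a * mform \<kappa> (W1 a) (N1 i)" .
    qed
    finally show "(\<Sum>j\<in>UNIV. \<Sum>a\<in>UNIV. \<Sum>b\<in>UNIV. t i j a b) = (\<Sum>a\<in>UNIV. G $ i $ a * mform \<kappa> (W1 a) (N1 i))" .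
  qed
  have t2: "(\<Sum>i\<in>UNIV. \<Sum>j\<in>UNIV. \<Sum>a\<in>UNIV. \<Sum>b\<in>UNIV. t j i b a)
      = (\<Sum>i\<in>UNIV. \<Sum>j\<in>UNIV. \<Sum>a\<in>UNIV. \<Sum>b\<in>UNIV. t i j a b)"
    by (subst sum.swap) (intro sum.cong refl sum.swap)
  have DGA: "DG i j * mform \<kappa> (E2 i j) N
      = (\<Sum>a\<in>UNIV. \<Sum>b\<in>UNIV. t i j a b) + (\<Sum>a\<in>UNIV. \<Sum>b\<in>UNIV. t j i b a)" for i j
  proof -
    have "mform \<kappa> (E2 i j) N = - A i j"
      unfolding A_def A(1) mform_commute[of \<kappa> N] by simp
    then have "DG i j * mform \<kappa> (E2 i j) N = (\<Sum>a\<in>UNIV. \<Sum>b\<in>UNIV.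
      G $ i $ a * (mform \<kappa> (W1 a) (E b) + mform \<kappa> (E a) (W1 b)) * G $ b $ j * A i j)"
      by (simp add: DG sum_distrib_right)
    also have "\<dots> = (\<Sum>a\<in>UNIV. \<Sum>b\<in>UNIV. t i j a b + t j i b a)"
    proof (intro sum.cong refl)
      fix a b
      have "t j i b a = G $ b $ j * mform \<kappa> (E a) (W1 b) * G $ i $ a * A i j"
        unfolding t_def by (simp only: A_sym[of j i] G_symmetric[of j b] G_symmetric[of a i] mform_commute[of \<kappa> "W1 b"])
      then show "G $ i $ a * (mform \<kappa> (W1 a) (E b) + mform \<kappa> (E a) (W1 b)) * G $ b $ j * A i j = t i j a b + t j i b a"
        unfolding t_def by (simp add: algebra_simps)
    qed
    finally show ?thesis by (simp add: sum.distrib)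
  qed
  have "(\<Sum>i\<in>UNIV. \<Sum>j\<in>UNIV. DG i j * mform \<kappa> (E2 i j) N)
      = S (\<lambda>i j. mform \<kappa> (W1 j) (N1 i)) + S (\<lambda>i j. mform \<kappa> (W1 i) (N1 j))"
    unfolding DGA sum.distrib t2 t1 S_swap[of "\<lambda>i j. mform \<kappa> (W1 j) (N1 i)"] ..
  with H have H1: "S (\<lambda>i j. mform \<kappa> (W1 j) (N1 i)) + S (\<lambda>i j. mform \<kappa> (W1 i) (N1 j))
      + S (\<lambda>i j. mform \<kappa> (W2 i j) N) + S (\<lambda>i j. mform \<kappa> (E2 i j) Nd) = 0"
    unfolding sum.distrib by (simp add: S_def distrib_left sum.distrib)
  \<comment> \<open>In the Gauss splitting of E2 the normal part does not meet Nd, since the normal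
    keeps unit length. The position part yields the metric times \<kappa> (W, N), whose trace is the
    curvature term; the tangential part yields the Christoffel terms of the Laplacian.\<close>
  have "mform \<kappa> (E2 i j) Nd
      = mform \<kappa> (E i) (E j) * (\<kappa> * mform \<kappa> W N) - (\<Sum>k\<in>UNIV. \<Gamma> E2 k i j * mform \<kappa> (W1 k) N)" for i j
    unfolding Gauss[OF E2, of i j Nd] Nd \<Gamma>_def by (simp add: sum_negf)
  then have "S (\<lambda>i j. mform \<kappa> (E2 i j) Nd)
      = S (\<lambda>i j. mform \<kappa> (E i) (E j)) * (\<kappa> * mform \<kappa> W N) - S (\<lambda>i j. \<Sum>k\<in>UNIV. \<Gamma> E2 k i j * mform \<kappa> (W1 k) N)"
    by (simp only: S_diff S_cmult)
  then have H2: "S (\<lambda>i j. mform \<kappa> (E2 i j) Nd)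
      = real CARD('n) * \<kappa> * mform \<kappa> W N - S (\<lambda>i j. \<Sum>k\<in>UNIV. \<Gamma> E2 k i j * mform \<kappa> (W1 k) N)"
    using trace_gram by (simp add: S_def)
  have "(\<Sum>i\<in>UNIV. \<Sum>j\<in>UNIV. G $ i $ j *
      ((mform \<kappa> (W2 i j) N + mform \<kappa> (W1 j) (N1 i) + mform \<kappa> (W1 i) (N1 j) + mform \<kappa> W (N2 i j))
        - (\<Sum>k\<in>UNIV. \<Gamma> E2 k i j * (mform \<kappa> (W1 k) N + mform \<kappa> W (N1 k)))))
    = S (\<lambda>i j. (mform \<kappa> (W2 i j) N + mform \<kappa> (W1 j) (N1 i) + mform \<kappa> (W1 i) (N1 j) + mform \<kappa> W (N2 i j))
        - ((\<Sum>k\<in>UNIV. \<Gamma> E2 k i j * mform \<kappa> (W1 k) N) + (\<Sum>k\<in>UNIV. \<Gamma> E2 k i j * mform \<kappa> W (N1 k))))"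
    unfolding S_def by (simp only: distrib_left sum.distrib)
  moreover have "(\<Sum>i\<in>UNIV. \<Sum>j\<in>UNIV. G $ i $ j * mform \<kappa> W (N2 i j - (\<Sum>k\<in>UNIV. \<Gamma> E2 k i j *\<^sub>R N1 k)))
    = S (\<lambda>i j. mform \<kappa> W (N2 i j) - (\<Sum>k\<in>UNIV. \<Gamma> E2 k i j * mform \<kappa> W (N1 k)))"
    unfolding S_def by (simp only: mform_simps real_scaleR_def)
  ultimately show ?thesis
    using H1 H2 by (simp only: S_add S_diff)
qed

text \<open>Expanding one of the two normal derivatives in the frame by Weingarten produces the
  second pair of inverse metrics in the norm of the second fundamental form.\<close>

lemma sff_square:
  assumes N1: "\<And>i. N1 i \<in> tangent_space \<kappa> F" "\<And>i. mform \<kappa> N (N1 i) = 0"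
  shows "(\<Sum>i\<in>UNIV. \<Sum>j\<in>UNIV. G $ i $ j * mform \<kappa> (N1 i) (N1 j))
    = (\<Sum>i\<in>UNIV. \<Sum>j\<in>UNIV. \<Sum>k\<in>UNIV. \<Sum>l\<in>UNIV. G $ i $ k * G $ j $ l
        * mform \<kappa> (N1 i) (E j) * mform \<kappa> (N1 k) (E l))"
proof (rule sum.cong[OF refl])
  fix i
  have "(\<Sum>k\<in>UNIV. G $ i $ k * mform \<kappa> (N1 i) (N1 k)) = (\<Sum>k\<in>UNIV. \<Sum>j\<in>UNIV. \<Sum>l\<in>UNIV. G $ i $ k * G $ j $ l
        * mform \<kappa> (N1 i) (E j) * mform \<kappa> (N1 k) (E l))"
    unfolding Weingarten[OF N1(1,2), of "N1 i"] sum_distrib_left by (simp add: mult_ac)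
  also have "\<dots> = (\<Sum>j\<in>UNIV. \<Sum>k\<in>UNIV. \<Sum>l\<in>UNIV. G $ i $ k * G $ j $ l
        * mform \<kappa> (N1 i) (E j) * mform \<kappa> (N1 k) (E l))"
    by (rule sum.swap)
  finally show "(\<Sum>k\<in>UNIV. G $ i $ k * mform \<kappa> (N1 i) (N1 k)) = \<dots>" .
qed

end

section \<open>Families of hypersurfaces in coordinates\<close>

lemma differentiable_prod_fun:
  fixes f :: "'i \<Rightarrow> 'v::real_normed_vector \<Rightarrow> real"
  assumes "\<And>i. i \<in> I \<Longrightarrow> f i differentiable (at z)"
  shows "(\<lambda>z. \<Prod>i\<in>I. f i z) differentiable (at z)"
  using assms by (induction I rule: infinite_finite_induct) auto

lemma differentiable_det:
  fixes A :: "'v::real_normed_vector \<Rightarrow> real^'n^'n"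
  assumes "\<And>i j. (\<lambda>z. A z $ i $ j) differentiable (at z)"
  shows "(\<lambda>z. det (A z)) differentiable (at z)"
proof -
  have "(\<lambda>z. of_int (sign p) * (\<Prod>i\<in>UNIV. A z $ i $ p i)) differentiable (at z)" for p
    by (intro differentiable_mult differentiable_const differentiable_prod_fun assms)
  then show ?thesis
    unfolding det_def by (intro differentiable_sum) (simp_all add: finite_permutations)
qed

lemma matrix_inv_cramer:
  fixes A :: "real^'n^'n"
  assumes "det A \<noteq> 0"
  shows "matrix_inv A $ k $ l = det (\<chi> i j. if j = k then (if i = l then 1 else 0) else A $ i $ j) / det A"
proof -
  let ?e = "axis l 1 :: real^'n"
  have inv: "A ** matrix_inv A = mat 1"
    using assms by (intro matrix_inv_inverse) (simp add: invertible_det_nz)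
  have "A *v (matrix_inv A *v ?e) = ?e"
    by (simp add: matrix_vector_mul_assoc inv)
  then have "matrix_inv A *v ?e = (\<chi> k. det (\<chi> i j. if j = k then ?e $ i else A $ i $ j) / det A)"
    using cramer[OF assms] by blast
  from arg_cong[OF this, of "\<lambda>x. x $ k"] show ?thesis
    by (simp add: matrix_vector_mult_def axis_def if_distrib cong: if_cong)
qed

text \<open>By Cramer's rule the entries of the inverse are quotients of determinants. The formula
  holds wherever the determinant is nonzero, hence in a full neighbourhood of z, even if A has a
  geometric meaning only on part of it.\<close>

lemma differentiable_matrix_inv:
  fixes A :: "'v::euclidean_space \<Rightarrow> real^'n^'n"
  assumes "\<And>i j. (\<lambda>z. A z $ i $ j) differentiable (at z)" "invertible (A z)"
  shows "(\<lambda>z. matrix_inv (A z) $ k $ l) differentiable (at z)"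
proof -
  let ?B = "\<lambda>z. \<chi> i j. if j = k then (if i = l then 1 else 0) else A z $ i $ j"
  have dA: "(\<lambda>z. det (A z)) differentiable (at z)"
    by (rule differentiable_det[OF assms(1)])
  have "(\<lambda>z. ?B z $ i $ j) differentiable (at z)" for i j
    by (cases "j = k") (use assms(1) in simp_all)
  then have dB: "(\<lambda>z. det (?B z)) differentiable (at z)"
    by (rule differentiable_det)
  have nz: "det (A z) \<noteq> 0" using assms(2) by (simp add: invertible_det_nz)
  have "(\<lambda>z. det (?B z) / det (A z)) differentiable (at z)"
    by (rule differentiable_divide[OF dB dA nz])
  then obtain D where D: "((\<lambda>z. det (?B z) / det (A z)) has_derivative D) (at z)"
    unfolding differentiable_def by blast
  have "isCont (\<lambda>z. det (A z)) z" using dA differentiable_imp_continuous_within by blast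
  then have "\<forall>\<^sub>F y in at z. det (A y) \<noteq> 0"
    using nz unfolding isCont_def by (rule tendsto_imp_eventually_ne)
  then have "\<forall>\<^sub>F y in at z. det (?B y) / det (A y) = matrix_inv (A y) $ k $ l"
    by eventually_elim (rule matrix_inv_cramer[symmetric])
  from has_derivative_transform_eventually[OF D this] nz
  have "((\<lambda>z. matrix_inv (A z) $ k $ l) has_derivative D) (at z)"
    by (simp add: matrix_inv_cramer)
  then show ?thesis by (rule differentiableI)
qed

lemma dd_mform:
  assumes "p differentiable (at z)" "q differentiable (at z)"
  shows "dd v (\<lambda>z. mform \<kappa> (p z) (q z)) z = mform \<kappa> (p z) (dd v q z) + mform \<kappa> (dd v p z) (q z)"
  by (rule dd_bilinear[OF bounded_bilinear_mform assms])

lemma differentiable_mform: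
  assumes "p differentiable (at z)" "q differentiable (at z)"
  shows "(\<lambda>z. mform \<kappa> (p z) (q z)) differentiable (at z)"
  by (rule differentiable_bilinear[OF bounded_bilinear_mform assms])

lemma smooth_open_mform:
  assumes "open U" "smooth_open p U" "smooth_open q U"
  shows "smooth_open (\<lambda>z. mform \<kappa> (p z) (q z)) U"
  using Ck_on_open_bilinear[OF bounded_bilinear_mform assms(1)] assms(2,3) by blast

lemma dd_dd_mform:
  assumes "open U" "smooth_open p U" "smooth_open q U" "z \<in> U"
  shows "dd u (dd v (\<lambda>z. mform \<kappa> (p z) (q z))) z = mform \<kappa> (dd u (dd v p) z) (q z)
    + mform \<kappa> (dd v p z) (dd u q z) + mform \<kappa> (dd u p z) (dd v q z) + mform \<kappa> (p z) (dd u (dd v q) z)"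
proof -
  have d: "dd w h differentiable (at y)" "h differentiable (at y)"
    if "smooth_open h U" "y \<in> U" for h :: "'a \<Rightarrow> real \<times> 'b" and y w
    using smooth_open_differentiable smooth_open_dd that by blast+
  have "frechet_derivative (dd v (\<lambda>z. mform \<kappa> (p z) (q z))) (at z)
      = frechet_derivative (\<lambda>z. mform \<kappa> (p z) (dd v q z) + mform \<kappa> (dd v p z) (q z)) (at z)"
    using assms by (intro dd_cong_open[OF assms(1,4)] dd_mform d)
  moreover have "dd u (\<lambda>z. mform \<kappa> (p z) (dd v q z) + mform \<kappa> (dd v p z) (q z)) z
      = dd u (\<lambda>z. mform \<kappa> (p z) (dd v q z)) z + dd u (\<lambda>z. mform \<kappa> (dd v p z) (q z)) z"
    using assms by (intro dd_add differentiable_mform d)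
  ultimately show ?thesis
    using smooth_open_differentiable[OF assms(2,4)] smooth_open_differentiable[OF assms(3,4)]
      smooth_open_differentiable[OF smooth_open_dd[OF assms(2)] assms(4)]
      smooth_open_differentiable[OF smooth_open_dd[OF assms(3)] assms(4)]
    by (simp add: dd_mform)
qed

lemma dd_commute_smooth:
  fixes f :: "'v::euclidean_space \<Rightarrow> 'b::euclidean_space"
  assumes "open U" "smooth_open f U" "z \<in> U"
  shows "dd u (dd v f) z = dd v (dd u f) z"
  using dd_commute[OF assms(1,3)] assms(2) by blast

abbreviation sdir :: "'n::finite \<Rightarrow> real \<times> (real^'n)" where
  "sdir i \<equiv> (0, axis i 1)"

abbreviation tdir :: "real \<times> (real^'n::finite)" where
  "tdir \<equiv> (1, 0)"

text \<open>At an end point of I only one sign of t is available; a second point b of I shows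
  which.\<close>

lemma interval_accumulates:
  fixes I :: "real set"
  assumes I: "is_interval I" "interior I \<noteq> {}"
    and "a \<in> I" "0 < e"
  shows "\<exists>t. 0 < \<bar>t\<bar> \<and> \<bar>t\<bar> < e \<and> a + t \<in> I"
proof -
  obtain b where b: "b \<in> I" "b \<noteq> a"
  proof -
    obtain c d where "c \<in> interior I" "d > 0" "ball c d \<subseteq> I"
      using I(2) by (metis all_not_in_conv mem_interior)
    then have "c \<in> I" "c + d / 2 \<in> I" "c \<noteq> c + d / 2"
      by (auto simp: subset_iff dist_real_def)
    then show thesis using that by metis
  qed
  have *: "a + t \<in> I" if "min a b \<le> a + t" "a + t \<le> max a b" for t
    using I(1) assms(3) b(1) that unfolding is_interval_1 by (metis max_def min_def)
  show ?thesis
  proof (cases "a < b")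
    case True
    then show ?thesis using assms(4) *[of "min (b - a) (e / 2)"]
      by (intro exI[of _ "min (b - a) (e / 2)"]) linarith
  next
    case False
    then show ?thesis using assms(4) b(2) *[of "- min (a - b) (e / 2)"]
      by (intro exI[of _ "- min (a - b) (e / 2)"]) linarith
  qed
qed

text \<open>Smooth extensions of the family and of its normals to an open set of parameters. The geometric
  relations are only available on \<open>P\<close>.\<close>

locale hypersurface_patch =
  fixes \<kappa> :: real and I :: "real set" and Cs :: "(real^'n::finite) set" and U :: "(real \<times> (real^'n)) set"
    and f N :: "real \<times> (real^'n) \<Rightarrow> real \<times> 'e::euclidean_space"
  assumes kappa: "\<kappa> \<in> {-1, 0, 1}"
    and dim: "DIM('e) = CARD('n) + 1"
    and I: "is_interval I" "interior I \<noteq> {}"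
    and Cs: "openin (top_of_set halfspace) Cs"
    and U: "open U"
    and f_smooth: "smooth_open f U"
    and N_smooth: "smooth_open N U"
    and f_space: "\<And>z. z \<in> (I \<times> Cs) \<inter> U \<Longrightarrow> f z \<in> space_form \<kappa>"
    and f_inj: "\<And>z. z \<in> (I \<times> Cs) \<inter> U \<Longrightarrow> inj (\<lambda>v::real^'n. \<Sum>i\<in>UNIV. (v $ i) *\<^sub>R dd (sdir i) f z)"
    and N_tan: "\<And>z. z \<in> (I \<times> Cs) \<inter> U \<Longrightarrow> N z \<in> tangent_space \<kappa> (f z)"
    and N_one: "\<And>z. z \<in> (I \<times> Cs) \<inter> U \<Longrightarrow> mform \<kappa> (N z) (N z) = 1"
    and N_perp: "\<And>z i. z \<in> (I \<times> Cs) \<inter> U \<Longrightarrow> mform \<kappa> (N z) (dd (sdir i) f z) = 0"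
begin

section \<open>Differentiating relations on the parameter set\<close>

definition P :: "(real \<times> (real^'n)) set" where
  "P = (I \<times> Cs) \<inter> U"

lemma P_U: "z \<in> P \<Longrightarrow> z \<in> U" by (simp add: P_def)

definition dirs :: "(real \<times> (real^'n)) set" where
  "dirs = insert tdir (range sdir)"

lemma I_accumulates: "a \<in> I \<Longrightarrow> 0 < e \<Longrightarrow> \<exists>t. 0 < \<bar>t\<bar> \<and> \<bar>t\<bar> < e \<and> a + t \<in> I"
  by (rule interval_accumulates[OF I])

lemma near_U:
  assumes "z \<in> U"
  obtains d where "0 < d" "\<And>t. \<bar>t\<bar> < d \<Longrightarrow> z + t *\<^sub>R v \<in> U"
proof -
  obtain d where d: "d > 0" "ball z d \<subseteq> U" using U assms open_contains_ball by blast
  have "z + t *\<^sub>R v \<in> U" if "\<bar>t\<bar> < d / (norm v + 1)" for t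
  proof -
    have "\<bar>t\<bar> * norm v \<le> \<bar>t\<bar> * (norm v + 1)" by (intro mult_left_mono) auto
    also have "\<dots> < d" using that by (simp add: pos_less_divide_eq add_nonneg_pos)
    finally have "dist z (z + t *\<^sub>R v) < d" by (simp add: dist_norm)
    then show ?thesis using d(2) by auto
  qed
  moreover have "0 < d / (norm v + 1)" using d(1) by (simp add: add_nonneg_pos)
  ultimately show thesis using that by blast
qed

lemma Cs_halfspace: "x \<in> Cs \<Longrightarrow> x \<in> halfspace"
  using openin_imp_subset[OF Cs] by blast

lemma near_Cs:
  assumes "x \<in> Cs"
  obtains d where "0 < d" "\<And>y. y \<in> halfspace \<Longrightarrow> dist y x < d \<Longrightarrow> y \<in> Cs"
  using Cs[unfolded openin_euclidean_subtopology_iff] assms that by blast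

lemma P_space_dir:
  assumes "z \<in> P" "0 < e" and s: "\<And>t. 0 < t \<Longrightarrow> snd z + t *\<^sub>R axis i 1 \<in> halfspace"
  shows "\<exists>t>0. t < e \<and> z + t *\<^sub>R sdir i \<in> P"
proof -
  obtain d1 where d1: "0 < d1" "\<And>t. \<bar>t\<bar> < d1 \<Longrightarrow> z + t *\<^sub>R sdir i \<in> U"
    using near_U[OF P_U[OF assms(1)]] by blast
  have x: "snd z \<in> Cs" "fst z \<in> I" using assms(1) by (auto simp: P_def)
  obtain d2 where d2: "0 < d2" "\<And>y. y \<in> halfspace \<Longrightarrow> dist y (snd z) < d2 \<Longrightarrow> y \<in> Cs"
    using near_Cs[OF x(1)] by blast
  define t where "t = min e (min d1 d2) / 2"
  have t: "0 < t" "t < e" "t < d1" "t < d2" using assms(2) d1(1) d2(1) by (auto simp: t_def)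
  have "snd z + t *\<^sub>R axis i 1 \<in> Cs"
    using t by (intro d2(2) s) (simp_all add: dist_norm)
  then have "z + t *\<^sub>R sdir i \<in> P"
    using d1(2)[of t] t x by (simp add: P_def mem_Times_iff)
  then show ?thesis using t by blast
qed

lemma P_time_dir:
  assumes "z \<in> P" "0 < e"
  shows "\<exists>t. 0 < \<bar>t\<bar> \<and> \<bar>t\<bar> < e \<and> z + t *\<^sub>R tdir \<in> P"
proof -
  obtain d where d: "0 < d" "\<And>t. \<bar>t\<bar> < d \<Longrightarrow> z + t *\<^sub>R tdir \<in> U"
    using near_U[OF P_U[OF assms(1)]] by blast
  have x: "snd z \<in> Cs" "fst z \<in> I" using assms(1) by (auto simp: P_def)
  obtain t where t: "0 < \<bar>t\<bar>" "\<bar>t\<bar> < min e d" "fst z + t \<in> I"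
    using I_accumulates[OF x(2), of "min e d"] assms(2) d(1) by auto
  then have "z + t *\<^sub>R tdir \<in> P"
    using d(2)[of t] x by (simp add: P_def mem_Times_iff)
  then show ?thesis using t by (intro exI[of _ t]) simp
qed

lemma P_dirs:
  assumes "z \<in> P" "v \<in> dirs" "0 < e"
  shows "\<exists>t. 0 < \<bar>t\<bar> \<and> \<bar>t\<bar> < e \<and> z + t *\<^sub>R v \<in> P"
proof (cases "v = tdir")
  case True
  then show ?thesis using P_time_dir[OF assms(1,3)] by simp
next
  case False
  then obtain i where v: "v = sdir i" using assms(2) by (auto simp: dirs_def)
  have "snd z + t *\<^sub>R axis i 1 \<in> halfspace" if "0 < t" for t
    using Cs_halfspace[of "snd z"] assms(1) that by (auto simp: halfspace_def P_def axis_def)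
  then obtain t where "t > 0" "t < e" "z + t *\<^sub>R sdir i \<in> P"
    using P_space_dir[OF assms(1,3)] by blast
  then show ?thesis unfolding v by (intro exI[of _ t]) auto
qed

text \<open>The device by which the geometric identities are differentiated. Off P the map h is
  built from arbitrary extensions and may be nonzero, so \<open>dd_eq_0\<close> has to be fed with
  points of P only.\<close>

lemma rel_0:
  fixes h :: "real \<times> (real^'n) \<Rightarrow> 'b::real_normed_vector"
  assumes "z \<in> P" "v \<in> dirs" "h differentiable (at z)" "\<And>y. y \<in> P \<Longrightarrow> h y = 0"
  shows "dd v h z = 0"
proof (rule dd_eq_0[OF assms(3) assms(4)[OF assms(1)]])
  fix e :: real assume "0 < e"
  from P_dirs[OF assms(1,2) this] assms(4)
  show "\<exists>t. 0 < \<bar>t\<bar> \<and> \<bar>t\<bar> < e \<and> h (z + t *\<^sub>R v) = 0" by blast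
qed

lemma rel_const:
  fixes h :: "real \<times> (real^'n) \<Rightarrow> real"
  assumes "z \<in> P" "v \<in> dirs" "h differentiable (at z)" "\<And>y. y \<in> P \<Longrightarrow> h y = c"
  shows "dd v h z = 0"
proof -
  have "dd v (\<lambda>y. h y + - c) z = 0"
    using assms by (intro rel_0) auto
  then show ?thesis using dd_add[OF assms(3) differentiable_const[of "- c"], of v] by simp
qed

lemma sdir_dirs: "sdir i \<in> dirs" and tdir_dirs: "tdir \<in> dirs"
  by (auto simp: dirs_def)

abbreviation E :: "'n \<Rightarrow> real \<times> (real^'n) \<Rightarrow> real \<times> 'e" where
  "E i \<equiv> dd (sdir i) f"

lemmas f_space' = f_space[folded P_def] and f_inj' = f_inj[folded P_def] and N_tan' = N_tan[folded P_def]
  and N_one' = N_one[folded P_def] and N_perp' = N_perp[folded P_def]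

lemma f_diff: "z \<in> P \<Longrightarrow> f differentiable (at z)"
  by (rule smooth_open_differentiable[OF f_smooth P_U])

lemma N_diff: "z \<in> P \<Longrightarrow> N differentiable (at z)"
  by (rule smooth_open_differentiable[OF N_smooth P_U])

lemma df_smooth: "smooth_open (dd v f) U"
  by (rule smooth_open_dd[OF f_smooth])

lemma dN_smooth: "smooth_open (dd v N) U"
  by (rule smooth_open_dd[OF N_smooth])

lemma df_diff: "z \<in> P \<Longrightarrow> dd v f differentiable (at z)"
  by (rule smooth_open_differentiable[OF df_smooth P_U])

lemma dN_diff: "z \<in> P \<Longrightarrow> dd v N differentiable (at z)"
  by (rule smooth_open_differentiable[OF dN_smooth P_U])

lemma ddf_diff: "z \<in> P \<Longrightarrow> dd u (dd v f) differentiable (at z)"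
  by (rule smooth_open_differentiable[OF smooth_open_dd[OF df_smooth] P_U])

lemmas dd_qform = dd_bilinear[OF bounded_bilinear_qform[of \<kappa>]]
lemmas differentiable_qform = differentiable_bilinear[OF bounded_bilinear_qform[of \<kappa>]]

lemma qform_f:
  assumes "z \<in> P" "v \<in> dirs"
  shows "qform \<kappa> (f z) (dd v f z) = 0"
proof -
  have "dd v (\<lambda>z. qform \<kappa> (f z) (f z)) z = 0"
    by (rule rel_const[OF assms differentiable_qform[OF f_diff[OF assms(1)] f_diff[OF assms(1)]]])
      (rule qform_self[OF f_space'])
  then show ?thesis
    unfolding dd_qform[OF f_diff[OF assms(1)] f_diff[OF assms(1)]] qform_commute[of \<kappa> _ "f z"] by simp
qed

lemma df_tangent: "z \<in> P \<Longrightarrow> v \<in> dirs \<Longrightarrow> dd v f z \<in> tangent_space \<kappa> (f z)"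
  by (simp add: tangent_space_iff qform_f)

lemma frame:
  assumes "z \<in> P"
  shows "hypersurface_frame \<kappa> (f z) (N z) (\<lambda>i. E i z)"
  by (rule hypersurface_frame.intro)
    (rule kappa dim f_space'[OF assms] df_tangent[OF assms sdir_dirs] N_tan'[OF assms] N_one'[OF assms]
      N_perp'[OF assms] f_inj'[OF assms])+

lemma N_dN:
  assumes "z \<in> P" "v \<in> dirs"
  shows "mform \<kappa> (N z) (dd v N z) = 0"
proof -
  have "dd v (\<lambda>z. mform \<kappa> (N z) (N z)) z = 0"
    by (rule rel_const[OF assms differentiable_mform[OF N_diff[OF assms(1)] N_diff[OF assms(1)]] N_one'])
  then show ?thesis
    unfolding dd_mform[OF N_diff[OF assms(1)] N_diff[OF assms(1)]] mform_commute[of \<kappa> _ "N z"] by simp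
qed

text \<open>Confined to coordinate directions, where the derivative of f is orthogonal to N. In the
  parameter direction the velocity has a normal part, and \<open>f_dN\<close> records the position
  component of the derivative of N that it causes.\<close>

lemma dN_tangent:
  assumes "z \<in> P"
  shows "dd (sdir i) N z \<in> tangent_space \<kappa> (f z)"
proof -
  have "dd (sdir i) (\<lambda>z. qform \<kappa> (f z) (N z)) z = 0"
    by (rule rel_0[OF assms sdir_dirs differentiable_qform[OF f_diff[OF assms] N_diff[OF assms]]
          N_tan'[unfolded tangent_space_iff]])
  then have "qform \<kappa> (f z) (dd (sdir i) N z) + qform \<kappa> (E i z) (N z) = 0"
    unfolding dd_qform[OF f_diff[OF assms] N_diff[OF assms]] .
  moreover have "qform \<kappa> (E i z) (N z) = 0"
    using qform_tangent[OF kappa f_space'[OF assms] df_tangent[OF assms sdir_dirs] N_tan'[OF assms], of i]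
      N_perp'[OF assms, of i] mform_commute[of \<kappa> "N z" "E i z"] by simp
  ultimately show ?thesis by (simp add: tangent_space_iff)
qed

lemma f_dN:
  assumes "z \<in> P" "v \<in> dirs"
  shows "\<kappa> * mform \<kappa> (f z) (dd v N z) = - \<kappa> * mform \<kappa> (dd v f z) (N z)"
proof -
  note d = differentiable_mform[OF f_diff[OF assms(1)] N_diff[OF assms(1)], of \<kappa>]
  have "dd v (\<lambda>z. \<kappa> * mform \<kappa> (f z) (N z)) z = 0"
    by (rule rel_0[OF assms differentiable_mult[OF differentiable_const d] mform_tangent_point[OF kappa N_tan']])
  moreover have "dd v (\<lambda>z. \<kappa> * mform \<kappa> (f z) (N z)) z
      = \<kappa> * (mform \<kappa> (f z) (dd v N z) + mform \<kappa> (dd v f z) (N z))"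
    unfolding dd_bilinear[OF bounded_bilinear_mult differentiable_const d]
      dd_mform[OF f_diff[OF assms(1)] N_diff[OF assms(1)]] by simp
  ultimately show ?thesis by (simp add: algebra_simps)
qed

lemma E_dN:
  assumes "z \<in> P" "v \<in> dirs"
  shows "mform \<kappa> (E k z) (dd v N z) = - mform \<kappa> (dd v (E k) z) (N z)"
proof -
  have "dd v (\<lambda>z. mform \<kappa> (N z) (E k z)) z = 0"
    by (rule rel_0[OF assms differentiable_mform[OF N_diff[OF assms(1)] df_diff[OF assms(1)]] N_perp'])
  then show ?thesis
    unfolding dd_mform[OF N_diff[OF assms(1)] df_diff[OF assms(1)]]
      mform_commute[of \<kappa> "N z"] mform_commute[of \<kappa> "dd v N z"] by simp
qed

lemma commute_f: "z \<in> P \<Longrightarrow> dd u (dd v f) z = dd v (dd u f) z"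
  using dd_commute_smooth[OF U f_smooth P_U] .

text \<open>Moves v to the innermost place: the variation of the second derivatives becomes second
  derivatives of the variation field.\<close>

lemma commute_f3:
  assumes "z \<in> P"
  shows "dd v (dd (sdir i) (E j)) z = dd (sdir i) (dd (sdir j) (dd v f)) z"
proof -
  have "dd v (dd (sdir i) (E j)) z = dd (sdir i) (dd v (E j)) z"
    by (rule dd_commute_smooth[OF U df_smooth P_U[OF assms]])
  moreover have "frechet_derivative (dd v (E j)) (at z) = frechet_derivative (dd (sdir j) (dd v f)) (at z)"
    by (rule dd_cong_open[OF U P_U[OF assms]]) (rule dd_commute_smooth[OF U f_smooth])
  ultimately show ?thesis by simp
qed

lemma qform_E2:
  assumes "z \<in> P"
  shows "qform \<kappa> (f z) (dd (sdir i) (E j) z) = - \<kappa> * mform \<kappa> (E i z) (E j z)"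
proof -
  have "dd (sdir i) (\<lambda>z. qform \<kappa> (f z) (E j z)) z = 0"
    by (rule rel_0[OF assms sdir_dirs differentiable_qform[OF f_diff[OF assms] df_diff[OF assms]] qform_f[OF _ sdir_dirs]])
  moreover have "qform \<kappa> (E i z) (E j z) = \<kappa> * mform \<kappa> (E i z) (E j z)"
    by (rule qform_tangent[OF kappa f_space'[OF assms] df_tangent[OF assms sdir_dirs] df_tangent[OF assms sdir_dirs]])
  ultimately show ?thesis
    unfolding dd_qform[OF f_diff[OF assms] df_diff[OF assms]] by simp
qed

section \<open>The metric, its inverse and the second fundamental form\<close>

definition gm :: "real \<times> (real^'n) \<Rightarrow> real^'n^'n" where
  "gm z = (\<chi> i j. mform \<kappa> (E i z) (E j z))"

lemma gram_eq: "z \<in> P \<Longrightarrow> hypersurface_frame.gram \<kappa> (\<lambda>i. E i z) = gm z"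
  using hypersurface_frame.gram_def[OF frame] by (simp add: gm_def)

abbreviation Gi :: "'n \<Rightarrow> 'n \<Rightarrow> real \<times> (real^'n) \<Rightarrow> real" where
  "Gi i j \<equiv> \<lambda>z. matrix_inv (gm z) $ i $ j"

lemma gm_diff: "z \<in> P \<Longrightarrow> (\<lambda>z. gm z $ i $ j) differentiable (at z)"
  by (simp add: gm_def differentiable_mform df_diff)

lemma gm_invertible: "z \<in> P \<Longrightarrow> invertible (gm z)"
  using hypersurface_frame.gram_invertible[OF frame] by (simp add: gram_eq)

lemma Gi_diff: "z \<in> P \<Longrightarrow> Gi i j differentiable (at z)"
  by (rule differentiable_matrix_inv[OF gm_diff gm_invertible])

lemma dd_sum:
  assumes "\<And>i. i \<in> S \<Longrightarrow> h i differentiable (at z)"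
  shows "dd v (\<lambda>z. \<Sum>i\<in>S. h i z) z = (\<Sum>i\<in>S. dd v (h i) z)"
proof -
  have "((\<lambda>z. \<Sum>i\<in>S. h i z) has_derivative (\<lambda>v. \<Sum>i\<in>S. dd v (h i) z)) (at z)"
    by (rule has_derivative_sum) (rule assms[unfolded frechet_derivative_works])
  from frechet_derivative_at[OF this] show ?thesis by metis
qed

lemma dd_mult:
  fixes g h :: "real \<times> (real^'n) \<Rightarrow> real"
  assumes "g differentiable (at z)" "h differentiable (at z)"
  shows "dd v (\<lambda>z. g z * h z) z = g z * dd v h z + dd v g z * h z"
  by (rule dd_bilinear[OF bounded_bilinear_mult assms])

text \<open>Differentiating G g = 1, a constant on P, and multiplying by G from the right gives dG =
  - G (dg) G.\<close>

lemma dd_Gi: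
  assumes "z \<in> P" "v \<in> dirs"
  shows "dd v (Gi i j) z = - (\<Sum>a\<in>UNIV. \<Sum>b\<in>UNIV. Gi i a z *
    (mform \<kappa> (dd v (E a) z) (E b z) + mform \<kappa> (E a z) (dd v (E b) z)) * Gi b j z)"
proof -
  define dg where "dg = (\<lambda>a b. mform \<kappa> (dd v (E a) z) (E b z) + mform \<kappa> (E a z) (dd v (E b) z))"
  have dgm: "dd v (\<lambda>z. gm z $ a $ b) z = dg a b" for a b
    by (simp add: gm_def dg_def dd_mform[OF df_diff[OF assms(1)] df_diff[OF assms(1)]])
  have 1: "(\<Sum>a\<in>UNIV. dd v (Gi i a) z * gm z $ a $ b) = - (\<Sum>a\<in>UNIV. Gi i a z * dg a b)" for b
  proof -
    have d: "(\<lambda>z. Gi i a z * gm z $ a $ b) differentiable (at z)" for a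
      by (intro differentiable_mult Gi_diff gm_diff assms)
    have "dd v (\<lambda>z. \<Sum>a\<in>UNIV. Gi i a z * gm z $ a $ b) z = 0"
    proof (rule rel_const[OF assms])
      show "(\<lambda>z. \<Sum>a\<in>UNIV. Gi i a z * gm z $ a $ b) differentiable (at z)"
        by (intro differentiable_sum ballI d finite)
      show "(\<Sum>a\<in>UNIV. Gi i a y * gm y $ a $ b) = (if i = b then 1 else 0)" if "y \<in> P" for y
        by (rule sum_delta_product[OF matrix_inv_inverse(2)[OF gm_invertible[OF that]]])
    qed
    then have "(\<Sum>a\<in>UNIV. Gi i a z * dg a b + dd v (Gi i a) z * gm z $ a $ b) = 0"
      unfolding dd_sum[OF d] dd_mult[OF Gi_diff[OF assms(1)] gm_diff[OF assms(1)]] dgm .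
    then show ?thesis by (simp add: sum.distrib)
  qed
  have "dd v (Gi i j) z = (\<Sum>a\<in>UNIV. dd v (Gi i a) z * (\<Sum>b\<in>UNIV. gm z $ a $ b * Gi b j z))"
    unfolding sum_delta_product[OF matrix_inv_inverse(1)[OF gm_invertible[OF assms(1)]]]
    by (simp add: if_distrib cong: if_cong)
  also have "\<dots> = (\<Sum>a\<in>UNIV. \<Sum>b\<in>UNIV. dd v (Gi i a) z * gm z $ a $ b * Gi b j z)"
    by (simp add: sum_distrib_left mult.assoc)
  also have "\<dots> = (\<Sum>b\<in>UNIV. (\<Sum>a\<in>UNIV. dd v (Gi i a) z * gm z $ a $ b) * Gi b j z)"
    by (subst sum.swap) (simp add: sum_distrib_right)
  also have "\<dots> = - (\<Sum>b\<in>UNIV. \<Sum>a\<in>UNIV. Gi i a z * dg a b * Gi b j z)"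
    unfolding 1 by (simp add: sum_distrib_right sum_negf)
  also have "\<dots> = - (\<Sum>a\<in>UNIV. \<Sum>b\<in>UNIV. Gi i a z * dg a b * Gi b j z)"
    by (subst sum.swap) (rule refl)
  finally show ?thesis by (simp add: dg_def)
qed

end

context hypersurface_patch
begin

definition chris :: "'n \<Rightarrow> 'n \<Rightarrow> 'n \<Rightarrow> real \<times> (real^'n) \<Rightarrow> real" where
  "chris k i j z = (\<Sum>l\<in>UNIV. Gi k l z * mform \<kappa> (dd (sdir i) (E j) z) (E l z))"

definition sf :: "'n \<Rightarrow> 'n \<Rightarrow> real \<times> (real^'n) \<Rightarrow> real" where
  "sf i j z = mform \<kappa> (dd (sdir i) N z) (E j z)"

lemma sf_eq:
  assumes "z \<in> P"
  shows "sf i j z = - mform \<kappa> (N z) (dd (sdir i) (E j) z)"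
  using E_dN[OF assms sdir_dirs, of j i] mform_commute unfolding sf_def by metis

lemma sf_sym: "z \<in> P \<Longrightarrow> sf i j z = sf j i z"
  by (simp add: sf_eq commute_f[of z "sdir i"])

text \<open>For \<open>tdir\<close> this is the parametric field; for the coordinate directions it
  vanishes on P. Keeping v general lets one variation formula serve both cases.\<close>

definition field :: "(real \<times> (real^'n)) \<Rightarrow> real \<times> (real^'n) \<Rightarrow> real" where
  "field v z = mform \<kappa> (dd v f z) (N z)"

lemma field_smooth: "smooth_open (field v) U"
  unfolding field_def[abs_def] by (rule smooth_open_mform[OF U df_smooth N_smooth])

lemma dd_field:
  "z \<in> P \<Longrightarrow> dd u (field v) z = mform \<kappa> (dd u (dd v f) z) (N z) + mform \<kappa> (dd v f z) (dd u N z)"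
  unfolding field_def[abs_def] by (simp add: dd_mform df_diff N_diff)

lemma dd_dd_field:
  "z \<in> P \<Longrightarrow> dd u (dd w (field v)) z = mform \<kappa> (dd u (dd w (dd v f)) z) (N z)
    + mform \<kappa> (dd w (dd v f) z) (dd u N z) + mform \<kappa> (dd u (dd v f) z) (dd w N z)
    + mform \<kappa> (dd v f z) (dd u (dd w N) z)"
  unfolding field_def[abs_def] by (rule dd_dd_mform[OF U df_smooth N_smooth P_U])

end

section \<open>Minimality and the Jacobi equation\<close>

locale minimal_patch = hypersurface_patch \<kappa> I Cs U f N
  for \<kappa> :: real and I :: "real set" and Cs :: "(real^'n::finite) set" and U :: "(real \<times> (real^'n)) set"
    and f N :: "real \<times> (real^'n) \<Rightarrow> real \<times> 'e::euclidean_space" +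
  assumes minimal: "\<And>z. z \<in> P \<Longrightarrow>
    (\<Sum>i\<in>UNIV. \<Sum>j\<in>UNIV. Gi i j z * mform \<kappa> (dd (sdir i) (E j) z) (N z)) = 0"
begin

lemma minimal_variation:
  assumes "z \<in> P" "v \<in> dirs"
  shows "(\<Sum>i\<in>UNIV. \<Sum>j\<in>UNIV. dd v (Gi i j) z * mform \<kappa> (dd (sdir i) (E j) z) (N z)
    + Gi i j z * (mform \<kappa> (dd v (dd (sdir i) (E j)) z) (N z) + mform \<kappa> (dd (sdir i) (E j) z) (dd v N z))) = 0"
proof -
  have m: "(\<lambda>z. mform \<kappa> (dd (sdir i) (E j) z) (N z)) differentiable (at z)" for i j
    by (rule differentiable_mform[OF ddf_diff[OF assms(1)] N_diff[OF assms(1)]])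
  have d: "(\<lambda>z. Gi i j z * mform \<kappa> (dd (sdir i) (E j) z) (N z)) differentiable (at z)" for i j
    by (rule differentiable_mult[OF Gi_diff[OF assms(1)] m])
  have d': "(\<lambda>z. \<Sum>j\<in>UNIV. Gi i j z * mform \<kappa> (dd (sdir i) (E j) z) (N z)) differentiable (at z)" for i
    by (intro differentiable_sum ballI d finite)
  have "dd v (\<lambda>z. \<Sum>i\<in>UNIV. \<Sum>j\<in>UNIV. Gi i j z * mform \<kappa> (dd (sdir i) (E j) z) (N z)) z = 0"
    by (rule rel_0[OF assms _ minimal]) (intro differentiable_sum ballI d' finite)
  then show ?thesis
    unfolding dd_sum[OF d'] dd_sum[OF d] dd_mult[OF Gi_diff[OF assms(1)] m]
      dd_mform[OF ddf_diff[OF assms(1)] N_diff[OF assms(1)]]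
    by (simp only: add.commute)
qed

text \<open>The Laplace--Beltrami operator applied to N as a map into the flat ambient space,
  component by component.\<close>

definition lapN :: "real \<times> (real^'n) \<Rightarrow> real \<times> 'e" where
  "lapN z = (\<Sum>i\<in>UNIV. \<Sum>j\<in>UNIV. Gi i j z *\<^sub>R
    (dd (sdir i) (dd (sdir j) N) z - (\<Sum>k\<in>UNIV. chris k i j z *\<^sub>R dd (sdir k) N z)))"

definition lap :: "(real \<times> (real^'n) \<Rightarrow> real) \<Rightarrow> real \<times> (real^'n) \<Rightarrow> real" where
  "lap u z = (\<Sum>i\<in>UNIV. \<Sum>j\<in>UNIV. Gi i j z *
    (dd (sdir i) (dd (sdir j) u) z - (\<Sum>k\<in>UNIV. chris k i j z * dd (sdir k) u z)))"

lemma mform_lapN: "mform \<kappa> w (lapN z) = (\<Sum>i\<in>UNIV. \<Sum>j\<in>UNIV. Gi i j z *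
    mform \<kappa> w (dd (sdir i) (dd (sdir j) N) z - (\<Sum>k\<in>UNIV. chris k i j z *\<^sub>R dd (sdir k) N z)))"
  unfolding lapN_def by (simp only: mform_simps(10,12) real_scaleR_def)

text \<open>The variation field is \<open>dd v f\<close>. Expanding the Laplacian of its product
  with N by Leibniz, every term with a derivative of the variation field is accounted for by the
  vanishing variation of the mean curvature; only the term in which both derivatives fall on N
  remains.\<close>

lemma field_equation:
  assumes "z \<in> P" "v \<in> dirs"
  shows "lap (field v) z + real CARD('n) * \<kappa> * field v z = mform \<kappa> (dd v f z) (lapN z)"
proof -
  interpret fr: hypersurface_frame \<kappa> "f z" "N z" "\<lambda>i. E i z"
    by (rule frame[OF assms(1)])
  let ?W1 = "\<lambda>i. dd (sdir i) (dd v f) z" and ?W2 = "\<lambda>i j. dd (sdir i) (dd (sdir j) (dd v f)) z"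
    and ?N1 = "\<lambda>i. dd (sdir i) N z" and ?E2 = "\<lambda>i j. dd (sdir i) (E j) z"
  have G: "fr.gram = gm z" by (rule gram_eq[OF assms(1)])
  have \<Gamma>: "fr.\<Gamma> ?E2 k i j = chris k i j z" for k i j
    unfolding fr.\<Gamma>_def chris_def G ..
  have "(\<Sum>i\<in>UNIV. \<Sum>j\<in>UNIV. matrix_inv fr.gram $ i $ j *
      ((mform \<kappa> (?W2 i j) (N z) + mform \<kappa> (?W1 j) (?N1 i) + mform \<kappa> (?W1 i) (?N1 j)
          + mform \<kappa> (dd v f z) (dd (sdir i) (dd (sdir j) N) z))
        - (\<Sum>k\<in>UNIV. fr.\<Gamma> ?E2 k i j * (mform \<kappa> (?W1 k) (N z) + mform \<kappa> (dd v f z) (?N1 k)))))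
      + real CARD('n) * \<kappa> * mform \<kappa> (dd v f z) (N z)
    = (\<Sum>i\<in>UNIV. \<Sum>j\<in>UNIV. matrix_inv fr.gram $ i $ j *
      mform \<kappa> (dd v f z) (dd (sdir i) (dd (sdir j) N) z - (\<Sum>k\<in>UNIV. fr.\<Gamma> ?E2 k i j *\<^sub>R ?N1 k)))"
  proof (rule fr.first_variation)
    show "?N1 i \<in> tangent_space \<kappa> (f z)" for i by (rule dN_tangent[OF assms(1)])
    show "mform \<kappa> (N z) (?N1 i) = 0" for i by (rule N_dN[OF assms(1) sdir_dirs])
    show "mform \<kappa> (?N1 i) (E j z) = - mform \<kappa> (N z) (?E2 i j)" for i j
      using sf_eq[OF assms(1)] unfolding sf_def .
    show "?E2 i j = ?E2 j i" for i j by (rule commute_f[OF assms(1)])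
    show "qform \<kappa> (f z) (?E2 i j) = - \<kappa> * mform \<kappa> (E i z) (E j z)" for i j
      by (rule qform_E2[OF assms(1)])
    show "dd v (Gi i j) z = - (\<Sum>a\<in>UNIV. \<Sum>b\<in>UNIV. matrix_inv fr.gram $ i $ a *
        (mform \<kappa> (?W1 a) (E b z) + mform \<kappa> (E a z) (?W1 b)) * matrix_inv fr.gram $ b $ j)" for i j
      unfolding G dd_Gi[OF assms] commute_f[OF assms(1), of v] ..
    show "(\<Sum>i\<in>UNIV. \<Sum>j\<in>UNIV. dd v (Gi i j) z * mform \<kappa> (?E2 i j) (N z)
      + matrix_inv fr.gram $ i $ j * (mform \<kappa> (?W2 i j) (N z) + mform \<kappa> (?E2 i j) (dd v N z))) = 0"
      using minimal_variation[OF assms] unfolding G commute_f3[OF assms(1)] .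
    show "mform \<kappa> (N z) (dd v N z) = 0" by (rule N_dN[OF assms])
    show "mform \<kappa> (E k z) (dd v N z) = - mform \<kappa> (?W1 k) (N z)" for k
      using E_dN[OF assms, of k] unfolding commute_f[OF assms(1), of v] .
    show "\<kappa> * mform \<kappa> (f z) (dd v N z) = - \<kappa> * mform \<kappa> (dd v f z) (N z)"
      by (rule f_dN[OF assms])
  qed
  then show ?thesis
    unfolding G \<Gamma> mform_lapN lap_def dd_dd_field[OF assms(1)] dd_field[OF assms(1)] unfolding field_def .
qed

text \<open>The traced Codazzi equation of a minimal hypersurface. It comes from
  \<open>field_equation\<close> in a coordinate direction, where the field is 0 on P and so are its
  first and second derivatives.\<close>

lemma lapN_tangential:
  assumes "z \<in> P"
  shows "mform \<kappa> (E m z) (lapN z) = 0"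
proof -
  have 0: "field (sdir m) y = 0" if "y \<in> P" for y
    unfolding field_def using N_perp'[OF that, of m] mform_commute by metis
  have 1: "dd (sdir j) (field (sdir m)) y = 0" if "y \<in> P" for y j
    by (rule rel_0[OF that sdir_dirs smooth_open_differentiable[OF field_smooth P_U[OF that]] 0])
  have "dd (sdir i) (dd (sdir j) (field (sdir m))) z = 0" for i j
    by (rule rel_0[OF assms sdir_dirs smooth_open_differentiable[OF smooth_open_dd[OF field_smooth] P_U[OF assms]] 1])
  then have "lap (field (sdir m)) z = 0"
    by (simp add: lap_def 1[OF assms])
  then show ?thesis
    using field_equation[OF assms sdir_dirs, of m] 0[OF assms] by simp
qed

definition sf2 :: "real \<times> (real^'n) \<Rightarrow> real" where
  "sf2 z = (\<Sum>i\<in>UNIV. \<Sum>j\<in>UNIV. \<Sum>k\<in>UNIV. \<Sum>l\<in>UNIV.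
    Gi i k z * Gi j l z * sf i j z * sf k l z)"

text \<open>Differentiating the orthogonality of N to its own derivatives replaces second
  derivatives by products of first ones, whose trace is the norm in
  \<open>sff_square\<close>.\<close>

lemma lapN_normal:
  assumes "z \<in> P"
  shows "mform \<kappa> (N z) (lapN z) = - sf2 z"
proof -
  interpret fr: hypersurface_frame \<kappa> "f z" "N z" "\<lambda>i. E i z"
    by (rule frame[OF assms])
  have G: "fr.gram = gm z" by (rule gram_eq[OF assms])
  have NN: "mform \<kappa> (N z) (dd (sdir i) (dd (sdir j) N) z) = - mform \<kappa> (dd (sdir i) N z) (dd (sdir j) N z)" for i j
  proof -
    have "dd (sdir i) (\<lambda>z. mform \<kappa> (N z) (dd (sdir j) N z)) z = 0"
      by (rule rel_0[OF assms sdir_dirs differentiable_mform[OF N_diff[OF assms] dN_diff[OF assms]] N_dN[OF _ sdir_dirs]])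
    then show ?thesis
      unfolding dd_mform[OF N_diff[OF assms] dN_diff[OF assms]] by simp
  qed
  have "mform \<kappa> (N z) (lapN z)
      = (\<Sum>i\<in>UNIV. \<Sum>j\<in>UNIV. Gi i j z * - mform \<kappa> (dd (sdir i) N z) (dd (sdir j) N z))"
    unfolding mform_lapN mform_simps(4,10,12) NN N_dN[OF assms sdir_dirs] by simp
  also have "\<dots> = - (\<Sum>i\<in>UNIV. \<Sum>j\<in>UNIV. matrix_inv fr.gram $ i $ j * mform \<kappa> (dd (sdir i) N z) (dd (sdir j) N z))"
    unfolding G by (simp add: sum_negf)
  also have "\<dots> = - sf2 z"
    using fr.sff_square[OF dN_tangent[OF assms] N_dN[OF assms sdir_dirs]]
    unfolding sf2_def sf_def G by simp
  finally show ?thesis .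
qed

theorem Jacobi_equation:
  assumes "z \<in> P"
  shows "lap (field tdir) z + (sf2 z + real CARD('n) * \<kappa>) * field tdir z = 0"
proof -
  interpret fr: hypersurface_frame \<kappa> "f z" "N z" "\<lambda>i. E i z"
    by (rule frame[OF assms])
  let ?V = "dd tdir f z"
  obtain c where "?V = mform \<kappa> (N z) ?V *\<^sub>R N z + fr.tang c"
    using fr.tangent_decomp_ex[OF df_tangent[OF assms tdir_dirs]] by blast
  from arg_cong[OF this, of "\<lambda>w. mform \<kappa> w (lapN z)"]
  have "mform \<kappa> ?V (lapN z) = mform \<kappa> (N z) ?V * - sf2 z"
    unfolding mform_simps(1,9,11) lapN_tangential[OF assms] lapN_normal[OF assms] by simp
  then show ?thesis
    using field_equation[OF assms tdir_dirs] mform_commute[of \<kappa> "N z" ?V]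
    by (simp add: field_def algebra_simps)
qed

end

section \<open>The Robin condition\<close>

context hypersurface_patch
begin

text \<open>The relation is available only on the boundary part of P, so it may be differentiated
  only in directions that stay there: the parameter direction and the coordinates other than
  \<open>nidx\<close>.\<close>

lemma boundary_dd_0:
  fixes h :: "real \<times> (real^'n) \<Rightarrow> real"
  assumes z: "z \<in> P" "snd z $ nidx = 0" and h: "h differentiable (at z)"
    and rel: "\<And>y. y \<in> P \<Longrightarrow> snd y $ nidx = 0 \<Longrightarrow> h y = 0"
  shows "dd tdir h z = 0" "i \<noteq> nidx \<Longrightarrow> dd (sdir i) h z = 0"
proof -
  show "dd tdir h z = 0"
  proof (rule dd_eq_0[OF h rel[OF z]])
    fix e :: real assume "0 < e"
    then obtain t where "0 < \<bar>t\<bar>" "\<bar>t\<bar> < e" "z + t *\<^sub>R tdir \<in> P" using P_time_dir[OF z(1)] by blast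
    then show "\<exists>t. 0 < \<bar>t\<bar> \<and> \<bar>t\<bar> < e \<and> h (z + t *\<^sub>R tdir) = 0"
      using z(2) by (intro exI[of _ t] conjI rel) simp_all
  qed
  show "dd (sdir i) h z = 0" if i: "i \<noteq> nidx"
  proof (rule dd_eq_0[OF h rel[OF z]])
    fix e :: real assume e: "0 < e"
    have n: "(snd z + t *\<^sub>R axis i 1) $ nidx = 0" for t
      using z(2) i by (simp add: axis_def)
    then obtain t where "t > 0" "t < e" "z + t *\<^sub>R sdir i \<in> P"
      using P_space_dir[OF z(1) e, of i] by (auto simp: halfspace_def)
    then show "\<exists>t. 0 < \<bar>t\<bar> \<and> \<bar>t\<bar> < e \<and> h (z + t *\<^sub>R sdir i) = 0"
      using n[of t] by (intro exI[of _ t] conjI rel) simp_all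
  qed
qed

text \<open>In the application s and C are \<open>sn\<close> and \<open>cs\<close> at the radius, c
  the coordinates of \<eta>, and r' the speed of the radius. The derivative of \<phi> along \<eta>
  has two parts: the derivative of the velocity paired with N gives C / s times \<phi>, and the
  velocity paired with the derivative of N gives r' A(\<eta>, \<eta>).\<close>

theorem boundary_derivative:
  fixes p0 :: "real \<times> 'e" and c :: "real^'n"
  assumes z: "z \<in> P" "snd z $ nidx = 0"
    and c: "c $ nidx \<noteq> 0" "c \<bullet> (gm z *v c) = 1" "\<And>v. v $ nidx = 0 \<Longrightarrow> c \<bullet> (gm z *v v) = 0"
    and perp: "\<And>y. y \<in> P \<Longrightarrow> snd y $ nidx = 0 \<Longrightarrow> mform \<kappa> (N y) (f y - p0) = 0"
    and s: "s \<noteq> 0" "s *\<^sub>R (\<Sum>i\<in>UNIV. (c $ i) *\<^sub>R E i z) = covariant \<kappa> (f z) (f z - p0)"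
    and k: "\<kappa> * mform \<kappa> (f z - p0) (f z) = 1 - C"
    and rad: "mform \<kappa> (f z - p0) (dd tdir f z) = s * r'"
  shows "(\<Sum>i\<in>UNIV. c $ i * dd (sdir i) (field tdir) z) - C / s * field tdir z
    = r' * (\<Sum>i\<in>UNIV. \<Sum>j\<in>UNIV. c $ i * c $ j * sf i j z)"
proof -
  interpret fr: hypersurface_frame \<kappa> "f z" "N z" "\<lambda>i. E i z"
    by (rule frame[OF z(1)])
  let ?V = "dd tdir f z" and ?\<eta> = "fr.tang c" and ?\<phi> = "field tdir z"
  define b where "b = mform \<kappa> (f z - p0) (f z)"
  have fd: "(\<lambda>y. f y - p0) differentiable (at z)"
    using f_diff[OF z(1)] by simp
  have dfp: "dd v (\<lambda>y. f y - p0) z = dd v f z" for v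
    using dd_add[OF f_diff[OF z(1)] differentiable_const[of "- p0"], of v] by simp
  have hd: "(\<lambda>y. mform \<kappa> (N y) (f y - p0)) differentiable (at z)"
    by (rule differentiable_mform[OF N_diff[OF z(1)] fd])
  \<comment> \<open>Pairings with \<eta> are traded for pairings with \<open>f z - p0\<close>, to
    which \<open>perp\<close> applies; the last term is the position component removed by
    \<open>covariant\<close>.\<close>
  have cov: "s * mform \<kappa> w ?\<eta> = mform \<kappa> w (f z - p0) - b * (\<kappa> * mform \<kappa> (f z) w)" for w
  proof -
    have "s * mform \<kappa> w ?\<eta> = mform \<kappa> w (covariant \<kappa> (f z) (f z - p0))"
      unfolding s(2)[symmetric] mform_simps(10) by simp
    then show ?thesis
      by (simp add: covariant_def mform_simps(4,10) b_def mform_commute[of \<kappa> w "f z"])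
  qed
  have "mform \<kappa> (N z) ?V + mform \<kappa> (dd tdir N z) (f z - p0) = 0"
    using boundary_dd_0(1)[OF z hd perp] unfolding dd_mform[OF N_diff[OF z(1)] fd] dfp .
  then have tN: "mform \<kappa> (dd tdir N z) (f z - p0) = - ?\<phi>"
    by (simp add: field_def mform_commute[of \<kappa> "N z"])
  \<comment> \<open>The position component of the derivative of N contributes \<kappa> b \<phi> to
    the - \<phi> of \<open>tN\<close>, and 1 - \<kappa> b = C.\<close>
  have t\<eta>: "s * mform \<kappa> (dd tdir N z) ?\<eta> = - C * ?\<phi>"
  proof -
    have "b * (\<kappa> * mform \<kappa> (f z) (dd tdir N z)) = - (\<kappa> * b) * ?\<phi>"
      unfolding f_dN[OF z(1) tdir_dirs] by (simp add: field_def)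
    then show ?thesis using cov[of "dd tdir N z"] tN k by (simp add: b_def algebra_simps)
  qed
  define B where "B = (\<lambda>j. mform \<kappa> (dd (sdir j) N z) ?\<eta>)"
  \<comment> \<open>This is the principal direction property: \<open>B j\<close> is A applied to
    \<eta> and the j-th coordinate direction, and it vanishes on directions tangent to the
    boundary.\<close>
  have B0: "B j = 0" if "j \<noteq> nidx" for j
  proof -
    have "mform \<kappa> (N z) (E j z) + mform \<kappa> (dd (sdir j) N z) (f z - p0) = 0"
      using boundary_dd_0(2)[OF z hd perp that] unfolding dd_mform[OF N_diff[OF z(1)] fd] dfp .
    then have "mform \<kappa> (dd (sdir j) N z) (f z - p0) = 0" using N_perp'[OF z(1)] by simp
    then have "s * B j = 0"
      unfolding B_def cov mform_tangent_point[OF kappa dN_tangent[OF z(1)]] by simp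
    then show ?thesis using s(1) by simp
  qed
  have Bsum: "B j = (\<Sum>i\<in>UNIV. c $ i * sf j i z)" for j
    unfolding B_def sf_def by (simp only: mform_simps(10,12) real_scaleR_def)
  have pick: "(\<Sum>j\<in>UNIV. v $ j * B j) = v $ nidx * B nidx" for v :: "real^'n"
  proof -
    have "(\<Sum>j\<in>UNIV. v $ j * B j) = (\<Sum>j::'n\<in>UNIV. if j = nidx then v $ nidx * B nidx else 0)"
      by (rule sum.cong[OF refl]) (simp add: B0)
    then show ?thesis by simp
  qed
  have A\<eta>\<eta>: "(\<Sum>i\<in>UNIV. \<Sum>j\<in>UNIV. c $ i * c $ j * sf i j z) = c $ nidx * B nidx"
    using pick[of c] unfolding Bsum sum_distrib_left by (simp add: mult.assoc)
  obtain v where v: "?V = mform \<kappa> (N z) ?V *\<^sub>R N z + fr.tang v"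
    using fr.tangent_decomp_ex[OF df_tangent[OF z(1) tdir_dirs]] by blast
  \<comment> \<open>The coefficient of \<eta> in the tangential part of the velocity: v - \<alpha> c
    is tangent to the boundary, hence orthogonal to \<eta>.\<close>
  define \<alpha> where "\<alpha> = v $ nidx / c $ nidx"
  have "\<alpha> = r'"
  proof -
    have "s * mform \<kappa> ?V ?\<eta> = s * r'"
      unfolding cov mform_tangent_point[OF kappa df_tangent[OF z(1) tdir_dirs]]
      using rad mform_commute[of \<kappa> ?V] by simp
    then have "mform \<kappa> ?V ?\<eta> = r'" using s(1) by simp
    moreover have "mform \<kappa> ?V ?\<eta> = c \<bullet> (gm z *v v)"
    proof -
      have "mform \<kappa> ?V ?\<eta> = mform \<kappa> (N z) ?V * mform \<kappa> (N z) ?\<eta> + mform \<kappa> (fr.tang v) ?\<eta>"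
        using arg_cong[OF v, of "\<lambda>w. mform \<kappa> w ?\<eta>"] by (simp only: mform_simps(1,9) real_scaleR_def)
      also have "\<dots> = mform \<kappa> ?\<eta> (fr.tang v)"
        unfolding fr.N_tang by (simp only: mform_commute[of \<kappa> "fr.tang v"] mult_zero_right add_0_left)
      also have "\<dots> = c \<bullet> (gm z *v v)"
        unfolding fr.mform_tang gram_eq[OF z(1)] ..
      finally show ?thesis .
    qed
    moreover have "c \<bullet> (gm z *v v) = \<alpha>"
    proof -
      have "(v - \<alpha> *\<^sub>R c) $ nidx = 0" using c(1) by (simp add: \<alpha>_def)
      from c(3)[OF this] show ?thesis
        using c(2) by (simp add: matrix_vector_mult_diff_distrib inner_diff_right matrix_vector_mult_scaleR)
    qed
    ultimately show ?thesis by simp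
  qed
  \<comment> \<open>By symmetry of A the sum is A(\<eta>, .) on the tangential velocity. Since
    \<open>B\<close> sees only the coordinate \<open>nidx\<close>, just the component r' \<eta>
    contributes.\<close>
  have VN: "(\<Sum>i\<in>UNIV. c $ i * mform \<kappa> ?V (dd (sdir i) N z)) = r' * (c $ nidx * B nidx)"
  proof -
    have "mform \<kappa> ?V (dd (sdir i) N z) = (\<Sum>j\<in>UNIV. v $ j * sf i j z)" for i
    proof -
      have "mform \<kappa> ?V (dd (sdir i) N z) = mform \<kappa> (N z) ?V * mform \<kappa> (N z) (dd (sdir i) N z)
          + (\<Sum>j\<in>UNIV. v $ j * mform \<kappa> (E j z) (dd (sdir i) N z))"
        using arg_cong[OF v, of "\<lambda>w. mform \<kappa> w (dd (sdir i) N z)"]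
        by (simp only: mform_simps(1,9,11) real_scaleR_def)
      then show ?thesis
        unfolding N_dN[OF z(1) sdir_dirs] sf_def mform_commute[of \<kappa> "E _ z"] by simp
    qed
    then have "(\<Sum>i\<in>UNIV. c $ i * mform \<kappa> ?V (dd (sdir i) N z))
        = (\<Sum>i\<in>UNIV. \<Sum>j\<in>UNIV. v $ j * (c $ i * sf j i z))"
      by (simp add: sum_distrib_left mult.left_commute sf_sym[OF z(1)])
    also have "\<dots> = (\<Sum>j\<in>UNIV. v $ j * B j)"
      unfolding Bsum by (subst sum.swap) (simp add: sum_distrib_left)
    also have "\<dots> = r' * (c $ nidx * B nidx)"
      unfolding pick \<open>\<alpha> = r'\<close>[symmetric] using c(1) by (simp add: \<alpha>_def)
    finally show ?thesis .
  qed
  \<comment> \<open>Differentiating the orthogonality of N and the frame in the parameter moves the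
    derivative from the velocity to the normal, where \<open>t\<eta>\<close> evaluates it.\<close>
  have "(\<Sum>i\<in>UNIV. c $ i * mform \<kappa> (dd (sdir i) (dd tdir f) z) (N z)) = - mform \<kappa> (dd tdir N z) ?\<eta>"
  proof -
    have "mform \<kappa> (dd tdir N z) ?\<eta> = (\<Sum>i\<in>UNIV. c $ i * mform \<kappa> (E i z) (dd tdir N z))"
      by (simp only: mform_simps(10,12) real_scaleR_def mform_commute[of \<kappa> "dd tdir N z"])
    also have "\<dots> = (\<Sum>i\<in>UNIV. c $ i * - mform \<kappa> (dd (sdir i) (dd tdir f) z) (N z))"
      unfolding E_dN[OF z(1) tdir_dirs] commute_f[OF z(1), of tdir] ..
    finally show ?thesis by (simp add: sum_negf)
  qed
  then have "(\<Sum>i\<in>UNIV. c $ i * mform \<kappa> (dd (sdir i) (dd tdir f) z) (N z)) = C / s * ?\<phi>"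
    using t\<eta> s(1) by (simp add: field_simps)
  then have "(\<Sum>i\<in>UNIV. c $ i * dd (sdir i) (field tdir) z) = C / s * ?\<phi> + r' * (c $ nidx * B nidx)"
    unfolding dd_field[OF z(1)] distrib_left sum.distrib VN by simp
  then show ?thesis unfolding A\<eta>\<eta> by simp
qed

end

section \<open>Charts of a variable-radius family\<close>

lemma pd_eq:
  assumes "x \<in> halfspace" "(u has_derivative D) (at x within halfspace)"
  shows "pd i u x = D (axis i 1)"
proof -
  have "frechet_derivative u (at x within halfspace) = D"
  proof (rule frechet_derivative_unique_within[OF _ assms(2)])
    show "(u has_derivative frechet_derivative u (at x within halfspace)) (at x within halfspace)"
      using assms(2) frechet_derivative_works differentiableI by blast
    fix b :: "real^'a" and e :: real assume b: "b \<in> Basis" "0 < e"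
    then obtain j where "b = axis j 1" by (auto simp: Basis_vec_def)
    \<comment> \<open>A positive step along any axis, the one of \<open>nidx\<close> included, stays
      in the half-space; so derivatives are determined at boundary points as well.\<close>
    then show "\<exists>d. 0 < \<bar>d\<bar> \<and> \<bar>d\<bar> < e \<and> x + d *\<^sub>R b \<in> halfspace"
      using assms(1) b(2) by (intro exI[of _ "e / 2"]) (auto simp: halfspace_def axis_def)
  qed
  then show ?thesis by (simp add: pd_def)
qed

lemma has_derivative_local_rep:
  assumes Cs: "openin (top_of_set halfspace) Cs" and U: "open U" and x: "(s, x) \<in> (I \<times> Cs) \<inter> U"
    and h: "h differentiable (at (s, x))" and eq: "\<And>y. (s, y) \<in> (I \<times> Cs) \<inter> U \<Longrightarrow> u y = h (s, y)"
  shows "(u has_derivative (\<lambda>v. dd (0, v) h (s, x))) (at x within halfspace)"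
proof -
  have "open (Pair s -` U)" by (intro open_vimage U continuous_intros)
  then obtain d1 where d1: "0 < d1" "ball x d1 \<subseteq> Pair s -` U"
    using x open_contains_ball by blast
  obtain d2 where d2: "0 < d2" "\<And>y. y \<in> halfspace \<Longrightarrow> dist y x < d2 \<Longrightarrow> y \<in> Cs"
    using Cs[unfolded openin_euclidean_subtopology_iff] x by blast
  show ?thesis
  proof (rule has_derivative_transform_within[OF has_derivative_at_withinI[OF has_derivative_slice[OF h]]])
    show "0 < min d1 d2" using d1 d2 by simp
    show "x \<in> halfspace" using openin_imp_subset[OF Cs] x by blast
    fix y assume y: "y \<in> halfspace" "dist y x < min d1 d2"
    then have "y \<in> Cs" "y \<in> ball x d1" using d2(2)[OF y(1)] by (auto simp: dist_commute)
    then have "(s, y) \<in> (I \<times> Cs) \<inter> U" using d1(2) x by auto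
    then show "h (s, y) = u y" using eq by simp
  qed
qed

lemma pd_local_rep:
  assumes Cs: "openin (top_of_set halfspace) Cs" and "open U" "(s, x) \<in> (I \<times> Cs) \<inter> U"
    and "h differentiable (at (s, x))" "\<And>y. (s, y) \<in> (I \<times> Cs) \<inter> U \<Longrightarrow> u y = h (s, y)"
  shows "pd i u x = dd (sdir i) h (s, x)"
  using pd_eq[OF _ has_derivative_local_rep[OF assms]] openin_imp_subset[OF Cs] assms(3) by blast

text \<open>Works on a single slice. It is meant for the unit normal in the definition of
  minimality, which is given for each parameter separately and has no extension in the
  parameter.\<close>

lemma pd_mform_0:
  assumes x: "x \<in> halfspace"
    and p: "(p has_derivative Dp) (at x within halfspace)" and q: "(q has_derivative Dq) (at x within halfspace)"
    and Cs: "openin (top_of_set halfspace) Cs" "x \<in> Cs" and 0: "\<And>y. y \<in> Cs \<Longrightarrow> mform \<kappa> (p y) (q y) = 0"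
  shows "mform \<kappa> (p x) (pd i q x) + mform \<kappa> (pd i p x) (q x) = 0"
proof -
  have D: "((\<lambda>y. mform \<kappa> (p y) (q y)) has_derivative (\<lambda>h. mform \<kappa> (p x) (Dq h) + mform \<kappa> (Dp h) (q x)))
      (at x within halfspace)"
    by (rule bounded_bilinear.FDERIV[OF bounded_bilinear_mform p q])
  obtain d where d: "0 < d" "\<And>y. y \<in> halfspace \<Longrightarrow> dist y x < d \<Longrightarrow> y \<in> Cs"
    using Cs[unfolded openin_euclidean_subtopology_iff] by blast
  have "((\<lambda>y. mform \<kappa> (p y) (q y)) has_derivative (\<lambda>h. 0)) (at x within halfspace)"
    by (rule has_derivative_transform_within[OF has_derivative_const[of 0] d(1) x]) (simp add: d(2) 0)
  from pd_eq[OF x D, of i] pd_eq[OF x this, of i] show ?thesis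
    by (simp add: pd_eq[OF x p] pd_eq[OF x q])
qed

lemma smooth_on_has_derivative:
  assumes Cs: "openin (top_of_set halfspace) Cs" "x \<in> Cs" and u: "smooth_on Cs u"
  shows "\<exists>D. (u has_derivative D) (at x within halfspace)"
proof -
  obtain V g where V: "open V" "x \<in> V" "smooth_open g V" "\<forall>y\<in>Cs \<inter> V. g y = u y"
    using u Cs(2) unfolding smooth_on_def by blast
  obtain D where D: "(g has_derivative D) (at x)"
    using smooth_open_differentiable[OF V(3,2)] unfolding differentiable_def by blast
  obtain d1 where d1: "0 < d1" "ball x d1 \<subseteq> V" using V(1,2) open_contains_ball by blast
  obtain d2 where d2: "0 < d2" "\<And>y. y \<in> halfspace \<Longrightarrow> dist y x < d2 \<Longrightarrow> y \<in> Cs"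
    using Cs[unfolded openin_euclidean_subtopology_iff] by blast
  have "(u has_derivative D) (at x within halfspace)"
  proof (rule has_derivative_transform_within[OF has_derivative_at_withinI[OF D]])
    show "0 < min d1 d2" using d1 d2 by simp
    show "x \<in> halfspace" using openin_imp_subset[OF Cs(1)] Cs(2) by blast
    fix y assume y: "y \<in> halfspace" "dist y x < min d1 d2"
    then have "y \<in> Cs" "y \<in> ball x d1" using d2(2)[OF y(1)] by (auto simp: dist_commute)
    then show "g y = u y" using V(4) d1(2) by auto
  qed
  then show ?thesis by blast
qed

lemma push_axis: "push f x (axis i 1) = pd i f x"
proof -
  have "push f x (axis i 1) = (\<Sum>j\<in>UNIV. if j = i then pd i f x else 0)"
    unfolding push_def by (rule sum.cong[OF refl]) (simp add: axis_def)
  then show ?thesis by simp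
qed

text \<open>Minimality is asserted for some unit normal, possibly with a sign other than that of N.
  A nonzero factor at each point is enough to transfer the vanishing of the mean curvature.\<close>

lemma (in hypersurface_frame) unit_normal_unique:
  assumes "w \<in> tangent_space \<kappa> F" "mform \<kappa> w w = 1" "\<And>v. mform \<kappa> w (tang v) = 0"
  shows "w = mform \<kappa> N w *\<^sub>R N" "mform \<kappa> N w \<noteq> 0"
proof -
  obtain v where v: "w = mform \<kappa> N w *\<^sub>R N + tang v"
    using tangent_decomp_ex[OF assms(1)] by blast
  have "mform \<kappa> w (tang v) = mform \<kappa> (tang v) (tang v)"
    using arg_cong[OF v, of "\<lambda>u. mform \<kappa> u (tang v)"] N_tang[of v] by (simp only: mform_simps(1,9)) simp
  then have "tang v = 0"
    using assms(3)[of v] mform_tangent_pos[OF kappa F tang_tangent[of v]] by fastforce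
  then show 1: "w = mform \<kappa> N w *\<^sub>R N" using v by simp
  show "mform \<kappa> N w \<noteq> 0"
  proof
    assume "mform \<kappa> N w = 0"
    then have "w = 0" using 1 by simp
    then show False using assms(2) by (simp add: mform_simps)
  qed
qed

lemma family_extension:
  assumes "smooth_family I atl F" "C \<in> atl" "s \<in> I" "x \<in> chart_image C"
  obtains U f where "open U" "(s, x) \<in> U" "smooth_open f U"
    "\<And>s y. (s, y) \<in> (I \<times> chart_image C) \<inter> U \<Longrightarrow> local_rep C (F s) y = f (s, y)"
proof -
  have "smooth_on (I \<times> chart_image C) (\<lambda>(s, x). local_rep C (F s) x)"
    using assms(1,2) unfolding smooth_family_def by blast
  moreover have "(s, x) \<in> I \<times> chart_image C" using assms by blast
  ultimately obtain U g where U: "open U" "(s, x) \<in> U" "smooth_open g U"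
    "\<forall>y\<in>(I \<times> chart_image C) \<inter> U. g y = (\<lambda>(s, x). local_rep C (F s) x) y"
    unfolding smooth_on_def by blast
  show thesis by (rule that[OF U(1-3)]) (use U(4) in force)
qed

lemma ex_minimal_patch:
  fixes atl :: "('a, 'n::finite) chart set" and \<Phi> :: "real \<Rightarrow> 'a \<Rightarrow> real \<times> 'e::euclidean_space"
  assumes k: "\<kappa> \<in> {-1, 0, 1}" and dim: "DIM('e) = CARD('n) + 1"
    and V: "variable_radius_family \<kappa> p0 X atl I r \<Phi> \<nu>"
    and C: "C \<in> atl" and a: "a \<in> I" and x: "x \<in> chart_image C"
  obtains U f N where "minimal_patch \<kappa> I (chart_image C) U f N" "(a, x) \<in> U"
    "\<And>s y. (s, y) \<in> (I \<times> chart_image C) \<inter> U \<Longrightarrow> local_rep C (\<Phi> s) y = f (s, y)"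
    "\<And>s y. (s, y) \<in> (I \<times> chart_image C) \<inter> U \<Longrightarrow> local_rep C (\<nu> s) y = N (s, y)"
proof -
  have I: "is_interval I" "interior I \<noteq> {}" and mfd: "smooth_manifold_with_boundary X atl"
    and fam: "smooth_family I atl \<Phi>" "smooth_family I atl \<nu>"
    and fb: "\<And>s. s \<in> I \<Longrightarrow> free_boundary_minimal_immersion \<kappa> p0 (r s) X atl (\<Phi> s)"
    and un: "\<And>s. s \<in> I \<Longrightarrow> unit_normal \<kappa> atl (\<Phi> s) (\<nu> s)"
    using V unfolding variable_radius_family_def by blast+
  let ?C = "chart_image C"
  have Cs: "openin (top_of_set halfspace) ?C"
    using mfd C unfolding smooth_manifold_with_boundary_def by blast
  obtain U1 f where U1: "open U1" "(a, x) \<in> U1" "smooth_open f U1"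
    and f1: "\<And>s y. (s, y) \<in> (I \<times> ?C) \<inter> U1 \<Longrightarrow> local_rep C (\<Phi> s) y = f (s, y)"
    using family_extension[OF fam(1) C a x] by blast
  obtain U2 N where U2: "open U2" "(a, x) \<in> U2" "smooth_open N U2"
    and N2: "\<And>s y. (s, y) \<in> (I \<times> ?C) \<inter> U2 \<Longrightarrow> local_rep C (\<nu> s) y = N (s, y)"
    using family_extension[OF fam(2) C a x] by blast
  define U where "U = U1 \<inter> U2"
  have aU: "(a, x) \<in> U" using U1(2) U2(2) by (simp add: U_def)
  have U: "open U" "smooth_open f U" "smooth_open N U"
    using U1 U2 Ck_on_open_subset unfolding U_def by (blast intro: Ck_on_open_subset)+
  have f: "local_rep C (\<Phi> s) y = f (s, y)" and N: "local_rep C (\<nu> s) y = N (s, y)"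
    if "(s, y) \<in> (I \<times> ?C) \<inter> U" for s y
    using that f1 N2 unfolding U_def by blast+
  have pd_f: "pd i (local_rep C (\<Phi> s)) y = dd (sdir i) f (s, y)" if "(s, y) \<in> (I \<times> ?C) \<inter> U" for s y i
  proof (rule pd_local_rep[OF Cs U(1) that])
    show "f differentiable (at (s, y))" using smooth_open_differentiable[OF U(2)] that by blast
  qed (rule f)
  have push: "push (local_rep C (\<Phi> s)) y = (\<lambda>v. \<Sum>i\<in>UNIV. (v $ i) *\<^sub>R dd (sdir i) f (s, y))"
    if "(s, y) \<in> (I \<times> ?C) \<inter> U" for s y
    unfolding push_def pd_f[OF that] ..
  have imm: "local_rep C (\<Phi> s) y \<in> space_form \<kappa>" "inj (push (local_rep C (\<Phi> s)) y)"
    if "s \<in> I" "y \<in> ?C" for s y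
    using fb[OF that(1)] that(2) C
    unfolding free_boundary_minimal_immersion_def two_sided_minimal_immersion_def immersion_def by blast+
  have nu: "local_rep C (\<nu> s) y \<in> tangent_space \<kappa> (local_rep C (\<Phi> s) y)"
    "mform \<kappa> (local_rep C (\<nu> s) y) (local_rep C (\<nu> s) y) = 1"
    "mform \<kappa> (local_rep C (\<nu> s) y) (push (local_rep C (\<Phi> s)) y v) = 0"
    if "s \<in> I" "y \<in> ?C" for s y v
    using un[OF that(1)] that(2) C unfolding unit_normal_def by blast+
  interpret hypersurface_patch \<kappa> I ?C U f N
  proof (rule hypersurface_patch.intro[OF k dim I Cs U])
    fix z assume "z \<in> (I \<times> ?C) \<inter> U"
    then obtain s y where z: "z = (s, y)" "(s, y) \<in> (I \<times> ?C) \<inter> U" by (cases z) auto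
    then have sy: "s \<in> I" "y \<in> ?C" by auto
    show "f z \<in> space_form \<kappa>" using imm(1)[OF sy] unfolding z(1) f[OF z(2)] .
    show "inj (\<lambda>v::real^'n. \<Sum>i\<in>UNIV. (v $ i) *\<^sub>R dd (sdir i) f z)"
      using imm(2)[OF sy] unfolding z(1) push[OF z(2)] .
    show "N z \<in> tangent_space \<kappa> (f z)" using nu(1)[OF sy] unfolding z(1) f[OF z(2)] N[OF z(2)] .
    show "mform \<kappa> (N z) (N z) = 1" using nu(2)[OF sy] unfolding z(1) N[OF z(2)] .
    show "mform \<kappa> (N z) (dd (sdir i) f z) = 0" for i
      using nu(3)[OF sy, of "axis i 1"] unfolding push_axis z(1) N[OF z(2)] pd_f[OF z(2)] .
  qed
  have "minimal_patch \<kappa> I ?C U f N"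
  proof (intro minimal_patch.intro minimal_patch_axioms.intro hypersurface_patch_axioms)
    fix z assume zP: "z \<in> P"
    then obtain s y where z: "z = (s, y)" "(s, y) \<in> (I \<times> ?C) \<inter> U" by (cases z) (auto simp: P_def)
    then have sy: "s \<in> I" "y \<in> ?C" by auto
    let ?F = "local_rep C (\<Phi> s)"
    \<comment> \<open>This normal depends on s and is unrelated to the smooth choice \<nu>; the two
      are compared only at the point y.\<close>
    obtain \<mu> where \<mu>: "unit_normal \<kappa> atl (\<Phi> s) \<mu>" "mean_curvature \<kappa> ?F (local_rep C \<mu>) y = 0"
      using fb[OF sy(1)] sy(2) C
      unfolding free_boundary_minimal_immersion_def two_sided_minimal_immersion_def by blast
    let ?m = "local_rep C \<mu>"
    have m: "smooth_on ?C ?m" "\<And>y. y \<in> ?C \<Longrightarrow> ?m y \<in> tangent_space \<kappa> (?F y)"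
      "\<And>y. y \<in> ?C \<Longrightarrow> mform \<kappa> (?m y) (?m y) = 1" "\<And>y v. y \<in> ?C \<Longrightarrow> mform \<kappa> (?m y) (push ?F y v) = 0"
      using \<mu>(1) C unfolding unit_normal_def smooth_on_mfd_def by blast+
    interpret fr: hypersurface_frame \<kappa> "f z" "N z" "\<lambda>i. E i z" by (rule frame[OF zP])
    have mz: "?m y = mform \<kappa> (N z) (?m y) *\<^sub>R N z" "mform \<kappa> (N z) (?m y) \<noteq> 0"
      using fr.unit_normal_unique[of "?m y"] m(2-4)[OF sy(2)] unfolding push[OF z(2)] f[OF z(2)] z(1) by blast+
    have yh: "y \<in> halfspace" by (rule Cs_halfspace[OF sy(2)])
    obtain Dm where Dm: "(?m has_derivative Dm) (at y within halfspace)"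
      using smooth_on_has_derivative[OF Cs sy(2) m(1)] by blast
    have ginv: "ginv \<kappa> ?F y $ i $ j = Gi i j z" for i j
      unfolding ginv_def gmat_def gm_def pd_f[OF z(2)] z(1) ..
    \<comment> \<open>Differentiating the orthogonality of \<open>?m\<close> to the coordinate
      vectors moves the derivative off \<open>?m\<close>. What remains is its value at y, a multiple
      of N, so no derivative of the factor appears.\<close>
    have A: "sff \<kappa> ?F ?m y $ i $ j = - mform \<kappa> (N z) (?m y) * mform \<kappa> (dd (sdir i) (E j) z) (N z)" for i j
    proof -
      have "sff \<kappa> ?F ?m y $ i $ j = mform \<kappa> (pd i ?m y) (pd j ?F y)"
        using mform_covariant[OF k, of "pd j ?F y" "?F y" "pd i ?m y"] df_tangent[OF zP sdir_dirs, of j]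
        unfolding sff_def pd_f[OF z(2)] f[OF z(2)] z(1) by simp
      also have "\<dots> = - mform \<kappa> (?m y) (pd i (pd j ?F) y)"
      proof -
        have D: "((pd j ?F) has_derivative (\<lambda>v. dd (0, v) (E j) (s, y))) (at y within halfspace)"
          by (rule has_derivative_local_rep[OF Cs U(1) z(2) df_diff[OF zP[unfolded z(1)]]]) (rule pd_f)
        have "mform \<kappa> (?m y) (pd i (pd j ?F) y) + mform \<kappa> (pd i ?m y) (pd j ?F y) = 0"
          by (rule pd_mform_0[OF yh Dm D Cs sy(2)]) (use m(4) push_axis in metis)
        then show ?thesis by linarith
      qed
      also have "pd i (pd j ?F) y = dd (sdir i) (E j) z"
        unfolding z(1) by (rule pd_local_rep[OF Cs U(1) z(2) df_diff[OF zP[unfolded z(1)]]]) (rule pd_f)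
      also have "mform \<kappa> (?m y) (dd (sdir i) (E j) z) = mform \<kappa> (N z) (?m y) * mform \<kappa> (N z) (dd (sdir i) (E j) z)"
        using arg_cong[OF mz(1), of "\<lambda>w. mform \<kappa> w (dd (sdir i) (E j) z)"] by (simp only: mform_simps(9) real_scaleR_def)
      finally show ?thesis by (simp add: mform_commute[of \<kappa> "N z" "dd (sdir i) (E j) z"])
    qed
    have "- mform \<kappa> (N z) (?m y) * (\<Sum>i\<in>UNIV. \<Sum>j\<in>UNIV. Gi i j z * mform \<kappa> (dd (sdir i) (E j) z) (N z)) = 0"
      using \<mu>(2) unfolding mean_curvature_def ginv A
      by (simp add: sum_distrib_left sum_negf mult.left_commute)
    then show "(\<Sum>i\<in>UNIV. \<Sum>j\<in>UNIV. Gi i j z * mform \<kappa> (dd (sdir i) (E j) z) (N z)) = 0"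
      using mz(2) by simp
  qed
  then show thesis using that aU f N by blast
qed

section \<open>The conormal\<close>

lemma conormal_unique:
  fixes A :: "real^'n::finite^'n"
  assumes inv: "invertible A" and sym: "\<And>i j. A $ i $ j = A $ j $ i"
    and pos: "\<And>v. v \<noteq> 0 \<Longrightarrow> 0 < v \<bullet> (A *v v)"
  shows "\<exists>!c. c $ nidx < 0 \<and> c \<bullet> (A *v c) = 1 \<and> (\<forall>v. v $ nidx = 0 \<longrightarrow> c \<bullet> (A *v v) = 0)"
proof -
  have swap: "v \<bullet> (A *v w) = w \<bullet> (A *v v)" for v w
  proof -
    have "transpose A = A" using sym by (simp add: transpose_def vec_eq_iff)
    then show ?thesis by (metis dot_lmul_matrix inner_commute transpose_matrix_vector)
  qed
  let ?e = "axis nidx 1 :: real^'n"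
  define w where "w = matrix_inv A *v ?e"
  have Aw: "A *v w = ?e"
    by (simp add: w_def matrix_vector_mul_assoc matrix_inv_inverse(1)[OF inv])
  then have "w \<noteq> 0" by (metis axis_eq_0_iff matrix_vector_mult_0_right zero_neq_one)
  then have wn: "0 < w $ nidx" using pos[of w] by (simp add: Aw inner_axis)
  \<comment> \<open>w is the gradient of the boundary coordinate, and its metric square is
    \<open>w $ nidx\<close>; this explains the normalisation. The minus sign makes c point out of
    the half-space.\<close>
  define c where "c = (- 1 / sqrt (w $ nidx)) *\<^sub>R w"
  have Ac: "v \<bullet> (A *v c) = - v $ nidx / sqrt (w $ nidx)" for v
    unfolding c_def matrix_vector_mult_scaleR Aw by (simp add: inner_axis)
  have c: "c $ nidx < 0" "c \<bullet> (A *v c) = 1" "\<forall>v. v $ nidx = 0 \<longrightarrow> c \<bullet> (A *v v) = 0"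
  proof -
    show "c $ nidx < 0" using wn by (simp add: c_def)
    show "c \<bullet> (A *v c) = 1" unfolding Ac using wn by (simp add: c_def)
    show "\<forall>v. v $ nidx = 0 \<longrightarrow> c \<bullet> (A *v v) = 0" unfolding swap[of c] Ac by simp
  qed
  show ?thesis
  proof (rule ex1I[of _ c])
    fix d assume d: "d $ nidx < 0 \<and> d \<bullet> (A *v d) = 1 \<and> (\<forall>v. v $ nidx = 0 \<longrightarrow> d \<bullet> (A *v v) = 0)"
    \<comment> \<open>d - a c has boundary coordinate 0, so both orthogonality conditions apply to
      it. With the symmetry of A they give a^2 = 1, and positivity leaves a = 1.\<close>
    define a where "a = d $ nidx / c $ nidx"
    have a: "0 < a" using d c(1) by (simp add: a_def divide_neg_neg)
    let ?v = "d - a *\<^sub>R c"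
    have v: "?v $ nidx = 0" using c(1) by (simp add: a_def)
    have "c \<bullet> (A *v d) = a"
      using c(3)[rule_format, OF v] c(2)
      by (simp add: matrix_vector_mult_diff_distrib inner_diff_right matrix_vector_mult_scaleR)
    moreover have "1 = a * (d \<bullet> (A *v c))"
      using d[THEN conjunct2, THEN conjunct2, rule_format, OF v] d
      by (simp add: matrix_vector_mult_diff_distrib inner_diff_right matrix_vector_mult_scaleR)
    ultimately have "a * a = 1" using swap[of d c] by simp
    then have a1: "a = 1" using a
      by (metis abs_of_pos abs_mult_self_eq power2_eq_1_iff power2_eq_square
          less_minus_one_simps(3) order_less_asym)
    then have "?v \<bullet> (A *v ?v) = 0"
      using v d c(3) by (simp add: inner_diff_left)
    then have "?v = 0" using pos[of ?v] by fastforce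
    then show "d = c" using a1 by simp
  qed (use c in blast)
qed

lemma interval_at_within_not_bot:
  fixes I :: "real set"
  assumes "is_interval I" "interior I \<noteq> {}" "a \<in> I"
  shows "at a within I \<noteq> bot"
proof -
  have "a islimpt I" unfolding islimpt_approachable
  proof (intro allI impI)
    fix e :: real assume "0 < e"
    then obtain t where "0 < \<bar>t\<bar>" "\<bar>t\<bar> < e" "a + t \<in> I"
      using interval_accumulates[OF assms] by blast
    then show "\<exists>x'\<in>I. x' \<noteq> a \<and> dist x' a < e"
      by (intro bexI[of _ "a + t"]) (auto simp: dist_real_def)
  qed
  then show ?thesis by (simp add: trivial_limit_within)
qed

lemma smooth_on_real_differentiable:
  fixes r :: "real \<Rightarrow> real"
  assumes "smooth_on I r" "a \<in> I"
  shows "r differentiable (at a within I)"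
proof -
  obtain V g where V: "open V" "a \<in> V" "smooth_open g V" "\<forall>y\<in>I \<inter> V. g y = r y"
    using assms unfolding smooth_on_def by blast
  obtain D where D: "(g has_derivative D) (at a within I)"
    using smooth_open_differentiable[OF V(3,2)] has_derivative_at_withinI unfolding differentiable_def by blast
  obtain d where d: "0 < d" "ball a d \<subseteq> V" using V(1,2) open_contains_ball by blast
  have "(r has_derivative D) (at a within I)"
  proof (rule has_derivative_transform_within[OF D d(1) assms(2)])
    fix y assume "y \<in> I" "dist y a < d"
    then show "g y = r y" using d(2) V(4) by (auto simp: dist_commute)
  qed
  then show ?thesis by (rule differentiableI)
qed

section \<open>Matching chart quantities with their extensions\<close>

locale family_chart = minimal_patch \<kappa> I "chart_image C" U f N
  for \<kappa> :: real and I :: "real set" and C :: "('a, 'n::finite) chart" and U :: "(real \<times> (real^'n)) set"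
    and f N :: "real \<times> (real^'n) \<Rightarrow> real \<times> 'e::euclidean_space" +
  fixes \<Phi> \<nu> :: "real \<Rightarrow> 'a \<Rightarrow> real \<times> 'e"
  assumes rep_f: "\<And>s y. (s, y) \<in> P \<Longrightarrow> local_rep C (\<Phi> s) y = f (s, y)"
    and rep_N: "\<And>s y. (s, y) \<in> P \<Longrightarrow> local_rep C (\<nu> s) y = N (s, y)"
begin

lemma pd_rep:
  assumes "(s, x) \<in> P" "h differentiable (at (s, x))" "\<And>y. (s, y) \<in> P \<Longrightarrow> u y = h (s, y)"
  shows "pd i u x = dd (sdir i) h (s, x)"
  by (rule pd_local_rep[OF Cs U assms(1)[unfolded P_def] assms(2)]) (rule assms(3)[unfolded P_def])

lemma pd_f: "(s, y) \<in> P \<Longrightarrow> pd i (local_rep C (\<Phi> s)) y = E i (s, y)"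
  by (rule pd_rep[OF _ f_diff rep_f])

lemma pd_N: "(s, y) \<in> P \<Longrightarrow> pd i (local_rep C (\<nu> s)) y = dd (sdir i) N (s, y)"
  by (rule pd_rep[OF _ N_diff rep_N])

lemma push_f: "(s, y) \<in> P \<Longrightarrow> push (local_rep C (\<Phi> s)) y v = (\<Sum>i\<in>UNIV. (v $ i) *\<^sub>R E i (s, y))"
  unfolding push_def by (simp only: pd_f)

lemma gmat_f: "(s, y) \<in> P \<Longrightarrow> gmat \<kappa> (local_rep C (\<Phi> s)) y = gm (s, y)"
  unfolding gmat_def gm_def by (simp only: pd_f)

lemma ginv_f: "(s, y) \<in> P \<Longrightarrow> ginv \<kappa> (local_rep C (\<Phi> s)) y $ i $ j = Gi i j (s, y)"
  unfolding ginv_def by (simp only: gmat_f)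

lemma pd_gmat:
  assumes "(s, y) \<in> P"
  shows "pd l (\<lambda>y. gmat \<kappa> (local_rep C (\<Phi> s)) y $ i $ j) y
    = mform \<kappa> (E i (s, y)) (dd (sdir l) (E j) (s, y)) + mform \<kappa> (dd (sdir l) (E i) (s, y)) (E j (s, y))"
proof -
  have "pd l (\<lambda>y. gmat \<kappa> (local_rep C (\<Phi> s)) y $ i $ j) y = dd (sdir l) (\<lambda>z. gm z $ i $ j) (s, y)"
    by (rule pd_rep[OF assms gm_diff[OF assms]]) (simp only: gmat_f)
  then show ?thesis
    by (simp add: gm_def dd_mform[OF df_diff[OF assms] df_diff[OF assms]])
qed

text \<open>Because second derivatives commute, four of the six products in the Koszul combination
  of metric derivatives cancel, and the other two agree.\<close>

lemma christoffel_f: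
  assumes "(s, y) \<in> P"
  shows "christoffel \<kappa> (local_rep C (\<Phi> s)) k i j y = chris k i j (s, y)"
proof -
  let ?z = "(s, y)"
  have c: "dd (sdir b) (E a) ?z = dd (sdir a) (E b) ?z" for a b
    by (rule commute_f[OF assms])
  have "mform \<kappa> (E j ?z) (dd (sdir i) (E l) ?z) + mform \<kappa> (dd (sdir i) (E j) ?z) (E l ?z)
      + (mform \<kappa> (E i ?z) (dd (sdir j) (E l) ?z) + mform \<kappa> (dd (sdir j) (E i) ?z) (E l ?z))
      - (mform \<kappa> (E i ?z) (dd (sdir l) (E j) ?z) + mform \<kappa> (dd (sdir l) (E i) ?z) (E j ?z))
    = 2 * mform \<kappa> (dd (sdir i) (E j) ?z) (E l ?z)" for l
    using mform_commute[of \<kappa> "E j ?z" "dd (sdir i) (E l) ?z"] c[of l j] c[of l i] c[of j i] by simp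
  note eq = this
  have "christoffel \<kappa> (local_rep C (\<Phi> s)) k i j y
      = 1/2 * (\<Sum>l\<in>UNIV. Gi k l ?z * (2 * mform \<kappa> (dd (sdir i) (E j) ?z) (E l ?z)))"
    unfolding christoffel_def ginv_f[OF assms] pd_gmat[OF assms] eq ..
  then show ?thesis by (simp add: chris_def sum_distrib_left mult.left_commute)
qed

lemma laplacian_f:
  assumes z: "(s, x) \<in> P" and h: "smooth_open h U" and u: "\<And>y. (s, y) \<in> P \<Longrightarrow> u y = h (s, y)"
  shows "laplacian \<kappa> (local_rep C (\<Phi> s)) u x = lap h (s, x)"
proof -
  \<comment> \<open>Needed on the whole slice of P and not just at x, because a second half-space
    derivative is taken of it.\<close>
  have 1: "pd j u y = dd (sdir j) h (s, y)" if "(s, y) \<in> P" for j y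
    by (rule pd_rep[OF that smooth_open_differentiable[OF h P_U[OF that]] u])
  have "pd i (pd j u) x = dd (sdir i) (dd (sdir j) h) (s, x)" for i j
    by (rule pd_rep[OF z smooth_open_differentiable[OF smooth_open_dd[OF h] P_U[OF z]] 1])
  then show ?thesis
    unfolding laplacian_def lap_def ginv_f[OF z] christoffel_f[OF z] 1[OF z] by simp
qed

lemma sff_f:
  assumes "(s, y) \<in> P"
  shows "sff \<kappa> (local_rep C (\<Phi> s)) (local_rep C (\<nu> s)) y $ i $ j = sf i j (s, y)"
  using mform_covariant[OF kappa df_tangent[OF assms sdir_dirs]]
  unfolding sff_def sf_def pd_f[OF assms] pd_N[OF assms] rep_f[OF assms] by simp

lemma sff_norm2_f:
  "(s, y) \<in> P \<Longrightarrow> sff_norm2 \<kappa> (local_rep C (\<Phi> s)) (local_rep C (\<nu> s)) y = sf2 (s, y)"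
  unfolding sff_norm2_def sf2_def by (simp only: ginv_f sff_f)

lemma parametric_field_f:
  assumes z: "(a, y) \<in> P"
  shows "local_rep C (parametric_field \<kappa> I \<Phi> \<nu> a) y = field tdir (a, y)"
proof -
  \<comment> \<open>The line starts at parameter 0, so that its running parameter is s
    itself.\<close>
  have d: "((\<lambda>s. f ((0, y) + s *\<^sub>R tdir)) has_vector_derivative dd tdir f ((0, y) + a *\<^sub>R tdir)) (at a)"
    by (rule has_vector_derivative_line) (use f_diff[OF z] in simp)
  obtain e where e: "0 < e" "\<And>t. \<bar>t\<bar> < e \<Longrightarrow> (a, y) + t *\<^sub>R tdir \<in> U"
    using near_U[OF P_U[OF z]] by blast
  have "((\<lambda>s. local_rep C (\<Phi> s) y) has_vector_derivative dd tdir f (a, y)) (at a within I)"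
  proof (rule has_vector_derivative_transform_within[OF has_vector_derivative_at_within e(1)])
    show "((\<lambda>s. f (s, y)) has_vector_derivative dd tdir f (a, y)) (at a)" using d by simp
    show "a \<in> I" using z by (simp add: P_def)
    fix s assume s: "s \<in> I" "dist s a < e"
    then have "(s, y) \<in> P" using e(2)[of "s - a"] z by (simp add: P_def dist_real_def)
    then show "f (s, y) = local_rep C (\<Phi> s) y" using rep_f by simp
  qed
  moreover have "at a within I \<noteq> bot"
    using z by (intro interval_at_within_not_bot[OF I]) (simp add: P_def)
  ultimately have "vector_derivative (\<lambda>s. local_rep C (\<Phi> s) y) (at a within I) = dd tdir f (a, y)"
    by (intro vector_derivative_within)
  then show ?thesis
    unfolding local_rep_def parametric_field_def field_def
    using rep_N[OF z] by (simp add: local_rep_def)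
qed

end

lemma boundary_chart_point:
  assumes "smooth_manifold_with_boundary X atl" "C \<in> atl" "x \<in> chart_image C" "x $ nidx = 0"
  shows "inv_into (fst C) (snd C) x \<in> mfd_boundary X atl"
proof -
  have x: "x \<in> snd C ` fst C" using assms(3) by (simp add: chart_image_def)
  have "inv_into (fst C) (snd C) x \<in> fst C" by (rule inv_into_into[OF x])
  moreover have "snd C (inv_into (fst C) (snd C) x) = x" by (rule f_inv_into_f[OF x])
  moreover have "fst C \<subseteq> topspace X"
    using assms(1,2) unfolding smooth_manifold_with_boundary_def by blast
  ultimately show ?thesis using assms(2,4) unfolding mfd_boundary_def by auto
qed

section \<open>The parametric field at a chart point\<close>

context
  fixes \<kappa> :: real and p0 :: "real \<times> 'e::euclidean_space"
    and X :: "'a topology" and atl :: "('a, 'n::finite) chart set"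
    and I :: "real set" and r :: "real \<Rightarrow> real"
    and \<Phi> \<nu> :: "real \<Rightarrow> 'a \<Rightarrow> real \<times> 'e" and a :: real and C :: "('a, 'n) chart" and x :: "real^'n"
  assumes kappa: "\<kappa> \<in> {-1, 0, 1}" and dim: "DIM('e) = CARD('n) + 1" and p0: "p0 \<in> space_form \<kappa>"
    and V: "variable_radius_family \<kappa> p0 X atl I r \<Phi> \<nu>"
    and a: "a \<in> I" and C: "C \<in> atl" and x: "x \<in> chart_image C"
begin

lemma ex_family_chart:
  obtains U f N where "family_chart \<kappa> I C U f N \<Phi> \<nu>" "(a, x) \<in> (I \<times> chart_image C) \<inter> U"
proof -
  obtain U f N where *: "minimal_patch \<kappa> I (chart_image C) U f N" "(a, x) \<in> U"
    "\<And>s y. (s, y) \<in> (I \<times> chart_image C) \<inter> U \<Longrightarrow> local_rep C (\<Phi> s) y = f (s, y)"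
    "\<And>s y. (s, y) \<in> (I \<times> chart_image C) \<inter> U \<Longrightarrow> local_rep C (\<nu> s) y = N (s, y)"
    using ex_minimal_patch[OF kappa dim V C a x] by blast
  interpret minimal_patch \<kappa> I "chart_image C" U f N by (rule *(1))
  have "family_chart \<kappa> I C U f N \<Phi> \<nu>"
    by unfold_locales (auto simp: P_def intro: *(3,4))
  then show thesis using that *(2) a x by blast
qed

lemma parametric_field_extension:
  "\<exists>W g. open W \<and> x \<in> W \<and> smooth_open g W \<and> (\<forall>y\<in>chart_image C \<inter> W. g y = local_rep C (parametric_field \<kappa> I \<Phi> \<nu> a) y)"
proof -
  obtain U f N where *: "family_chart \<kappa> I C U f N \<Phi> \<nu>" and ax: "(a, x) \<in> (I \<times> chart_image C) \<inter> U"
    using ex_family_chart by blast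
  interpret family_chart \<kappa> I C U f N \<Phi> \<nu> by (rule *)
  have "open (Pair a -` U)" by (intro open_vimage U continuous_intros)
  moreover have "smooth_open (\<lambda>y. field tdir (a, y)) (Pair a -` U)"
    using Ck_on_open_slice[OF U] field_smooth by blast
  moreover have "field tdir (a, y) = local_rep C (parametric_field \<kappa> I \<Phi> \<nu> a) y" if "y \<in> chart_image C \<inter> Pair a -` U" for y
    using parametric_field_f[of a y] that a by (simp add: P_def)
  ultimately show ?thesis
    using ax by (intro exI[of _ "Pair a -` U"] exI[of _ "\<lambda>y. field tdir (a, y)"]) auto
qed

lemma parametric_field_Jacobi:
  "laplacian \<kappa> (local_rep C (\<Phi> a)) (local_rep C (parametric_field \<kappa> I \<Phi> \<nu> a)) x
    + (sff_norm2 \<kappa> (local_rep C (\<Phi> a)) (local_rep C (\<nu> a)) x + real CARD('n) * \<kappa>)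
      * local_rep C (parametric_field \<kappa> I \<Phi> \<nu> a) x = 0"
proof -
  obtain U f N where *: "family_chart \<kappa> I C U f N \<Phi> \<nu>" and ax: "(a, x) \<in> (I \<times> chart_image C) \<inter> U"
    using ex_family_chart by blast
  interpret family_chart \<kappa> I C U f N \<Phi> \<nu> by (rule *)
  have z: "(a, x) \<in> P" using ax by (simp add: P_def)
  have "laplacian \<kappa> (local_rep C (\<Phi> a)) (local_rep C (parametric_field \<kappa> I \<Phi> \<nu> a)) x = lap (field tdir) (a, x)"
    by (rule laplacian_f[OF z field_smooth]) (rule parametric_field_f)
  then show ?thesis
    using Jacobi_equation[OF z] unfolding sff_norm2_f[OF z] parametric_field_f[OF z] by simp
qed

text \<open>An instance of \<open>boundary_derivative\<close> in which C / s becomes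
  \<open>ct\<close>. What has to be supplied are the consequences of the free boundary condition:
  orthogonality at all nearby parameters, and the radial speed at a.\<close>

lemma parametric_field_boundary:
  assumes x0: "x $ nidx = 0"
  shows "push (local_rep C (parametric_field \<kappa> I \<Phi> \<nu> a)) x (conormal \<kappa> (local_rep C (\<Phi> a)) x)
      - ct \<kappa> (r a) * local_rep C (parametric_field \<kappa> I \<Phi> \<nu> a) x
    = vector_derivative r (at a within I) * sff_conormal \<kappa> (local_rep C (\<Phi> a)) (local_rep C (\<nu> a)) x"
proof -
  obtain U f N where *: "family_chart \<kappa> I C U f N \<Phi> \<nu>" and ax: "(a, x) \<in> (I \<times> chart_image C) \<inter> U"
    using ex_family_chart by blast
  interpret family_chart \<kappa> I C U f N \<Phi> \<nu> by (rule *)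
  have z: "(a, x) \<in> P" using ax by (simp add: P_def)
  have mfd: "smooth_manifold_with_boundary X atl" and rs: "smooth_on I r"
    and rpos: "\<And>s. s \<in> I \<Longrightarrow> 0 < r s" "\<And>s. s \<in> I \<Longrightarrow> \<kappa> = 1 \<Longrightarrow> r s < pi"
    and fb: "\<And>s. s \<in> I \<Longrightarrow> free_boundary_minimal_immersion \<kappa> p0 (r s) X atl (\<Phi> s)"
    using V unfolding variable_radius_family_def by blast+
  have dist: "geo_dist \<kappa> p0 (f (s, y)) = r s" and f_sp: "f (s, y) \<in> space_form \<kappa>"
    and grad: "is_gradient \<kappa> (geo_dist \<kappa> p0) (f (s, y))
      (\<Sum>i\<in>UNIV. (conormal \<kappa> (local_rep C (\<Phi> s)) y $ i) *\<^sub>R E i (s, y))"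
    if "(s, y) \<in> P" "y $ nidx = 0" for s y
  proof -
    have sy: "s \<in> I" "y \<in> chart_image C" using that(1) by (auto simp: P_def)
    have "\<Phi> s ` mfd_boundary X atl \<subseteq> geo_sphere \<kappa> p0 (r s)"
      using fb[OF sy(1)] unfolding free_boundary_minimal_immersion_def by blast
    then have "f (s, y) \<in> geo_sphere \<kappa> p0 (r s)"
      using boundary_chart_point[OF mfd C sy(2) that(2)] unfolding rep_f[OF that(1), symmetric] local_rep_def by blast
    moreover have "0 \<le> r s" "\<kappa> = 1 \<Longrightarrow> r s \<le> pi"
      using rpos[OF sy(1)] by (auto intro: less_imp_le)
    ultimately show "geo_dist \<kappa> p0 (f (s, y)) = r s" "f (s, y) \<in> space_form \<kappa>"
      using geo_sphere_dist[OF kappa p0] by blast+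
    show "is_gradient \<kappa> (geo_dist \<kappa> p0) (f (s, y))
      (\<Sum>i\<in>UNIV. (conormal \<kappa> (local_rep C (\<Phi> s)) y $ i) *\<^sub>R E i (s, y))"
      using fb[OF sy(1)] C sy(2) that(2) push_f[OF that(1)] rep_f[OF that(1)]
      unfolding free_boundary_minimal_immersion_def by metis
  qed
  have cov: "sn \<kappa> (r s) *\<^sub>R (\<Sum>i\<in>UNIV. (conormal \<kappa> (local_rep C (\<Phi> s)) y $ i) *\<^sub>R E i (s, y))
      = covariant \<kappa> (f (s, y)) (f (s, y) - p0)" if "(s, y) \<in> P" "y $ nidx = 0" for s y
    using gradient_geo_dist[OF kappa p0 f_sp[OF that] grad[OF that]] unfolding dist[OF that] .
  define c where "c = conormal \<kappa> (local_rep C (\<Phi> a)) x"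
  interpret fr: hypersurface_frame \<kappa> "f (a, x)" "N (a, x)" "\<lambda>i. E i (a, x)" by (rule frame[OF z])
  have "c $ nidx < 0 \<and> c \<bullet> (gm (a, x) *v c) = 1 \<and> (\<forall>v. v $ nidx = 0 \<longrightarrow> c \<bullet> (gm (a, x) *v v) = 0)"
    unfolding c_def conormal_def gmat_f[OF z]
    by (rule theI', rule conormal_unique[OF gm_invertible[OF z]])
      (rule fr.gram_symmetric[unfolded gram_eq[OF z]], rule fr.gram_pos[unfolded gram_eq[OF z]])
  then have c: "c $ nidx \<noteq> 0" "c \<bullet> (gm (a, x) *v c) = 1" "\<And>v. v $ nidx = 0 \<Longrightarrow> c \<bullet> (gm (a, x) *v v) = 0"
    by auto
  have sn: "sn \<kappa> (r a) \<noteq> 0" using sn_pos[of "r a" \<kappa>] rpos[OF a] by simp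
  have chord: "chord \<kappa> (r s) = mform \<kappa> (f (s, y) - p0) (f (s, y) - p0)" if "(s, y) \<in> P" "y $ nidx = 0" for s y
    using chord_geo_dist(1)[OF kappa p0 f_sp[OF that]] unfolding dist[OF that] .
  have "(\<Sum>i\<in>UNIV. c $ i * dd (sdir i) (field tdir) (a, x)) - cs \<kappa> (r a) / sn \<kappa> (r a) * field tdir (a, x)
    = vector_derivative r (at a within I) * (\<Sum>i\<in>UNIV. \<Sum>j\<in>UNIV. c $ i * c $ j * sf i j (a, x))"
  proof (rule boundary_derivative[OF z _ c _ sn])
    show "snd (a, x) $ nidx = 0" using x0 by simp
    show "sn \<kappa> (r a) *\<^sub>R (\<Sum>i\<in>UNIV. (c $ i) *\<^sub>R E i (a, x)) = covariant \<kappa> (f (a, x)) (f (a, x) - p0)"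
      unfolding c_def by (rule cov[OF z x0])
    \<comment> \<open>The tangential part of \<open>f y - p0\<close> is a multiple of the conormal,
      which N annihilates. The relation is shown for all parameters in P, so that it can be
      differentiated in the parameter.\<close>
    show "mform \<kappa> (N y) (f y - p0) = 0" if y: "y \<in> P" "snd y $ nidx = 0" for y
    proof -
      obtain s y' where sy: "y = (s, y')" by (cases y)
      have "covariant \<kappa> (f y) (f y - p0) = sn \<kappa> (r s) *\<^sub>R
          (\<Sum>i\<in>UNIV. (conormal \<kappa> (local_rep C (\<Phi> s)) y' $ i) *\<^sub>R E i y)"
        using cov[of s y', symmetric] y unfolding sy by simp
      then have "mform \<kappa> (N y) (covariant \<kappa> (f y) (f y - p0)) = 0"
        by (simp only: mform_simps(10,12) N_perp'[OF y(1)]) simp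
      then show ?thesis
        using mform_covariant[OF kappa N_tan'[OF y(1)]] mform_commute by metis
    qed
    \<comment> \<open>For \<kappa> = 0 both sides vanish; otherwise this is the chord identity
      expanded with both points having square \<kappa>.\<close>
    show "\<kappa> * mform \<kappa> (f (a, x) - p0) (f (a, x)) = 1 - cs \<kappa> (r a)"
    proof (cases "\<kappa> = 0")
      case False
      then have k: "\<kappa> \<in> {-1, 1}" using kappa by auto
      show ?thesis
        using chord[OF z x0] k
        by (auto simp: chord_def mform_simps mform_self[OF k p0] mform_self[OF k f_sp[OF z x0]]
            mform_commute[of _ "f (a, x)" p0])
    qed (simp add: cs_def)
    \<comment> \<open>The two sides of the chord identity are differentiated within I. A boundary
      point stays on the moving sphere, so the chord of r(s) has the derivative 2 \<open>sn\<close>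
      r', and the quadratic form gives twice the pairing with the velocity.\<close>
    show "mform \<kappa> (f (a, x) - p0) (dd tdir f (a, x)) = sn \<kappa> (r a) * vector_derivative r (at a within I)"
    proof -
      have "((\<lambda>s. f ((0, x) + s *\<^sub>R tdir)) has_vector_derivative dd tdir f ((0, x) + a *\<^sub>R tdir)) (at a)"
        by (rule has_vector_derivative_line) (use f_diff[OF z] in simp)
      then have "((\<lambda>s. f (s, x)) has_vector_derivative dd tdir f (a, x)) (at a)" by simp
      from has_vector_derivative_diff[OF has_vector_derivative_at_within[OF this] has_vector_derivative_const[of p0]]
      have "((\<lambda>s. f (s, x) - p0) has_vector_derivative dd tdir f (a, x)) (at a within I)" by simp
      from bounded_bilinear.has_vector_derivative[OF bounded_bilinear_mform[of \<kappa>] this this]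
      have d1: "((\<lambda>s. mform \<kappa> (f (s, x) - p0) (f (s, x) - p0)) has_vector_derivative
          2 * mform \<kappa> (f (a, x) - p0) (dd tdir f (a, x))) (at a within I)"
        by (simp add: mform_commute[of \<kappa> "dd tdir f (a, x)"])
      have "(r has_real_derivative vector_derivative r (at a within I)) (at a within I)"
        using smooth_on_real_differentiable[OF rs a] vector_derivative_works
        unfolding has_real_derivative_iff_has_vector_derivative by blast
      from DERIV_chain2[OF chord_derivative[OF kappa] this]
      have d2: "((\<lambda>s. chord \<kappa> (r s)) has_vector_derivative
          2 * sn \<kappa> (r a) * vector_derivative r (at a within I)) (at a within I)"
        by (simp add: has_real_derivative_iff_has_vector_derivative)
      obtain e where e: "0 < e" "\<And>t. \<bar>t\<bar> < e \<Longrightarrow> (a, x) + t *\<^sub>R tdir \<in> U"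
        using near_U[OF P_U[OF z]] by blast
      have "((\<lambda>s. mform \<kappa> (f (s, x) - p0) (f (s, x) - p0)) has_vector_derivative
          2 * sn \<kappa> (r a) * vector_derivative r (at a within I)) (at a within I)"
      proof (rule has_vector_derivative_transform_within[OF d2 e(1) a])
        fix s assume "s \<in> I" "dist s a < e"
        then have "(s, x) \<in> P" using e(2)[of "s - a"] z by (simp add: P_def dist_real_def)
        then show "chord \<kappa> (r s) = mform \<kappa> (f (s, x) - p0) (f (s, x) - p0)" by (rule chord[OF _ x0])
      qed
      from vector_derivative_unique_within[OF interval_at_within_not_bot[OF I a] d1 this]
      show ?thesis by simp
    qed
  qed
  moreover have "push (local_rep C (parametric_field \<kappa> I \<Phi> \<nu> a)) x c = (\<Sum>i\<in>UNIV. c $ i * dd (sdir i) (field tdir) (a, x))"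
    unfolding push_def
    using pd_rep[OF z smooth_open_differentiable[OF field_smooth P_U[OF z]] parametric_field_f] by simp
  moreover have "sff_conormal \<kappa> (local_rep C (\<Phi> a)) (local_rep C (\<nu> a)) x
      = (\<Sum>i\<in>UNIV. \<Sum>j\<in>UNIV. c $ i * c $ j * sf i j (a, x))"
    unfolding sff_conormal_def c_def[symmetric] inner_vec_def matrix_vector_mult_def
    by (simp add: sff_f[OF z] sum_distrib_left mult_ac)
  ultimately show ?thesis
    unfolding ct_eq[OF kappa] c_def parametric_field_f[OF z] by simp
qed

end

theorem theorem4p1:
  fixes \<kappa> :: real and p0 :: "real \<times> 'e::euclidean_space"
    and X :: "'a topology" and atl :: "('a, 'n::finite) chart set"
    and I :: "real set" and r :: "real \<Rightarrow> real"
    and \<Phi> \<nu> :: "real \<Rightarrow> 'a \<Rightarrow> real \<times> 'e" and a :: real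
  assumes "\<kappa> \<in> {-1, 0, 1}"
    and "DIM('e) = CARD('n) + 1"
    and "p0 \<in> space_form \<kappa>"
    and "variable_radius_family \<kappa> p0 X atl I r \<Phi> \<nu>"
    and "a \<in> I"
    and "sff_conormal_not_identically_zero \<kappa> atl (\<Phi> a) (\<nu> a)"
  shows "parametric_field \<kappa> I \<Phi> \<nu> a \<in> jacobi_robin_kernel \<kappa> atl (\<Phi> a) (\<nu> a) (r a)
    \<longleftrightarrow> vector_derivative r (at a within I) = 0"
proof
  note boundary = parametric_field_boundary[OF assms(1-5)]
  show "vector_derivative r (at a within I) = 0"
    if K: "parametric_field \<kappa> I \<Phi> \<nu> a \<in> jacobi_robin_kernel \<kappa> atl (\<Phi> a) (\<nu> a) (r a)"
  proof -
    \<comment> \<open>One boundary point suffices, since r' is the same number at all of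
      them.\<close>
    obtain C x where C: "C \<in> atl" "x \<in> chart_image C" "x $ nidx = 0"
      and "sff_conormal \<kappa> (local_rep C (\<Phi> a)) (local_rep C (\<nu> a)) x \<noteq> 0"
      using assms(6) unfolding sff_conormal_not_identically_zero_def by blast
    moreover have "push (local_rep C (parametric_field \<kappa> I \<Phi> \<nu> a)) x (conormal \<kappa> (local_rep C (\<Phi> a)) x)
        - ct \<kappa> (r a) * local_rep C (parametric_field \<kappa> I \<Phi> \<nu> a) x = 0"
      using K C unfolding jacobi_robin_kernel_def by blast
    ultimately show ?thesis using boundary[OF C] by simp
  qed
  show "parametric_field \<kappa> I \<Phi> \<nu> a \<in> jacobi_robin_kernel \<kappa> atl (\<Phi> a) (\<nu> a) (r a)"
    if r': "vector_derivative r (at a within I) = 0"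
    unfolding jacobi_robin_kernel_def smooth_on_mfd_def smooth_on_def
  proof (intro CollectI conjI ballI impI)
    fix C :: "('a, 'n) chart" and x assume C: "C \<in> atl" "x \<in> chart_image C"
    show "\<exists>U g. open U \<and> x \<in> U \<and> smooth_open g U \<and>
        (\<forall>y\<in>chart_image C \<inter> U. g y = local_rep C (parametric_field \<kappa> I \<Phi> \<nu> a) y)"
      by (rule parametric_field_extension[OF assms(1-5) C])
    show "laplacian \<kappa> (local_rep C (\<Phi> a)) (local_rep C (parametric_field \<kappa> I \<Phi> \<nu> a)) x
        + (sff_norm2 \<kappa> (local_rep C (\<Phi> a)) (local_rep C (\<nu> a)) x + real CARD('n) * \<kappa>)
          * local_rep C (parametric_field \<kappa> I \<Phi> \<nu> a) x = 0"
      by (rule parametric_field_Jacobi[OF assms(1-5) C])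
    show "push (local_rep C (parametric_field \<kappa> I \<Phi> \<nu> a)) x (conormal \<kappa> (local_rep C (\<Phi> a)) x)
        - ct \<kappa> (r a) * local_rep C (parametric_field \<kappa> I \<Phi> \<nu> a) x = 0" if "x $ nidx = 0"
      using boundary[OF C that] unfolding r' by simp
  qed
qed

end
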